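(* Let $k,\theta,\sigma>0$, let $H\in(\tfrac12,1)$, and assume the Feller condition $2k\theta>\sigma^2$. Let $M=B+B^H$, where $B$ is a one-dimensional standard Brownian motion and $B^H$ is an independent one-dimensional fractional Brownian motion with Hurst index $H$, and let $\mathbf{M}=(M,\mathbb{M}^{\mathrm{It\hat{o}}})$ be its Itô rough path lift. Let $(r_t)_{t\ge 0}$ be the process defined by the rough differential equation $$\mathrm{d}r_t=k(\theta-r_t)\,\mathrm{d}t+\sigma\sqrt{r_t}\,\mathrm{d}\mathbf{M}_t,\qquad r_0>0.$$ Then $(r_t)_{t\ge 0}$ is strictly positive almost surely, i.e. almost surely $r_t>0$ for all $t\ge 0$.
   Context: Write $X_{s,t}:=X_t-X_s$ for paths $X$. The Itô lift of $M=B+B^H$ is $\mathbf{M}=(M,\mathbb{M}^{\mathrm{It\hat{o}}})$ with $$\mathbb{M}^{\mathrm{It\hat{o}}}_{s,t}=\int_s^t M_{s,r}\,\mathrm{d}M_r=\int_s^t B_{s,r}\,\mathrm{d}B_r+\int_s^t B^H_{s,r}\,\mathrm{d}B_r+\int_s^t B_{s,r}\,\mathrm{d}B^H_r+\int_s^t B^H_{s,r}\,\mathrm{d}B^H_r,$$ where the first integral is an Itô integral and the other three are pathwise Young integrals (well defined since $H>1/2$). For every $T>0$ and $\alpha\in(\tfrac13,\tfrac12)$, almost surely $\mathbf{M}$ is an $\alpha$-Hölder rough path on $[0,T]$. Meaning of the equation: $r$ is a continuous nonnegative process with initial value $r_0>0$ which satisfies the equation, in the sense of controlled rough paths, up to its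 first hitting time $\tau=\inf\{t>0:r_t=0\}$ of zero (with $\inf\emptyset=\infty$). That is, almost surely, on every interval $[0,t]$ with $t<\tau$, $r$ is a path controlled by $M$ with Gubinelli derivative $\sigma\sqrt{r}$, and $$r_t=r_0+\int_0^t k(\theta-r_u)\,\mathrm{d}u+\int_0^t\sigma\sqrt{r_u}\,\mathrm{d}\mathbf{M}_u,$$ where the last integral is the rough integral of the controlled path $(\sigma\sqrt{r},\tfrac{\sigma^2}{2})$ (the second component being the Gubinelli derivative of $\sigma\sqrt r$), i.e. the limit of $\sum_{[u,v]\in\pi}\big(\sigma\sqrt{r_u}\,M_{u,v}+\tfrac{\sigma^2}{2}\mathbb{M}^{\mathrm{It\hat{o}}}_{u,v}\big)$ over partitions $\pi$ of $[0,t]$ as the mesh tends to $0$. Strict positivity means $\tau=\infty$ almost surely. *)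

theory Defs
  imports "HOL-Probability.Probability"
begin

text \<open>Throughout, a real-valued process indexed by \<open>[0,\<infinity>)\<close> is a function \<open>X :: real \<Rightarrow> 'w \<Rightarrow> real\<close>;
  its values at negative times play no role.\<close>

section \<open>Brownian motion and fractional Brownian motion\<close>

definition continuous_process :: "'w measure \<Rightarrow> (real \<Rightarrow> 'w \<Rightarrow> real) \<Rightarrow> bool" where
  "continuous_process P X \<longleftrightarrow>
     (\<forall>t\<ge>0. X t \<in> borel_measurable P) \<and> (AE \<omega> in P. continuous_on {0..} (\<lambda>t. X t \<omega>))"

definition standard_brownian_motion :: "'w measure \<Rightarrow> (real \<Rightarrow> 'w \<Rightarrow> real) \<Rightarrow> bool" where
  "standard_brownian_motion P B \<longleftrightarrow>
     continuous_process P B \<and>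
     (AE \<omega> in P. B 0 \<omega> = 0) \<and>
     (\<forall>s t. 0 \<le> s \<and> s < t \<longrightarrow>
        distributed P lborel (\<lambda>\<omega>. B t \<omega> - B s \<omega>) (\<lambda>x. ennreal (normal_density 0 (sqrt (t - s)) x))) \<and>
     (\<forall>(n::nat) p. 0 \<le> p 0 \<and> (\<forall>i<n. p i < p (Suc i)) \<longrightarrow>
        prob_space.indep_vars P (\<lambda>_. borel) (\<lambda>i \<omega>. B (p (Suc i)) \<omega> - B (p i) \<omega>) {..<n})"

text \<open>Degenerate (almost surely constant) variables count as Gaussian; they have no density.\<close>

definition gaussian_variable :: "'w measure \<Rightarrow> ('w \<Rightarrow> real) \<Rightarrow> bool" where
  "gaussian_variable P X \<longleftrightarrow> X \<in> borel_measurable P \<and>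
     (\<exists>m. (AE \<omega> in P. X \<omega> = m) \<or>
          (\<exists>s>0. distributed P lborel X (\<lambda>x. ennreal (normal_density m s x))))"

definition gaussian_process :: "'w measure \<Rightarrow> (real \<Rightarrow> 'w \<Rightarrow> real) \<Rightarrow> bool" where
  "gaussian_process P X \<longleftrightarrow>
     (\<forall>S c. finite S \<and> S \<subseteq> {0..} \<longrightarrow> gaussian_variable P (\<lambda>\<omega>. \<Sum>t\<in>S. c t * X t \<omega>))"

definition fractional_brownian_motion :: "'w measure \<Rightarrow> real \<Rightarrow> (real \<Rightarrow> 'w \<Rightarrow> real) \<Rightarrow> bool" where
  "fractional_brownian_motion P H X \<longleftrightarrow>
     continuous_process P X \<and> gaussian_process P X \<and>
     (\<forall>t\<ge>0. (\<integral>\<omega>. X t \<omega> \<partial>P) = 0) \<and>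
     (\<forall>s\<ge>0. \<forall>t\<ge>0. (\<integral>\<omega>. X s \<omega> * X t \<omega> \<partial>P) =
        (s powr (2 * H) + t powr (2 * H) - \<bar>t - s\<bar> powr (2 * H)) / 2)"

text \<open>Independence of the whole paths, i.e. of the \<open>\<sigma>\<close>-algebras they generate.\<close>

definition independent_processes ::
  "'w measure \<Rightarrow> (real \<Rightarrow> 'w \<Rightarrow> real) \<Rightarrow> (real \<Rightarrow> 'w \<Rightarrow> real) \<Rightarrow> bool" where
  "independent_processes P X Y \<longleftrightarrow>
     prob_space.indep_var P
       (PiM {0..} (\<lambda>_. borel)) (\<lambda>\<omega>. \<lambda>t\<in>{0..}. X t \<omega>)
       (PiM {0..} (\<lambda>_. borel)) (\<lambda>\<omega>. \<lambda>t\<in>{0..}. Y t \<omega>)"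


section \<open>Limits along partitions, Young and rough integrals\<close>

text \<open>\<open>a = p 0 < \<dots> < p n = b\<close>; the degenerate interval \<open>a = b\<close> has only the partition with \<open>n = 0\<close>.\<close>

definition is_partition :: "real \<Rightarrow> real \<Rightarrow> nat \<Rightarrow> (nat \<Rightarrow> real) \<Rightarrow> bool" where
  "is_partition a b n p \<longleftrightarrow> p 0 = a \<and> p n = b \<and> (\<forall>i<n. p i < p (Suc i))"

definition has_mesh_limit :: "(real \<Rightarrow> real \<Rightarrow> real) \<Rightarrow> real \<Rightarrow> real \<Rightarrow> real \<Rightarrow> bool" where
  "has_mesh_limit \<Xi> a b L \<longleftrightarrow>
     (\<forall>\<epsilon>>0. \<exists>\<delta>>0. \<forall>n p. is_partition a b n p \<and> (\<forall>i<n. p (Suc i) - p i < \<delta>) \<longrightarrow>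
        \<bar>(\<Sum>i<n. \<Xi> (p i) (p (Suc i))) - L\<bar> < \<epsilon>)"

definition holder_on :: "real \<Rightarrow> real set \<Rightarrow> (real \<Rightarrow> real) \<Rightarrow> bool" where
  "holder_on \<alpha> S f \<longleftrightarrow> (\<exists>C. \<forall>s\<in>S. \<forall>t\<in>S. \<bar>f t - f s\<bar> \<le> C * \<bar>t - s\<bar> powr \<alpha>)"

definition has_young_integral ::
  "(real \<Rightarrow> real) \<Rightarrow> (real \<Rightarrow> real) \<Rightarrow> real \<Rightarrow> real \<Rightarrow> real \<Rightarrow> bool" where
  "has_young_integral f g a b L \<longleftrightarrow>
     (\<exists>\<alpha>>0. \<exists>\<beta>>0. \<alpha> + \<beta> > 1 \<and> holder_on \<alpha> {a..b} f \<and> holder_on \<beta> {a..b} g) \<and>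
     has_mesh_limit (\<lambda>u v. f u * (g v - g u)) a b L"

definition rough_path :: "real \<Rightarrow> real \<Rightarrow> (real \<Rightarrow> real) \<Rightarrow> (real \<Rightarrow> real \<Rightarrow> real) \<Rightarrow> bool" where
  "rough_path \<alpha> T X XX \<longleftrightarrow>
     holder_on \<alpha> {0..T} X \<and>
     (\<exists>C. \<forall>s t. 0 \<le> s \<and> s \<le> t \<and> t \<le> T \<longrightarrow> \<bar>XX s t\<bar> \<le> C * (t - s) powr (2 * \<alpha>)) \<and>
     (\<forall>s u t. 0 \<le> s \<and> s \<le> u \<and> u \<le> t \<and> t \<le> T \<longrightarrow>
        XX s t = XX s u + XX u t + (X u - X s) * (X t - X u))"

text \<open>\<open>Y\<close> is controlled by \<open>X\<close> on \<open>[0,T]\<close> with Gubinelli derivative \<open>Y'\<close>.\<close>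

definition controlled_path ::
  "real \<Rightarrow> real \<Rightarrow> (real \<Rightarrow> real) \<Rightarrow> (real \<Rightarrow> real) \<Rightarrow> (real \<Rightarrow> real) \<Rightarrow> bool" where
  "controlled_path \<alpha> T X Y Y' \<longleftrightarrow>
     holder_on \<alpha> {0..T} Y \<and> holder_on \<alpha> {0..T} Y' \<and>
     (\<exists>C. \<forall>s t. 0 \<le> s \<and> s \<le> t \<and> t \<le> T \<longrightarrow>
        \<bar>(Y t - Y s) - Y' s * (X t - X s)\<bar> \<le> C * (t - s) powr (2 * \<alpha>))"

definition has_rough_integral ::
  "real \<Rightarrow> real \<Rightarrow> (real \<Rightarrow> real) \<Rightarrow> (real \<Rightarrow> real \<Rightarrow> real) \<Rightarrow> (real \<Rightarrow> real) \<Rightarrow> (real \<Rightarrow> real) \<Rightarrow> real \<Rightarrow> bool"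
  where
  "has_rough_integral \<alpha> T X XX Y Y' L \<longleftrightarrow>
     controlled_path \<alpha> T X Y Y' \<and>
     has_mesh_limit (\<lambda>u v. Y u * (X v - X u) + Y' u * XX u v) 0 T L"


section \<open>The Ito integral\<close>

definition natural_filtration :: "'w measure \<Rightarrow> (real \<Rightarrow> 'w \<Rightarrow> real) \<Rightarrow> real \<Rightarrow> 'w measure" where
  "natural_filtration P X t =
     vimage_algebra (space P) (\<lambda>\<omega>. \<lambda>u\<in>{0..t}. X u \<omega>) (PiM {0..t} (\<lambda>_. borel))"

text \<open>The data \<open>(n, p, \<xi>)\<close> of the simple adapted integrand \<open>\<Sum>i<n. \<xi> i \<cdot> 1\<close> on \<open>(p i, p (i+1)]\<close>.\<close>

definition simple_integrand ::
  "'w measure \<Rightarrow> (real \<Rightarrow> 'w measure) \<Rightarrow> real \<Rightarrow> real \<Rightarrow> nat \<Rightarrow> (nat \<Rightarrow> real) \<Rightarrow> (nat \<Rightarrow> 'w \<Rightarrow> real) \<Rightarrow> bool"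
  where
  "simple_integrand P F a b n p \<xi> \<longleftrightarrow>
     is_partition a b n p \<and>
     (\<forall>i<n. \<xi> i \<in> borel_measurable (F (p i)) \<and> (\<exists>C. \<forall>\<omega>\<in>space P. \<bar>\<xi> i \<omega>\<bar> \<le> C))"

definition step_process :: "nat \<Rightarrow> (nat \<Rightarrow> real) \<Rightarrow> (nat \<Rightarrow> 'w \<Rightarrow> real) \<Rightarrow> real \<Rightarrow> 'w \<Rightarrow> real" where
  "step_process n p \<xi> u \<omega> = (\<Sum>i<n. \<xi> i \<omega> * indicator {p i<..p (Suc i)} u)"

definition step_integral ::
  "(real \<Rightarrow> 'w \<Rightarrow> real) \<Rightarrow> nat \<Rightarrow> (nat \<Rightarrow> real) \<Rightarrow> (nat \<Rightarrow> 'w \<Rightarrow> real) \<Rightarrow> 'w \<Rightarrow> real" where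
  "step_integral B n p \<xi> \<omega> = (\<Sum>i<n. \<xi> i \<omega> * (B (p (Suc i)) \<omega> - B (p i) \<omega>))"

text \<open>\<open>I\<close> is (a version of) the integral over \<open>[a,b]\<close> of \<open>Y\<close> against the Brownian motion \<open>B\<close>: the
  \<open>L\<^sup>2(P)\<close> limit of the integrals of simple adapted integrands that approximate \<open>Y\<close> in
  \<open>L\<^sup>2(du \<otimes> P)\<close>. The expectation is taken inside the time integral so that no joint measurability
  of processes whose paths are only almost surely continuous is needed.\<close>

definition has_ito_integral ::
  "'w measure \<Rightarrow> (real \<Rightarrow> 'w measure) \<Rightarrow> (real \<Rightarrow> 'w \<Rightarrow> real) \<Rightarrow> (real \<Rightarrow> 'w \<Rightarrow> real) \<Rightarrow>
     real \<Rightarrow> real \<Rightarrow> ('w \<Rightarrow> real) \<Rightarrow> bool" where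
  "has_ito_integral P F B Y a b I \<longleftrightarrow>
     I \<in> borel_measurable P \<and>
     (\<exists>n p \<xi>. (\<forall>m. simple_integrand P F a b (n m) (p m) (\<xi> m)) \<and>
        (\<lambda>m::nat. \<integral>\<^sup>+u\<in>{a..b}. (\<integral>\<^sup>+\<omega>. ennreal ((step_process (n m) (p m) (\<xi> m) u \<omega> - Y u \<omega>)\<^sup>2) \<partial>P) \<partial>lborel)
          \<longlonglongrightarrow> 0 \<and>
        (\<lambda>m. \<integral>\<^sup>+\<omega>. ennreal ((step_integral B (n m) (p m) (\<xi> m) \<omega> - I \<omega>)\<^sup>2) \<partial>P) \<longlonglongrightarrow> 0)"


section \<open>The Ito lift and the rough differential equation\<close>

text \<open>The stochastic integral is only determined up to a null set depending on \<open>(s,t)\<close>. The second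
  clause selects the version of the second level (unique up to indistinguishability) for which
  almost every \<open>(M, MM)\<close> is a rough path.\<close>

definition ito_rough_lift ::
  "'w measure \<Rightarrow> (real \<Rightarrow> 'w \<Rightarrow> real) \<Rightarrow> (real \<Rightarrow> 'w \<Rightarrow> real) \<Rightarrow> (real \<Rightarrow> real \<Rightarrow> 'w \<Rightarrow> real) \<Rightarrow> bool" where
  "ito_rough_lift P B BH MM \<longleftrightarrow>
     (\<forall>s t. 0 \<le> s \<and> s \<le> t \<longrightarrow>
        (\<exists>I. has_ito_integral P (natural_filtration P B) B (\<lambda>u \<omega>. B u \<omega> - B s \<omega>) s t I \<and>
          (AE \<omega> in P. \<exists>J1 J2 J3.
             has_young_integral (\<lambda>u. BH u \<omega> - BH s \<omega>) (\<lambda>u. B u \<omega>) s t J1 \<and>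
             has_young_integral (\<lambda>u. B u \<omega> - B s \<omega>) (\<lambda>u. BH u \<omega>) s t J2 \<and>
             has_young_integral (\<lambda>u. BH u \<omega> - BH s \<omega>) (\<lambda>u. BH u \<omega>) s t J3 \<and>
             MM s t \<omega> = I \<omega> + J1 + J2 + J3))) \<and>
     (\<forall>T>0. \<forall>\<alpha>. 1/3 < \<alpha> \<and> \<alpha> < 1/2 \<longrightarrow>
        (AE \<omega> in P. rough_path \<alpha> T (\<lambda>t. B t \<omega> + BH t \<omega>) (\<lambda>s t. MM s t \<omega>)))"

definition zero_hitting_time :: "(real \<Rightarrow> 'w \<Rightarrow> real) \<Rightarrow> 'w \<Rightarrow> ereal" where
  "zero_hitting_time r \<omega> = Inf {ereal t | t. 0 < t \<and> r t \<omega> = 0}"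

definition solves_rde_until_zero ::
  "'w measure \<Rightarrow> real \<Rightarrow> real \<Rightarrow> real \<Rightarrow> real \<Rightarrow> real \<Rightarrow>
     (real \<Rightarrow> 'w \<Rightarrow> real) \<Rightarrow> (real \<Rightarrow> real \<Rightarrow> 'w \<Rightarrow> real) \<Rightarrow> (real \<Rightarrow> 'w \<Rightarrow> real) \<Rightarrow> bool" where
  "solves_rde_until_zero P \<alpha> k \<theta> \<sigma> r0 M MM r \<longleftrightarrow>
     continuous_process P r \<and>
     (AE \<omega> in P. \<forall>t\<ge>0. r t \<omega> \<ge> 0) \<and>
     (AE \<omega> in P. r 0 \<omega> = r0) \<and>
     (AE \<omega> in P. \<forall>t\<ge>0. ereal t < zero_hitting_time r \<omega> \<longrightarrow>
        controlled_path \<alpha> t (\<lambda>u. M u \<omega>) (\<lambda>u. r u \<omega>) (\<lambda>u. \<sigma> * sqrt (r u \<omega>)) \<and>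
        (\<exists>J. has_rough_integral \<alpha> t (\<lambda>u. M u \<omega>) (\<lambda>u v. MM u v \<omega>)
               (\<lambda>u. \<sigma> * sqrt (r u \<omega>)) (\<lambda>u. \<sigma>\<^sup>2 / 2) J \<and>
             r t \<omega> = r0 + integral {0..t} (\<lambda>u. k * (\<theta> - r u \<omega>)) + J))"

end

theory Submission
  imports Defs
begin

text \<open>
  Put \<open>X = 2 \<surd>r / \<sigma>\<close>. The Ito lift satisfies \<open>2 MM s t = (M t - M s)\<^sup>2 - (t - s)\<close>, that is, \<open>M\<close> has
  bracket \<open>t\<close>, because the only Ito integral in it is that of \<open>B\<close> against itself and the Young integrals
  obey the classical product rule. With this bracket the rough equation turns, path by path and
  up to the hitting time, into a Bessel equation with additive noise,
  \<open>dX = (A / X - k X / 2) dt + dB + dB\<^sup>H\<close> with \<open>A = 2k\<theta>/\<sigma>\<^sup>2 - 1/2\<close> (\<open>sqrt_solves_bessel_equation\<close>,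
  \<open>ito_rough_lift_formula\<close>). The Feller condition says \<open>A > 1/2\<close>: the Bessel dimension \<open>d = 2A + 1\<close>
  exceeds \<open>2\<close>.

  The path \<open>h = B\<^sup>H\<close> is independent of \<open>B\<close>, so it may be regarded as frozen, and it is \<open>\<gamma>\<close>-Hoelder with
  some \<open>\<gamma> > 1/2\<close>. Over a time span \<open>s\<close> it therefore moves by \<open>s\<^sup>\<gamma>\<close>, far less than the
  fluctuation \<open>\<surd>s\<close> of \<open>B\<close>. To exploit this, fix a target time \<open>T\<close>, let \<open>s = T + \<epsilon> - t\<close> be the time left
  and consider the potential \<open>s\<^sup>-\<^sup>D\<^sup>/\<^sup>2 exp (- W\<^sup>2 / (2\<rho>s))\<close> with \<open>W = X + h T - h t + K s\<^sup>\<gamma>\<close>. For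
  \<open>D = d\<close>, \<open>\<rho> = 1\<close> and \<open>W = X\<close> this is the heat kernel of the Bessel process at the origin, a martingale.
  Shifting by \<open>h T - h t\<close> removes the rough drift altogether, adding \<open>K s\<^sup>\<gamma>\<close> makes \<open>W \<ge> X\<close>, so that the
  repulsion \<open>A / X\<close> is at least \<open>A / W\<close>, and the price \<open>K \<gamma> s\<^sup>\<gamma>\<^sup>-\<^sup>1\<close> for the smooth shift is absorbed, when \<open>s\<close> is
  small, by the room left in \<open>2 < D\<close>, \<open>1 < \<rho>\<close>, \<open>\<rho> D < d\<close>. So the potential is a supermartingale
  on the last short stretch before \<open>T\<close> (\<open>potential_step\<close>). It starts bounded, and it is of order
  \<open>\<epsilon>\<^sup>-\<^sup>D\<^sup>/\<^sup>2\<close> if \<open>X\<close> comes as low as \<open>\<surd>\<epsilon>\<close> during \<open>[T - \<epsilon>, T]\<close>. Hence such a visit has probability at most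
  \<open>C \<epsilon>\<^sup>D\<^sup>/\<^sup>2\<close> (\<open>block_probability\<close>), and the \<open>O (1/\<epsilon>)\<close> blocks that cover a bounded time horizon contribute
  \<open>O (\<epsilon>\<^sup>D\<^sup>/\<^sup>2\<^sup>-\<^sup>1)\<close> in total, which vanishes as \<open>\<epsilon> \<rightarrow> 0\<close> because \<open>D > 2\<close>.

  The estimate is made for an Euler scheme on a grid of mesh \<open>\<delta> = \<epsilon> / n\<close>, where
  conditional expectations are explicit Gaussian integrals. The scheme uses the drift at \<open>x + \<surd>\<epsilon>\<close>
  instead of \<open>x\<close>; it then stays below \<open>X\<close> as soon as \<open>X\<close> oscillates by less than \<open>\<surd>\<epsilon>\<close> within
  each step (\<open>euler_below_path\<close>), which almost surely holds for all large \<open>n\<close>. So if \<open>X\<close> hits zero, the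
  schemes of all fine meshes reach the level \<open>\<surd>\<epsilon>\<close>, for every \<open>\<epsilon>\<close>, an event of probability zero.
\<close>


section \<open>Mesh limits and the sewing estimate\<close>

lemma has_mesh_limitE:
  assumes "has_mesh_limit \<Xi> a b L" "e > 0"
  obtains \<delta> where "\<delta> > 0" "\<forall>n p. is_partition a b n p \<and> (\<forall>i<n. p (Suc i) - p i < \<delta>) \<longrightarrow>
    \<bar>(\<Sum>i<n. \<Xi> (p i) (p (Suc i))) - L\<bar> < e"
proof -
  have "\<exists>\<delta>>0. \<forall>n p. is_partition a b n p \<and> (\<forall>i<n. p (Suc i) - p i < \<delta>) \<longrightarrow>
        \<bar>(\<Sum>i<n. \<Xi> (p i) (p (Suc i))) - L\<bar> < e"
    using assms(1)[unfolded has_mesh_limit_def, THEN spec[where x = e], THEN mp, OF assms(2)] .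
  then show ?thesis by (elim exE conjE) (rule that)
qed

lemma sum_pairs: "(\<Sum>i<2 * (m::nat). f i) = (\<Sum>i<m. f (2 * i) + f (Suc (2 * i)) :: real)"
  by (induction m) auto

text \<open>Dyadic refinement: passing from level \<open>n\<close> to \<open>n + 1\<close> changes the Riemann sum by at most \<open>2\<^sup>n\<close> defects of size
\<open>C ((b - a) / 2\<^sup>n)\<^sup>\<eta>\<close>, and \<open>\<eta> > 1\<close> makes these changes a convergent geometric series.\<close>

lemma sewing_bound:
  fixes \<Xi> :: "real \<Rightarrow> real \<Rightarrow> real"
  assumes "a < b" "\<eta> > 1"
    and defect: "\<And>u v. a \<le> u \<Longrightarrow> u \<le> v \<Longrightarrow> v \<le> b \<Longrightarrow>
      \<bar>\<Xi> u v - \<Xi> u ((u + v) / 2) - \<Xi> ((u + v) / 2) v\<bar> \<le> C * (v - u) powr \<eta>"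
    and lim: "has_mesh_limit \<Xi> a b L"
  shows "\<bar>L - \<Xi> a b\<bar> \<le> C / (1 - 2 powr (1 - \<eta>)) * (b - a) powr \<eta>"
proof -
  define q :: real where "q = 2 powr (1 - \<eta>)"
  have q: "0 < q" "q < 1" using assms(2) by (auto simp: q_def intro: powr_less_one)
  define p :: "nat \<Rightarrow> nat \<Rightarrow> real" where "p n i = a + (b - a) * real i / 2 ^ n" for n i
  define S where "S n = (\<Sum>i<2 ^ n. \<Xi> (p n i) (p n (Suc i)))" for n
  have C: "C \<ge> 0"
  proof -
    have "0 \<le> C * (b - a) powr \<eta>" using defect[of a b] assms(1) by linarith
    then show ?thesis using assms(1) by (simp add: zero_le_mult_iff)
  qed
  have p_half: "p (Suc n) (2 * i) = p n i" "p (Suc n) (Suc (2 * i)) = (p n i + p n (Suc i)) / 2" for n i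
    by (auto simp: p_def field_simps)
  have p_half_Suc: "p (Suc n) (Suc (Suc (2 * i))) = p n (Suc i)" for n i
    using p_half(1)[of n "Suc i"] by simp
  have p_mono: "p n i < p n (Suc i)" for n i
    using assms(1) by (auto simp: p_def field_simps)
  have p_diff: "p n (Suc i) - p n i = (b - a) / 2 ^ n" for n i
    by (auto simp: p_def field_simps)
  have p_in: "a \<le> p n i" "i \<le> 2 ^ n \<Longrightarrow> p n i \<le> b" for n i
  proof -
    show "a \<le> p n i" using assms(1) by (auto simp: p_def)
    assume "i \<le> 2 ^ n"
    then have "real i \<le> 2 ^ n" by (metis of_nat_le_iff of_nat_numeral of_nat_power)
    then have "(b - a) * (real i / 2 ^ n) \<le> (b - a) * 1"
      using assms(1) by (intro mult_left_mono) auto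
    then show "p n i \<le> b" by (simp add: p_def)
  qed
  have step: "\<bar>S (Suc n) - S n\<bar> \<le> C * (b - a) powr \<eta> * q ^ n" for n
  proof -
    have "S (Suc n) = (\<Sum>i<2 ^ n. \<Xi> (p (Suc n) (2 * i)) (p (Suc n) (Suc (2 * i)))
        + \<Xi> (p (Suc n) (Suc (2 * i))) (p (Suc n) (Suc (Suc (2 * i)))))"
      unfolding S_def power_Suc by (rule sum_pairs)
    also have "\<dots> = (\<Sum>i<2 ^ n. \<Xi> (p n i) ((p n i + p n (Suc i)) / 2)
        + \<Xi> ((p n i + p n (Suc i)) / 2) (p n (Suc i)))"
      by (simp only: p_half p_half_Suc)
    finally have "S n - S (Suc n) = (\<Sum>i<2 ^ n. \<Xi> (p n i) (p n (Suc i))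
        - \<Xi> (p n i) ((p n i + p n (Suc i)) / 2) - \<Xi> ((p n i + p n (Suc i)) / 2) (p n (Suc i)))"
      unfolding S_def by (simp add: sum_subtractf sum.distrib)
    also have "\<bar>\<dots>\<bar> \<le> (\<Sum>i<(2::nat) ^ n. C * ((b - a) / 2 ^ n) powr \<eta>)"
    proof (rule order_trans[OF sum_abs sum_mono])
      fix i assume "i \<in> {..<(2::nat) ^ n}"
      then show "\<bar>\<Xi> (p n i) (p n (Suc i)) - \<Xi> (p n i) ((p n i + p n (Suc i)) / 2)
          - \<Xi> ((p n i + p n (Suc i)) / 2) (p n (Suc i))\<bar> \<le> C * ((b - a) / 2 ^ n) powr \<eta>"
        using defect[of "p n i" "p n (Suc i)"] p_in[of n i] p_in[of "Suc i" n] p_in(2)[of "Suc i" n]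
          p_mono[of n i] by (simp add: p_diff)
    qed
    also have "\<dots> = C * (b - a) powr \<eta> * (2 ^ n / (2 ^ n) powr \<eta>)"
      using assms(1) by (simp add: powr_divide)
    also have "(2 ^ n / (2 ^ n) powr \<eta> :: real) = (2 ^ n) powr (1 - \<eta>)"
      by (simp add: powr_diff)
    also have "\<dots> = q ^ n"
      by (simp add: q_def powr_realpow[symmetric] powr_powr mult.commute)
    finally show ?thesis by (simp add: abs_minus_commute)
  qed
  have bound: "\<bar>S n - S 0\<bar> \<le> C * (b - a) powr \<eta> / (1 - q)" for n
  proof -
    have "\<bar>S n - S 0\<bar> = \<bar>\<Sum>i<n. S (Suc i) - S i\<bar>" by (simp add: sum_lessThan_telescope)
    also have "\<dots> \<le> (\<Sum>i<n. C * (b - a) powr \<eta> * q ^ i)"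
      by (rule order_trans[OF sum_abs sum_mono]) (rule step)
    also have "\<dots> = C * (b - a) powr \<eta> * (\<Sum>i<n. q ^ i)" by (simp add: sum_distrib_left)
    also have "\<dots> \<le> C * (b - a) powr \<eta> * (1 / (1 - q))"
    proof (rule mult_left_mono)
      have "(\<Sum>i<n. q ^ i) = (1 - q ^ n) / (1 - q)" using q by (simp add: sum_gp_strict)
      then show "(\<Sum>i<n. q ^ i) \<le> 1 / (1 - q)" using q by (simp add: divide_right_mono)
    qed (use C in simp)
    finally show ?thesis by (simp only: times_divide_eq_right mult_1_right)
  qed
  have "S \<longlonglongrightarrow> L"
  proof (rule LIMSEQ_I)
    fix e :: real assume e: "e > 0"
    obtain \<delta> where \<delta>: "\<delta> > 0" "\<forall>n p. is_partition a b n p \<and> (\<forall>i<n. p (Suc i) - p i < \<delta>) \<longrightarrow>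
        \<bar>(\<Sum>i<n. \<Xi> (p i) (p (Suc i))) - L\<bar> < e"
      by (rule has_mesh_limitE[OF lim e]) (rule that)
    have "(\<lambda>n. (b - a) / 2 ^ n) \<longlonglongrightarrow> 0"
      by (rule LIMSEQ_divide_realpow_zero) simp
    then have "eventually (\<lambda>n. (b - a) / 2 ^ n < \<delta>) sequentially"
      using \<delta>(1) by (rule order_tendstoD)
    then obtain N where N: "\<And>n. n \<ge> N \<Longrightarrow> (b - a) / 2 ^ n < \<delta>"
      by (auto simp: eventually_sequentially)
    have "norm (S n - L) < e" if "n \<ge> N" for n
      unfolding S_def real_norm_def
    proof (rule \<delta>(2)[rule_format, OF conjI], goal_cases)
      case 1
      show ?case unfolding is_partition_def using p_mono by (simp add: p_def)
    next
      case 2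
      show ?case using N[OF that] by (simp add: p_diff)
    qed
    then show "\<exists>no. \<forall>n\<ge>no. norm (S n - L) < e" by blast
  qed
  then have "(\<lambda>n. \<bar>S n - S 0\<bar>) \<longlonglongrightarrow> \<bar>L - S 0\<bar>" by (intro tendsto_intros)
  then have "\<bar>L - S 0\<bar> \<le> C * (b - a) powr \<eta> / (1 - q)"
    by (rule LIMSEQ_le_const2) (use bound in blast)
  moreover have "S 0 = \<Xi> a b" by (simp add: S_def p_def)
  ultimately show ?thesis by (simp add: q_def)
qed

lemma fine_partition_exists:
  assumes "a \<le> b" "\<delta> > 0"
  obtains n p where "is_partition a b n p" "\<And>i. i < n \<Longrightarrow> p (Suc i) - p i < \<delta>"
proof (cases "a = b")
  case True
  show ?thesis by (rule that[of 0 "\<lambda>_. a"]) (auto simp: True is_partition_def)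
next
  case False
  then have ab: "a < b" using assms by simp
  obtain n :: nat where n: "(b - a) / \<delta> < real n" using reals_Archimedean2 by blast
  have n0: "real n > 0" using n ab assms(2) by (smt (verit) divide_pos_pos)
  show ?thesis
  proof (rule that[of n "\<lambda>i. a + (b - a) * real i / real n"])
    show "is_partition a b n (\<lambda>i. a + (b - a) * real i / real n)"
      using ab n0 by (auto simp: is_partition_def divide_strict_right_mono)
    show "a + (b - a) * real (Suc i) / real n - (a + (b - a) * real i / real n) < \<delta>" for i
    proof -
      have "a + (b - a) * real (Suc i) / real n - (a + (b - a) * real i / real n) = (b - a) / real n"
        using n0 by (simp add: field_simps)
      also have "\<dots> < \<delta>" using n n0 assms(2) by (simp add: pos_divide_less_eq mult.commute)
      finally show ?thesis .
    qed
  qed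
qed

text \<open>Any partition of \<open>[b,c]\<close> may be preceded by one fixed fine partition of \<open>[a,b]\<close>. This localises an
integral that is only given on intervals starting at \<open>0\<close>.\<close>

lemma has_mesh_limit_split:
  assumes "a \<le> b" and L1: "has_mesh_limit \<Xi> a b L1" and L2: "has_mesh_limit \<Xi> a c L2"
  shows "has_mesh_limit \<Xi> b c (L2 - L1)"
  unfolding has_mesh_limit_def
proof (intro allI impI)
  fix e :: real assume "e > 0"
  then have e: "e / 2 > 0" by simp
  obtain \<delta>1 where \<delta>1: "\<delta>1 > 0" "\<forall>n p. is_partition a b n p \<and> (\<forall>i<n. p (Suc i) - p i < \<delta>1) \<longrightarrow>
        \<bar>(\<Sum>i<n. \<Xi> (p i) (p (Suc i))) - L1\<bar> < e / 2"
    by (rule has_mesh_limitE[OF L1 e]) (rule that)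
  obtain \<delta>2 where \<delta>2: "\<delta>2 > 0" "\<forall>n p. is_partition a c n p \<and> (\<forall>i<n. p (Suc i) - p i < \<delta>2) \<longrightarrow>
        \<bar>(\<Sum>i<n. \<Xi> (p i) (p (Suc i))) - L2\<bar> < e / 2"
    by (rule has_mesh_limitE[OF L2 e]) (rule that)
  obtain n p where p: "is_partition a b n p" "\<And>i. i < n \<Longrightarrow> p (Suc i) - p i < min \<delta>1 \<delta>2"
    using fine_partition_exists[OF assms(1), of "min \<delta>1 \<delta>2"] \<delta>1(1) \<delta>2(1) by (metis min_less_iff_conj)
  show "\<exists>\<delta>>0. \<forall>n p. is_partition b c n p \<and> (\<forall>i<n. p (Suc i) - p i < \<delta>) \<longrightarrow>
        \<bar>(\<Sum>i<n. \<Xi> (p i) (p (Suc i))) - (L2 - L1)\<bar> < e"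
  proof (intro exI[of _ \<delta>2] conjI allI impI \<delta>2(1))
    fix m r assume r: "is_partition b c m r \<and> (\<forall>i<m. r (Suc i) - r i < \<delta>2)"
    define s where "s i = (if i \<le> n then p i else r (i - n))" for i
    have pn: "p n = b" "p 0 = a" and rm: "r 0 = b" "r m = c"
      using p(1) r by (auto simp: is_partition_def)
    have s1: "s i = p i" if "i \<le> n" for i using that by (simp add: s_def)
    have s2: "s (n + i) = r i" for i using pn rm by (simp add: s_def)
    have step: "s i < s (Suc i) \<and> s (Suc i) - s i < \<delta>2" if "i < n + m" for i
    proof (cases "i < n")
      case True
      then show ?thesis using p(1) p(2)[of i] by (auto simp: s1 is_partition_def)
    next
      case False
      then obtain j where j: "i = n + j" using le_Suc_ex not_less by blast
      then show ?thesis using s2[of j] s2[of "Suc j"] r that by (auto simp: is_partition_def)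
    qed
    have "is_partition a c (n + m) s"
      using step pn rm s1[of 0] s2[of m] by (auto simp: is_partition_def)
    then have A: "\<bar>(\<Sum>i<n + m. \<Xi> (s i) (s (Suc i))) - L2\<bar> < e / 2"
      using step by (intro \<delta>2(2)[rule_format]) auto
    have B: "\<bar>(\<Sum>i<n. \<Xi> (p i) (p (Suc i))) - L1\<bar> < e / 2"
      using p by (intro \<delta>1(2)[rule_format]) auto
    have "(\<Sum>i<n + m. \<Xi> (s i) (s (Suc i))) =
        (\<Sum>i<n. \<Xi> (s i) (s (Suc i))) + (\<Sum>i<m. \<Xi> (s (n + i)) (s (n + Suc i)))"
      by (induction m) auto
    also have "\<dots> = (\<Sum>i<n. \<Xi> (p i) (p (Suc i))) + (\<Sum>i<m. \<Xi> (r i) (r (Suc i)))"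
      unfolding s2 by (simp add: s1)
    finally show "\<bar>(\<Sum>i<m. \<Xi> (r i) (r (Suc i))) - (L2 - L1)\<bar> < e"
      using A B by linarith
  qed
qed

text \<open>Summing over \<open>n\<close> equal pieces gives a bound of order \<open>n \<cdot> n\<^sup>-\<^sup>\<eta>\<close>. It turns a local expansion with a
remainder of order greater than one into an exact integral equation.\<close>

lemma superlinear_increments_imp_constant:
  fixes F :: "real \<Rightarrow> real"
  assumes "a \<le> b" "\<eta> > 1"
    and F: "\<And>u v. a \<le> u \<Longrightarrow> u \<le> v \<Longrightarrow> v \<le> b \<Longrightarrow> \<bar>F v - F u\<bar> \<le> C * (v - u) powr \<eta>"
  shows "F b = F a"
proof -
  have "\<bar>F b - F a\<bar> \<le> C * (b - a) powr \<eta> * (1 / real (Suc n)) powr (\<eta> - 1)" for n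
  proof -
    define p where "p i = a + (b - a) * real i / real (Suc n)" for i
    have p_diff: "p (Suc i) - p i = (b - a) / real (Suc n)" for i
      by (simp add: p_def of_nat_Suc[of i] ring_distribs add_divide_distrib del: of_nat_Suc)
    have p_mono: "p i \<le> p (Suc i)" for i using p_diff[of i] assms(1) by (smt (verit) divide_nonneg_nonneg of_nat_0_le_iff)
    have p_in: "a \<le> p i" "i \<le> Suc n \<Longrightarrow> p i \<le> b" for i
    proof -
      show "a \<le> p i" using assms(1) by (auto simp: p_def)
      assume "i \<le> Suc n"
      then have "(b - a) * (real i / real (Suc n)) \<le> (b - a) * 1"
        using assms(1) by (intro mult_left_mono) auto
      then show "p i \<le> b" by (simp add: p_def)
    qed
    have "F b - F a = (\<Sum>i<Suc n. F (p (Suc i)) - F (p i))"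
    proof -
      have "p 0 = a" "p (Suc n) = b"
        unfolding p_def by (simp, subst nonzero_mult_div_cancel_right) (simp_all del: of_nat_Suc)
      then show ?thesis using sum_lessThan_telescope[of "\<lambda>i. F (p i)" "Suc n"] by simp
    qed
    also have "\<bar>\<dots>\<bar> \<le> (\<Sum>i<Suc n. C * ((b - a) / real (Suc n)) powr \<eta>)"
    proof (rule order_trans[OF sum_abs sum_mono])
      fix i assume "i \<in> {..<Suc n}"
      then show "\<bar>F (p (Suc i)) - F (p i)\<bar> \<le> C * ((b - a) / real (Suc n)) powr \<eta>"
        using F[of "p i" "p (Suc i)"] p_in[of i] p_in(2)[of "Suc i"] p_mono[of i] by (simp add: p_diff)
    qed
    also have "\<dots> = C * (b - a) powr \<eta> * (real (Suc n) / real (Suc n) powr \<eta>)"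
      using assms(1) by (simp add: powr_divide)
    also have "real (Suc n) / real (Suc n) powr \<eta> = real (Suc n) powr (1 - \<eta>)"
      by (simp add: powr_diff)
    also have "\<dots> = (1 / real (Suc n)) powr (\<eta> - 1)"
      using powr_minus[of "real (Suc n)" "\<eta> - 1"]
      by (simp add: powr_divide inverse_eq_divide del: of_nat_Suc)
    finally show ?thesis .
  qed
  moreover have "(\<lambda>n. C * (b - a) powr \<eta> * (1 / real (Suc n)) powr (\<eta> - 1)) \<longlonglongrightarrow> C * (b - a) powr \<eta> * 0"
    using assms(2) LIMSEQ_inverse_real_of_nat
    by (intro tendsto_intros tendsto_zero_powrI[where b = "\<eta> - 1"]) (auto simp: inverse_eq_divide)
  ultimately have "\<bar>F b - F a\<bar> \<le> C * (b - a) powr \<eta> * 0"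
    by (intro LIMSEQ_le_const) auto
  then show ?thesis by simp
qed

section \<open>Young integrals\<close>

lemma is_partition_mono:
  assumes "is_partition a b n p" "i \<le> j" "j \<le> n"
  shows "p i \<le> p j"
  using assms(2,3)
proof (induction j rule: dec_induct)
  case (step j)
  then have "p j < p (Suc j)" using assms(1) by (auto simp: is_partition_def)
  then show ?case using step by simp
qed simp

lemma is_partition_in:
  assumes "is_partition a b n p" "i \<le> n"
  shows "p i \<in> {a..b}"
  using is_partition_mono[OF assms(1), of 0 i] is_partition_mono[OF assms(1), of i n] assms
  by (auto simp: is_partition_def)

lemma is_partition_sum_increments:
  "is_partition a b n p \<Longrightarrow> (\<Sum>i<n. F (p (Suc i)) - F (p i)) = F b - (F a :: real)"
  using sum_lessThan_telescope[of "\<lambda>i. F (p i)" n] by (simp add: is_partition_def)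

lemma has_mesh_limit_increment: "has_mesh_limit (\<lambda>u v. F v - F u) a b (F b - F a)"
  unfolding has_mesh_limit_def
proof (intro allI impI exI[of _ "1::real"] conjI)
  fix \<epsilon> :: real and n p
  assume "\<epsilon> > 0" "is_partition a b n p \<and> (\<forall>i<n. p (Suc i) - p i < 1)"
  then show "\<bar>(\<Sum>i<n. F (p (Suc i)) - F (p i)) - (F b - F a)\<bar> < \<epsilon>"
    using is_partition_sum_increments[of a b n p F] by simp
qed simp

lemma has_mesh_limit_add:
  assumes L1: "has_mesh_limit \<Xi>1 a b L1" and L2: "has_mesh_limit \<Xi>2 a b L2"
  shows "has_mesh_limit (\<lambda>u v. \<Xi>1 u v + \<Xi>2 u v) a b (L1 + L2)"
  unfolding has_mesh_limit_def
proof (intro allI impI)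
  fix e :: real assume "e > 0"
  then have e: "e / 2 > 0" by simp
  obtain \<delta>1 where \<delta>1: "\<delta>1 > 0" "\<forall>n p. is_partition a b n p \<and> (\<forall>i<n. p (Suc i) - p i < \<delta>1) \<longrightarrow>
        \<bar>(\<Sum>i<n. \<Xi>1 (p i) (p (Suc i))) - L1\<bar> < e / 2"
    by (rule has_mesh_limitE[OF L1 e]) (rule that)
  obtain \<delta>2 where \<delta>2: "\<delta>2 > 0" "\<forall>n p. is_partition a b n p \<and> (\<forall>i<n. p (Suc i) - p i < \<delta>2) \<longrightarrow>
        \<bar>(\<Sum>i<n. \<Xi>2 (p i) (p (Suc i))) - L2\<bar> < e / 2"
    by (rule has_mesh_limitE[OF L2 e]) (rule that)
  show "\<exists>\<delta>>0. \<forall>n p. is_partition a b n p \<and> (\<forall>i<n. p (Suc i) - p i < \<delta>) \<longrightarrow>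
        \<bar>(\<Sum>i<n. \<Xi>1 (p i) (p (Suc i)) + \<Xi>2 (p i) (p (Suc i))) - (L1 + L2)\<bar> < e"
  proof (intro exI[of _ "min \<delta>1 \<delta>2"] conjI allI impI)
    fix n p assume p: "is_partition a b n p \<and> (\<forall>i<n. p (Suc i) - p i < min \<delta>1 \<delta>2)"
    have "\<bar>(\<Sum>i<n. \<Xi>1 (p i) (p (Suc i))) - L1\<bar> < e / 2"
      using p by (intro \<delta>1(2)[rule_format]) auto
    moreover have "\<bar>(\<Sum>i<n. \<Xi>2 (p i) (p (Suc i))) - L2\<bar> < e / 2"
      using p by (intro \<delta>2(2)[rule_format]) auto
    ultimately show "\<bar>(\<Sum>i<n. \<Xi>1 (p i) (p (Suc i)) + \<Xi>2 (p i) (p (Suc i))) - (L1 + L2)\<bar> < e"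
      unfolding sum.distrib by linarith
  qed (use \<delta>1(1) \<delta>2(1) in simp)
qed

lemma has_mesh_limit_unique:
  assumes "a \<le> b" and L1: "has_mesh_limit \<Xi> a b L1" and L2: "has_mesh_limit \<Xi> a b L2"
  shows "L1 = L2"
proof -
  have "has_mesh_limit \<Xi> b b (L2 - L1)" by (rule has_mesh_limit_split[OF assms])
  have "\<bar>L2 - L1\<bar> \<le> 0 + e" if e: "e > 0" for e
  proof -
    obtain \<delta> where \<delta>: "\<delta> > 0" "\<forall>n p. is_partition b b n p \<and> (\<forall>i<n. p (Suc i) - p i < \<delta>) \<longrightarrow>
        \<bar>(\<Sum>i<n. \<Xi> (p i) (p (Suc i))) - (L2 - L1)\<bar> < e"
      by (rule has_mesh_limitE[OF \<open>has_mesh_limit \<Xi> b b (L2 - L1)\<close> e]) (rule that)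
    show ?thesis
      using \<delta>(2)[rule_format, of 0 "\<lambda>_. b"] by (simp add: is_partition_def)
  qed
  then have "\<bar>L2 - L1\<bar> \<le> 0" by (rule field_le_epsilon)
  then show ?thesis by simp
qed

lemma holder_onE:
  assumes "holder_on \<alpha> S f"
  obtains C where "C \<ge> 0" "\<And>s t. s \<in> S \<Longrightarrow> t \<in> S \<Longrightarrow> \<bar>f t - f s\<bar> \<le> C * \<bar>t - s\<bar> powr \<alpha>"
proof -
  obtain C where C: "\<forall>s\<in>S. \<forall>t\<in>S. \<bar>f t - f s\<bar> \<le> C * \<bar>t - s\<bar> powr \<alpha>"
    using assms unfolding holder_on_def by (elim exE)
  show ?thesis
  proof (rule that[of "max C 0"])
    fix s t assume "s \<in> S" "t \<in> S"
    then have "\<bar>f t - f s\<bar> \<le> C * \<bar>t - s\<bar> powr \<alpha>" using C by simp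
    also have "\<dots> \<le> max C 0 * \<bar>t - s\<bar> powr \<alpha>" by (intro mult_right_mono) auto
    finally show "\<bar>f t - f s\<bar> \<le> max C 0 * \<bar>t - s\<bar> powr \<alpha>" .
  qed simp
qed

text \<open>Each product is at most a constant times \<open>(v - u)\<^sup>\<alpha>\<^sup>+\<^sup>\<beta>\<close>, and \<open>\<alpha> + \<beta> > 1\<close> leaves a positive power of the mesh after summation.\<close>

lemma holder_cross_variation_zero:
  assumes "a \<le> b" and f: "holder_on \<alpha> {a..b} f" and g: "holder_on \<beta> {a..b} g" and "\<alpha> + \<beta> > 1"
  shows "has_mesh_limit (\<lambda>u v. (f v - f u) * (g v - g u)) a b 0"
  unfolding has_mesh_limit_def
proof (intro allI impI)
  fix e :: real assume e: "e > 0"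
  obtain C1 where C1: "C1 \<ge> 0" "\<And>s t. s \<in> {a..b} \<Longrightarrow> t \<in> {a..b} \<Longrightarrow> \<bar>f t - f s\<bar> \<le> C1 * \<bar>t - s\<bar> powr \<alpha>"
    using holder_onE[OF f] by metis
  obtain C2 where C2: "C2 \<ge> 0" "\<And>s t. s \<in> {a..b} \<Longrightarrow> t \<in> {a..b} \<Longrightarrow> \<bar>g t - g s\<bar> \<le> C2 * \<bar>t - s\<bar> powr \<beta>"
    using holder_onE[OF g] by metis
  define K where "K = C1 * C2 * (b - a)"
  have K: "K \<ge> 0" using C1 C2 assms(1) by (simp add: K_def)
  define \<kappa> where "\<kappa> = \<alpha> + \<beta> - 1"
  have \<kappa>: "\<kappa> > 0" using assms(4) by (simp add: \<kappa>_def)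
  define \<delta> where "\<delta> = (e / (K + 1)) powr (1 / \<kappa>)"
  have \<delta>0: "\<delta> > 0" using e K by (simp add: \<delta>_def)
  have \<delta>1: "\<delta> powr \<kappa> = e / (K + 1)" using e K \<kappa> by (simp add: \<delta>_def powr_powr)
  show "\<exists>\<delta>>0. \<forall>n p. is_partition a b n p \<and> (\<forall>i<n. p (Suc i) - p i < \<delta>) \<longrightarrow>
      \<bar>(\<Sum>i<n. (f (p (Suc i)) - f (p i)) * (g (p (Suc i)) - g (p i))) - 0\<bar> < e"
  proof (intro exI[of _ \<delta>] conjI \<delta>0 allI impI)
    fix n p assume p: "is_partition a b n p \<and> (\<forall>i<n. p (Suc i) - p i < \<delta>)"
    have "\<bar>\<Sum>i<n. (f (p (Suc i)) - f (p i)) * (g (p (Suc i)) - g (p i))\<bar>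
        \<le> (\<Sum>i<n. C1 * C2 * \<delta> powr \<kappa> * (p (Suc i) - p i))"
    proof (rule order_trans[OF sum_abs sum_mono])
      fix i assume "i \<in> {..<n}"
      then have i: "i < n" by simp
      define d where "d = p (Suc i) - p i"
      have d: "0 < d" "d < \<delta>" using p i by (auto simp: d_def is_partition_def)
      have "\<bar>(f (p (Suc i)) - f (p i)) * (g (p (Suc i)) - g (p i))\<bar>
          \<le> (C1 * \<bar>p (Suc i) - p i\<bar> powr \<alpha>) * (C2 * \<bar>p (Suc i) - p i\<bar> powr \<beta>)"
        unfolding abs_mult
        using is_partition_in[of a b n p i] is_partition_in[of a b n p "Suc i"] p i C1(1)
        by (intro mult_mono C1 C2) auto
      also have "\<dots> = C1 * C2 * (d powr \<kappa> * d)"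
      proof -
        have "d powr \<kappa> * d = d powr (\<alpha> + \<beta>)" using d by (simp add: \<kappa>_def powr_diff)
        then show ?thesis using d by (simp add: powr_add d_def)
      qed
      also have "\<dots> \<le> C1 * C2 * (\<delta> powr \<kappa> * d)"
        using d \<kappa> C1 C2 by (intro mult_left_mono mult_right_mono powr_mono2) auto
      finally show "\<bar>(f (p (Suc i)) - f (p i)) * (g (p (Suc i)) - g (p i))\<bar>
          \<le> C1 * C2 * \<delta> powr \<kappa> * (p (Suc i) - p i)" by (simp add: d_def mult.assoc)
    qed
    also have "\<dots> = C1 * C2 * \<delta> powr \<kappa> * (b - a)"
      using is_partition_sum_increments[of a b n p "\<lambda>x. x"] p
      by (simp add: sum_distrib_left[symmetric])
    also have "\<dots> = K * (e / (K + 1))" by (simp add: K_def \<delta>1)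
    also have "\<dots> < e" using e K by (simp add: field_simps)
    finally show "\<bar>(\<Sum>i<n. (f (p (Suc i)) - f (p i)) * (g (p (Suc i)) - g (p i))) - 0\<bar> < e" by simp
  qed
qed

lemma holder_on_shift: "holder_on \<alpha> S (\<lambda>u. f u - c) \<longleftrightarrow> holder_on \<alpha> S f"
  by (simp add: holder_on_def)

text \<open>The discrete product rule has the extra term \<open>(f v - f u) (g v - g u)\<close>, whose mesh limit vanishes in the Young regime.\<close>

lemma young_integral_by_parts:
  assumes "s \<le> t" and J1: "has_young_integral (\<lambda>u. f u - f s) g s t J1"
    and J2: "has_young_integral (\<lambda>u. g u - g s) f s t J2"
  shows "J1 + J2 = (f t - f s) * (g t - g s)"
proof -
  obtain \<alpha> \<beta> where "\<alpha> + \<beta> > 1" "holder_on \<alpha> {s..t} f" "holder_on \<beta> {s..t} g"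
    using J1 unfolding has_young_integral_def holder_on_shift by (elim exE conjE)
  then have cross: "has_mesh_limit (\<lambda>u v. (f v - f u) * (g v - g u)) s t 0"
    by (intro holder_cross_variation_zero[OF assms(1)])
  have "has_mesh_limit (\<lambda>u v. (f u - f s) * (g v - g u) + (g u - g s) * (f v - f u)
      + (f v - f u) * (g v - g u)) s t (J1 + J2 + 0)"
    using J1 J2 cross unfolding has_young_integral_def by (intro has_mesh_limit_add) auto
  moreover have "(\<lambda>u v. (f u - f s) * (g v - g u) + (g u - g s) * (f v - f u)
      + (f v - f u) * (g v - g u)) = (\<lambda>u v. (f v - f s) * (g v - g s) - (f u - f s) * (g u - g s))"
    by (auto simp: fun_eq_iff algebra_simps)
  ultimately have "has_mesh_limit (\<lambda>u v. (f v - f s) * (g v - g s) - (f u - f s) * (g u - g s)) s t (J1 + J2)"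
    by simp
  from has_mesh_limit_unique[OF assms(1) this has_mesh_limit_increment[of "\<lambda>v. (f v - f s) * (g v - g s)"]]
  show ?thesis by simp
qed

text \<open>If \<open>f\<close> is Young integrable against itself, two Hoelder exponents of \<open>f\<close> add up to more than one, so the
larger one exceeds \<open>1/2\<close>. This is how the regularity of fractional Brownian motion enters the proof.\<close>

lemma young_self_integral_imp_holder:
  assumes "has_young_integral (\<lambda>u. f u - c) f s t J"
  obtains \<gamma> where "\<gamma> > 1/2" "holder_on \<gamma> {s..t} f"
proof -
  obtain \<alpha> \<beta> where "\<alpha> + \<beta> > 1" "holder_on \<alpha> {s..t} f" "holder_on \<beta> {s..t} f"
    using assms unfolding has_young_integral_def holder_on_shift by auto
  then show ?thesis using that[of \<alpha>] that[of \<beta>] by argo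
qed

section \<open>Removing the square root from the rough equation\<close>

text \<open>For the germ \<open>y a (M b - M a) + c XX a b\<close> the quadratic part of \<open>XX\<close> cancels the part of the defect
that comes from the Gubinelli derivative \<open>c\<close>; what is left is a product of the controlled remainder and an increment of
\<open>M\<close>, of order \<open>3\<alpha> > 1\<close>.\<close>

lemma rough_integral_local_expansion:
  fixes M y :: "real \<Rightarrow> real" and c :: real
  assumes "1/3 < \<alpha>" "CZ \<ge> 0" "CM \<ge> 0" "u \<le> v"
    and XX: "\<And>a b. u \<le> a \<Longrightarrow> a \<le> b \<Longrightarrow> b \<le> v \<Longrightarrow> XX a b = ((M b - M a)\<^sup>2 - (b - a)) / 2"
    and M: "\<And>a b. u \<le> a \<Longrightarrow> a \<le> b \<Longrightarrow> b \<le> v \<Longrightarrow> \<bar>M b - M a\<bar> \<le> CM * (b - a) powr \<alpha>"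
    and Z: "\<And>a b. u \<le> a \<Longrightarrow> a \<le> b \<Longrightarrow> b \<le> v \<Longrightarrow>
              \<bar>y b - y a - c * (M b - M a)\<bar> \<le> CZ * (b - a) powr (2 * \<alpha>)"
    and lim: "has_mesh_limit (\<lambda>a b. y a * (M b - M a) + c * XX a b) u v J"
  shows "\<bar>J - (y u * (M v - M u) + c * ((M v - M u)\<^sup>2 - (v - u)) / 2)\<bar>
    \<le> CZ * CM / (1 - 2 powr (1 - 3 * \<alpha>)) * (v - u) powr (3 * \<alpha>)"
proof (cases "u = v")
  case True
  have "has_mesh_limit (\<lambda>a b. y a * (M b - M a) + c * XX a b) v v (J - J)"
    using lim lim True by (intro has_mesh_limit_split) auto
  then have "J = 0" using has_mesh_limit_unique[of v v _ "J - J" J] lim True by simp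
  then show ?thesis using True by simp
next
  case False
  define \<Xi> where "\<Xi> a b = y a * (M b - M a) + c * XX a b" for a b
  have "\<bar>J - \<Xi> u v\<bar> \<le> CZ * CM / (1 - 2 powr (1 - 3 * \<alpha>)) * (v - u) powr (3 * \<alpha>)"
  proof (rule sewing_bound)
    show "u < v" "3 * \<alpha> > 1" using assms False by auto
    show "has_mesh_limit \<Xi> u v J" using lim by (simp add: \<Xi>_def[abs_def])
    fix a b assume ab: "u \<le> a" "a \<le> b" "b \<le> v"
    define w where "w = (a + b) / 2"
    have w: "u \<le> w" "a \<le> w" "w \<le> b" "w \<le> v" using ab by (auto simp: w_def)
    have "\<Xi> a b - \<Xi> a w - \<Xi> w b = - ((y w - y a - c * (M w - M a)) * (M b - M w))"
      using ab w by (simp add: \<Xi>_def XX field_simps power2_eq_square)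
    also have "\<bar>\<dots>\<bar> = \<bar>y w - y a - c * (M w - M a)\<bar> * \<bar>M b - M w\<bar>" by (simp add: abs_mult)
    also have "\<dots> \<le> (CZ * (w - a) powr (2 * \<alpha>)) * (CM * (b - w) powr \<alpha>)"
      using ab w assms by (intro mult_mono Z M) auto
    also have "\<dots> \<le> (CZ * (b - a) powr (2 * \<alpha>)) * (CM * (b - a) powr \<alpha>)"
      using ab w assms by (intro mult_mono mult_left_mono powr_mono2) auto
    also have "\<dots> = CZ * CM * (b - a) powr (3 * \<alpha>)"
      by (simp add: powr_add[symmetric])
    finally show "\<bar>\<Xi> a b - \<Xi> a ((a + b) / 2) - \<Xi> ((a + b) / 2) b\<bar> \<le> CZ * CM * (b - a) powr (3 * \<alpha>)"
      by (simp add: w_def)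
  qed
  then show ?thesis using assms(4) XX[of u v] by (simp add: \<Xi>_def)
qed

text \<open>With \<open>y = \<sigma> \<surd>r\<close> and \<open>c = \<sigma>\<^sup>2/2\<close>, compare two expansions of \<open>\<sigma>\<^sup>2 (r v - r u) = (y v)\<^sup>2 - (y u)\<^sup>2\<close>: the one
obtained from the equation and \<open>rough_integral_local_expansion\<close>, and the one obtained from \<open>y v - y u = c (M v - M u) + Z\<close>. The
terms with \<open>M\<close> agree except for the bracket \<open>v - u\<close>, which leaves
\<open>2 (y u) Z = \<integral>\<phi>\<close> up to order \<open>3\<alpha>\<close>, where \<open>\<phi> = \<sigma>\<^sup>2 (k (\<theta> - r) - \<sigma>\<^sup>2/4)\<close>. So \<open>y - c M\<close> has derivative \<open>\<phi> / (2 y)\<close>,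
and dividing by \<open>c\<close> gives the Bessel equation.\<close>

lemma sqrt_solves_bessel_equation:
  fixes M r :: "real \<Rightarrow> real" and k \<theta> \<sigma> \<alpha> r0 T :: real
  defines "X \<equiv> \<lambda>u. 2 * sqrt (r u) / \<sigma>" and "A \<equiv> 2 * k * \<theta> / \<sigma>\<^sup>2 - 1 / 2"
  assumes "\<sigma> > 0" "1/3 < \<alpha>" "\<alpha> < 1/2"
    and r_cont: "continuous_on {0..T} r" and r_pos: "\<And>t. 0 \<le> t \<Longrightarrow> t \<le> T \<Longrightarrow> r t > 0"
    and M: "holder_on \<alpha> {0..T} M"
    and XX: "\<And>u v. 0 \<le> u \<Longrightarrow> u \<le> v \<Longrightarrow> v \<le> T \<Longrightarrow> XX u v = ((M v - M u)\<^sup>2 - (v - u)) / 2"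
    and sol: "\<And>t. 0 \<le> t \<Longrightarrow> t \<le> T \<Longrightarrow>
      \<exists>J. has_rough_integral \<alpha> t M XX (\<lambda>u. \<sigma> * sqrt (r u)) (\<lambda>u. \<sigma>\<^sup>2 / 2) J \<and>
          r t = r0 + integral {0..t} (\<lambda>u. k * (\<theta> - r u)) + J"
    and st: "0 \<le> s" "s \<le> t" "t \<le> T"
  shows "X t - X s = integral {s..t} (\<lambda>u. A / X u - k / 2 * X u) + (M t - M s)"
proof -
  define y where "y u = \<sigma> * sqrt (r u)" for u
  have T0: "0 \<le> T" using st by simp
  have y_cont: "continuous_on {0..T} y"
    unfolding y_def[abs_def] by (intro continuous_intros r_cont)
  have y_pos: "y u > 0" if "0 \<le> u" "u \<le> T" for u using r_pos[OF that] assms(3) by (simp add: y_def)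
  have y_sq: "y u * y u = \<sigma>\<^sup>2 * r u" if "0 \<le> u" "u \<le> T" for u
    using r_pos[OF that] by (simp add: y_def power2_eq_square)
  obtain J where J: "\<And>t. 0 \<le> t \<Longrightarrow> t \<le> T \<Longrightarrow> has_rough_integral \<alpha> t M XX y (\<lambda>u. \<sigma>\<^sup>2 / 2) (J t)"
      "\<And>t. 0 \<le> t \<Longrightarrow> t \<le> T \<Longrightarrow> r t = r0 + integral {0..t} (\<lambda>u. k * (\<theta> - r u)) + J t"
    using sol unfolding y_def[abs_def] by metis
  obtain CM where CM: "CM \<ge> 0" "\<And>s t. s \<in> {0..T} \<Longrightarrow> t \<in> {0..T} \<Longrightarrow> \<bar>M t - M s\<bar> \<le> CM * \<bar>t - s\<bar> powr \<alpha>"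
    using holder_onE[OF M] by metis
  have ctrl: "controlled_path \<alpha> T M y (\<lambda>u. \<sigma>\<^sup>2 / 2)"
    using J(1)[OF T0] by (simp add: has_rough_integral_def)
  obtain Cy where Cy: "Cy \<ge> 0" "\<And>s t. s \<in> {0..T} \<Longrightarrow> t \<in> {0..T} \<Longrightarrow> \<bar>y t - y s\<bar> \<le> Cy * \<bar>t - s\<bar> powr \<alpha>"
    using holder_onE[of \<alpha> "{0..T}" y] ctrl unfolding controlled_path_def by metis
  define c where "c = \<sigma>\<^sup>2 / 2"
  obtain CZ' where CZ': "\<forall>s t. 0 \<le> s \<and> s \<le> t \<and> t \<le> T \<longrightarrow>
        \<bar>(y t - y s) - \<sigma>\<^sup>2 / 2 * (M t - M s)\<bar> \<le> CZ' * (t - s) powr (2 * \<alpha>)"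
    using ctrl unfolding controlled_path_def by (elim conjE exE)
  define CZ where "CZ = max CZ' 0"
  have CZ: "\<bar>y v - y u - c * (M v - M u)\<bar> \<le> CZ * (v - u) powr (2 * \<alpha>)"
    if "0 \<le> u" "u \<le> v" "v \<le> T" for u v
  proof -
    have "\<bar>y v - y u - c * (M v - M u)\<bar> \<le> CZ' * (v - u) powr (2 * \<alpha>)"
      using CZ' that by (simp add: c_def)
    also have "\<dots> \<le> CZ * (v - u) powr (2 * \<alpha>)" by (intro mult_right_mono) (auto simp: CZ_def)
    finally show ?thesis .
  qed
  have CZ0: "CZ \<ge> 0" by (simp add: CZ_def)
  define C3 where "C3 = CZ * CM / (1 - 2 powr (1 - 3 * \<alpha>))"
  have J_local: "\<bar>J v - J u - (y u * (M v - M u) + c * ((M v - M u)\<^sup>2 - (v - u)) / 2)\<bar>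
      \<le> C3 * (v - u) powr (3 * \<alpha>)" if uv: "0 \<le> u" "u \<le> v" "v \<le> T" for u v
    unfolding C3_def
  proof (rule rough_integral_local_expansion)
    show "has_mesh_limit (\<lambda>a b. y a * (M b - M a) + c * XX a b) u v (J v - J u)"
      using J(1)[of u] J(1)[of v] uv unfolding has_rough_integral_def c_def
      by (intro has_mesh_limit_split[of 0]) auto
    show "\<bar>M b - M a\<bar> \<le> CM * (b - a) powr \<alpha>" if "u \<le> a" "a \<le> b" "b \<le> v" for a b
      using CM(2)[of a b] that uv by simp
    show "\<bar>y b - y a - c * (M b - M a)\<bar> \<le> CZ * (b - a) powr (2 * \<alpha>)" if "u \<le> a" "a \<le> b" "b \<le> v" for a b
      using CZ[of a b] that uv by simp
    show "XX a b = ((M b - M a)\<^sup>2 - (b - a)) / 2" if "u \<le> a" "a \<le> b" "b \<le> v" for a b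
      using XX[of a b] that uv by simp
  qed (use assms uv CM CZ0 in auto)
  define \<phi> where "\<phi> u = \<sigma>\<^sup>2 * (k * (\<theta> - r u) - \<sigma>\<^sup>2 / 4)" for u
  have \<phi>_cont: "continuous_on {0..T} \<phi>" unfolding \<phi>_def[abs_def] by (intro continuous_intros r_cont)
  define \<psi> where "\<psi> u = \<phi> u / (2 * y u)" for u
  have \<psi>_cont: "continuous_on {0..T} \<psi>"
    unfolding \<psi>_def[abs_def] using y_pos by (intro continuous_intros \<phi>_cont y_cont) fastforce
  obtain c0 where c0: "c0 > 0" "\<And>u. 0 \<le> u \<Longrightarrow> u \<le> T \<Longrightarrow> c0 \<le> y u"
  proof -
    obtain x where "x \<in> {0..T}" "\<forall>u\<in>{0..T}. y x \<le> y u"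
      using continuous_attains_inf[of "{0..T}" y] y_cont T0 by auto
    then show ?thesis using that[of "y x"] y_pos by simp
  qed
  obtain \<Phi> where \<Phi>: "\<Phi> \<ge> 0" "\<And>u. 0 \<le> u \<Longrightarrow> u \<le> T \<Longrightarrow> \<bar>\<phi> u\<bar> \<le> \<Phi>"
  proof -
    have "continuous_on {0..T} (\<lambda>u. \<bar>\<phi> u\<bar>)" by (intro continuous_intros \<phi>_cont)
    then obtain x where x: "x \<in> {0..T}" "\<forall>u\<in>{0..T}. \<bar>\<phi> u\<bar> \<le> \<bar>\<phi> x\<bar>"
      using continuous_attains_sup[of "{0..T}" "\<lambda>u. \<bar>\<phi> u\<bar>"] T0 by auto
    then show ?thesis using that[of "\<bar>\<phi> x\<bar>"] by simp
  qed
  have int: "f integrable_on {u..v}" if "continuous_on {0..T} f" "0 \<le> u" "v \<le> T" for f :: "real \<Rightarrow> real" and u v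
    using that by (intro integrable_continuous_real) (auto elim: continuous_on_subset)
  define C4 where "C4 = \<sigma>\<^sup>2 * C3 + CZ * (Cy + c * CM)"
  have Z_local: "\<bar>2 * y u * (y v - y u - c * (M v - M u)) - integral {u..v} \<phi>\<bar> \<le> C4 * (v - u) powr (3 * \<alpha>)"
    if uv: "0 \<le> u" "u \<le> v" "v \<le> T" for u v
  proof -
    define Z m K E where "Z = y v - y u - c * (M v - M u)" and "m = c * (M v - M u)"
      and "K = integral {u..v} (\<lambda>u. k * (\<theta> - r u))"
      and "E = J v - J u - (y u * (M v - M u) + c * ((M v - M u)\<^sup>2 - (v - u)) / 2)"
    have k_int: "(\<lambda>u. k * (\<theta> - r u)) integrable_on {0..v}"
      using uv by (intro int continuous_intros r_cont) auto
    have k_int': "(\<lambda>u. k * (\<theta> - r u)) integrable_on {u..v}"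
      using uv by (intro int continuous_intros r_cont) auto
    have "integral {0..u} (\<lambda>u. k * (\<theta> - r u)) + K = integral {0..v} (\<lambda>u. k * (\<theta> - r u))"
      unfolding K_def using uv k_int by (intro Henstock_Kurzweil_Integration.integral_combine) auto
    then have r_inc: "r v - r u = K + (J v - J u)"
      using J(2)[of u] J(2)[of v] uv by simp
    have int_\<phi>: "integral {u..v} \<phi> = \<sigma>\<^sup>2 * K - \<sigma>\<^sup>2 * \<sigma>\<^sup>2 / 4 * (v - u)"
    proof -
      have "integral {u..v} \<phi> = integral {u..v} (\<lambda>u. \<sigma>\<^sup>2 * (k * (\<theta> - r u)) - \<sigma>\<^sup>2 * \<sigma>\<^sup>2 / 4)"
        by (simp add: \<phi>_def[abs_def] algebra_simps)
      also have "\<dots> = \<sigma>\<^sup>2 * K - \<sigma>\<^sup>2 * \<sigma>\<^sup>2 / 4 * (v - u)"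
        unfolding K_def using k_int' uv
        by (subst integral_diff) (auto intro!: integrable_on_mult_right simp: mult.commute[of _ "v - u"])
      finally show ?thesis .
    qed
    have "\<sigma>\<^sup>2 * (r v - r u) = y v * y v - y u * y u"
      using y_sq[of u] y_sq[of v] uv by (simp add: algebra_simps)
    also have "\<dots> = 2 * y u * (Z + m) + m * m + Z * ((y v - y u) + m)"
      by (simp add: Z_def m_def algebra_simps)
    finally have "2 * y u * Z = \<sigma>\<^sup>2 * (K + (J v - J u)) - 2 * y u * m - m * m - Z * ((y v - y u) + m)"
      unfolding r_inc by (simp add: algebra_simps)
    also have "\<sigma>\<^sup>2 * (K + (J v - J u)) = \<sigma>\<^sup>2 * K + \<sigma>\<^sup>2 * E + 2 * y u * m + m * m - \<sigma>\<^sup>2 * \<sigma>\<^sup>2 / 4 * (v - u)"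
      by (simp add: E_def m_def c_def power2_eq_square field_simps)
    finally have "2 * y u * Z - integral {u..v} \<phi> = \<sigma>\<^sup>2 * E - Z * ((y v - y u) + m)"
      unfolding int_\<phi> by simp
    also have "\<bar>\<dots>\<bar> \<le> \<sigma>\<^sup>2 * \<bar>E\<bar> + \<bar>Z\<bar> * (\<bar>y v - y u\<bar> + \<bar>m\<bar>)"
    proof -
      have "\<bar>Z * ((y v - y u) + m)\<bar> \<le> \<bar>Z\<bar> * (\<bar>y v - y u\<bar> + \<bar>m\<bar>)"
        unfolding abs_mult by (intro mult_left_mono) auto
      moreover have "\<bar>\<sigma>\<^sup>2 * E\<bar> = \<sigma>\<^sup>2 * \<bar>E\<bar>" by (simp add: abs_mult)
      ultimately show ?thesis by linarith
    qed
    also have "\<dots> \<le> \<sigma>\<^sup>2 * (C3 * (v - u) powr (3 * \<alpha>)) +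
        (CZ * (v - u) powr (2 * \<alpha>)) * (Cy * (v - u) powr \<alpha> + c * (CM * (v - u) powr \<alpha>))"
    proof (intro add_mono mult_left_mono mult_mono)
      show "\<bar>E\<bar> \<le> C3 * (v - u) powr (3 * \<alpha>)" unfolding E_def by (rule J_local[OF uv])
      show "\<bar>Z\<bar> \<le> CZ * (v - u) powr (2 * \<alpha>)" unfolding Z_def by (rule CZ[OF uv])
      show "\<bar>y v - y u\<bar> \<le> Cy * (v - u) powr \<alpha>" using Cy(2)[of u v] uv by simp
      show "\<bar>m\<bar> \<le> c * (CM * (v - u) powr \<alpha>)"
        using CM(2)[of u v] uv by (auto simp: m_def c_def abs_mult intro!: mult_left_mono)
    qed (use CZ0 in auto)
    also have "\<dots> = C4 * (v - u) powr (3 * \<alpha>)"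
    proof -
      have "(v - u) powr (2 * \<alpha>) * (v - u) powr \<alpha> = (v - u) powr (3 * \<alpha>)"
        by (simp add: powr_add[symmetric])
      then show ?thesis by (simp add: C4_def algebra_simps)
    qed
    finally show ?thesis unfolding Z_def .
  qed
  define F where "F u = y u - c * M u - integral {0..u} \<psi>" for u
  define C5 where "C5 = C4 / (2 * c0) + \<Phi> * Cy / (2 * c0 * c0) * T powr (1 - 2 * \<alpha>)"
  have C4_nonneg: "C4 \<ge> 0"
  proof -
    have "2 powr (1 - 3 * \<alpha>) < (1::real)" using assms(4) by (intro powr_less_one) auto
    then have "C3 \<ge> 0" using CZ0 CM(1) by (simp add: C3_def)
    then show ?thesis using CZ0 CM(1) Cy(1) by (simp add: C4_def c_def)
  qed
  have F_local: "\<bar>F v - F u\<bar> \<le> C5 * (v - u) powr (3 * \<alpha>)" if uv: "s \<le> u" "u \<le> v" "v \<le> t" for u v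
  proof -
    have uv': "0 \<le> u" "u \<le> v" "v \<le> T" using uv st by auto
    define Z where "Z = y v - y u - c * (M v - M u)"
    have yu: "y u \<ge> c0" "y u > 0" using c0 uv' by (auto intro: less_le_trans)
    have 1: "\<bar>Z - integral {u..v} \<phi> / (2 * y u)\<bar> \<le> C4 / (2 * c0) * (v - u) powr (3 * \<alpha>)"
    proof -
      have "Z - integral {u..v} \<phi> / (2 * y u) = (2 * y u * Z - integral {u..v} \<phi>) / (2 * y u)"
        using yu by (simp add: field_simps)
      also have "\<bar>\<dots>\<bar> = \<bar>2 * y u * Z - integral {u..v} \<phi>\<bar> / (2 * y u)" using yu by simp
      also have "\<dots> \<le> C4 * (v - u) powr (3 * \<alpha>) / (2 * c0)"
        using Z_local[OF uv'] yu c0(1) C4_nonneg unfolding Z_def by (intro frac_le) auto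
      finally show ?thesis by simp
    qed
    have 2: "\<bar>integral {u..v} \<phi> / (2 * y u) - integral {u..v} \<psi>\<bar>
        \<le> \<Phi> * Cy / (2 * c0 * c0) * (v - u) powr \<alpha> * (v - u)"
    proof -
      have i1: "(\<lambda>x. \<phi> x / (2 * y u)) integrable_on {u..v}"
        using int[OF \<phi>_cont, of u v] uv' by (intro integrable_on_divide) auto
      have i2: "\<psi> integrable_on {u..v}" using int[OF \<psi>_cont, of u v] uv' by auto
      have "integral {u..v} \<phi> / (2 * y u) - integral {u..v} \<psi> = integral {u..v} (\<lambda>x. \<phi> x / (2 * y u) - \<psi> x)"
        using i1 i2 by (simp add: integral_diff)
      also have "norm \<dots> \<le> \<Phi> * Cy / (2 * c0 * c0) * (v - u) powr \<alpha> * (v - u)"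
      proof (rule integral_bound[OF uv'(2)])
        show "continuous_on {u..v} (\<lambda>x. \<phi> x / (2 * y u) - \<psi> x)"
          using yu uv' by (intro continuous_intros continuous_on_subset[OF \<phi>_cont] continuous_on_subset[OF \<psi>_cont]) auto
        show "norm (\<phi> x / (2 * y u) - \<psi> x) \<le> \<Phi> * Cy / (2 * c0 * c0) * (v - u) powr \<alpha>" if x: "x \<in> {u..v}" for x
        proof -
          have yx: "y x \<ge> c0" "y x > 0" using c0 uv' x by (auto intro: less_le_trans)
          have "\<phi> x / (2 * y u) - \<psi> x = \<phi> x * (y x - y u) / (2 * y u * y x)"
            using yx yu by (simp add: \<psi>_def field_simps)
          also have "\<bar>\<dots>\<bar> = \<bar>\<phi> x\<bar> * \<bar>y x - y u\<bar> / (2 * y u * y x)" using yx yu by (simp add: abs_mult)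
          also have "\<dots> \<le> \<Phi> * (Cy * (v - u) powr \<alpha>) / (2 * c0 * c0)"
          proof (intro frac_le mult_mono)
            show "\<bar>\<phi> x\<bar> \<le> \<Phi>" using \<Phi>(2)[of x] x uv' by simp
            have "\<bar>y x - y u\<bar> \<le> Cy * \<bar>x - u\<bar> powr \<alpha>" using Cy(2)[of u x] x uv' by simp
            also have "\<dots> \<le> Cy * (v - u) powr \<alpha>" using Cy(1) x assms by (intro mult_left_mono powr_mono2) auto
            finally show "\<bar>y x - y u\<bar> \<le> Cy * (v - u) powr \<alpha>" .
          qed (use \<Phi>(1) Cy(1) c0(1) yx yu in auto)
          finally show ?thesis by (simp add: mult.assoc)
        qed
      qed
      finally show ?thesis by simp
    qed
    \<comment> \<open>since \<open>3\<alpha> \<le> 1 + \<alpha>\<close>, the error from freezing \<open>y\<close> in the integrand has the required order as well\<close>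
    have d: "(v - u) powr \<alpha> * (v - u) \<le> T powr (1 - 2 * \<alpha>) * (v - u) powr (3 * \<alpha>)"
    proof (cases "u = v")
      case False
      then have "(v - u) powr \<alpha> * (v - u) = (v - u) powr (1 - 2 * \<alpha>) * (v - u) powr (3 * \<alpha>)"
        using uv' powr_add[of "v - u" \<alpha> 1] by (simp add: powr_add[symmetric])
      also have "\<dots> \<le> T powr (1 - 2 * \<alpha>) * (v - u) powr (3 * \<alpha>)"
        using uv' assms by (intro mult_right_mono powr_mono2) auto
      finally show ?thesis .
    qed simp
    have "integral {0..u} \<psi> + integral {u..v} \<psi> = integral {0..v} \<psi>"
      using uv' int[OF \<psi>_cont, of 0 v] by (intro Henstock_Kurzweil_Integration.integral_combine) auto
    then have "F v - F u = Z - integral {u..v} \<psi>" by (simp add: F_def Z_def algebra_simps)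
    then have "\<bar>F v - F u\<bar> \<le> C4 / (2 * c0) * (v - u) powr (3 * \<alpha>)
        + \<Phi> * Cy / (2 * c0 * c0) * ((v - u) powr \<alpha> * (v - u))" using 1 2 by (simp add: mult.assoc)
    also have "\<dots> \<le> C4 / (2 * c0) * (v - u) powr (3 * \<alpha>)
        + \<Phi> * Cy / (2 * c0 * c0) * (T powr (1 - 2 * \<alpha>) * (v - u) powr (3 * \<alpha>))"
      using d \<Phi>(1) Cy(1) c0(1) by (intro add_left_mono mult_left_mono) auto
    finally show ?thesis by (simp add: C5_def algebra_simps)
  qed
  have "F t = F s"
    by (rule superlinear_increments_imp_constant[of s t "3 * \<alpha>" F C5]) (use st assms F_local in auto)
  moreover have "integral {0..s} \<psi> + integral {s..t} \<psi> = integral {0..t} \<psi>"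
    using st int[OF \<psi>_cont, of 0 t] by (intro Henstock_Kurzweil_Integration.integral_combine) auto
  ultimately have y_inc: "y t - y s = c * (M t - M s) + integral {s..t} \<psi>"
    by (simp add: F_def algebra_simps)
  have X_y: "X u = y u / c" for u
    using assms(3) by (simp add: X_def y_def c_def power2_eq_square)
  have c_pos: "c > 0" using assms(3) by (simp add: c_def)
  have drift: "\<psi> u / c = A / X u - k / 2 * X u" if "0 \<le> u" "u \<le> T" for u
  proof -
    have "r u = y u * y u / \<sigma>\<^sup>2" using y_sq[OF that] assms(3) by simp
    then have "\<phi> u = \<sigma>\<^sup>2 * k * \<theta> - k * (y u * y u) - \<sigma>\<^sup>2 * \<sigma>\<^sup>2 / 4"
      using assms(3) by (simp add: \<phi>_def field_simps)
    then have \<psi>_eq: "\<psi> u = (\<sigma>\<^sup>2 * k * \<theta> - k * (y u * y u) - \<sigma>\<^sup>2 * \<sigma>\<^sup>2 / 4) / (2 * y u)"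
      by (simp only: \<psi>_def)
    show ?thesis
      using assms(3) y_pos[OF that] unfolding \<psi>_eq by (simp add: X_y A_def c_def field_simps power2_eq_square)
  qed
  have "integral {s..t} (\<lambda>u. A / X u - k / 2 * X u) = integral {s..t} (\<lambda>u. \<psi> u / c)"
    using st by (intro integral_cong drift[symmetric]) auto
  also have "\<dots> = integral {s..t} \<psi> / c" by simp
  finally show ?thesis
    unfolding X_y using y_inc c_pos by (simp add: field_simps)
qed

section \<open>Brownian increments and the past\<close>

abbreviation normal_law :: "real \<Rightarrow> real measure" where
  "normal_law v \<equiv> density lborel (normal_density 0 (sqrt v))"

text \<open>The square expands into moments of order at most four; the odd ones vanish, the others are \<open>1\<close>, \<open>\<delta>\<close>
and \<open>3\<delta>\<^sup>2\<close>.\<close>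

lemma nn_integral_normal_martingale_increment:
  fixes S \<alpha> \<delta> :: real
  assumes "\<delta> > 0"
  shows "(\<integral>\<^sup>+y. ennreal ((S + (\<alpha> * y - (y\<^sup>2 - \<delta>) / 2))\<^sup>2) \<partial>normal_law \<delta>)
    = ennreal (S\<^sup>2 + (\<delta> * \<alpha>\<^sup>2 + \<delta>\<^sup>2 / 2))"
proof -
  define g where "g = normal_density 0 (sqrt \<delta>)"
  have s: "sqrt \<delta> > 0" using assms by simp
  define a0 where "a0 = S + \<delta> / 2"
  have m0: "has_bochner_integral lborel (\<lambda>x. g x * 1) 1"
    using normal_moment_even[OF s, of 0 0] by (simp add: g_def)
  have m1: "has_bochner_integral lborel (\<lambda>x. g x * x) 0"
    using normal_moment_odd[OF s, of 0 0] by (simp add: g_def)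
  have m2: "has_bochner_integral lborel (\<lambda>x. g x * x ^ 2) \<delta>"
    using normal_moment_even[OF s, of 0 1] assms by (simp add: g_def)
  have m3: "has_bochner_integral lborel (\<lambda>x. g x * x ^ 3) 0"
    using normal_moment_odd[OF s, of 0 1] by (simp add: g_def)
  have m4: "has_bochner_integral lborel (\<lambda>x. g x * x ^ 4) (3 * \<delta>\<^sup>2)"
    using normal_moment_even[OF s, of 0 2] assms by (simp add: g_def fact_numeral field_simps power2_eq_square)
  have "has_bochner_integral lborel (\<lambda>x. 1 / 4 * (g x * x ^ 4) + (- \<alpha>) * (g x * x ^ 3)
      + (\<alpha>\<^sup>2 - a0) * (g x * x ^ 2) + 2 * a0 * \<alpha> * (g x * x) + a0\<^sup>2 * (g x * 1))
      (1 / 4 * (3 * \<delta>\<^sup>2) + (- \<alpha>) * 0 + (\<alpha>\<^sup>2 - a0) * \<delta> + 2 * a0 * \<alpha> * 0 + a0\<^sup>2 * 1)"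
    by (intro has_bochner_integral_add has_bochner_integral_mult_right m0 m1 m2 m3 m4)
  moreover have "(\<lambda>x. 1 / 4 * (g x * x ^ 4) + (- \<alpha>) * (g x * x ^ 3)
      + (\<alpha>\<^sup>2 - a0) * (g x * x ^ 2) + 2 * a0 * \<alpha> * (g x * x) + a0\<^sup>2 * (g x * 1)) =
      (\<lambda>x. g x * (S + (\<alpha> * x - (x\<^sup>2 - \<delta>) / 2))\<^sup>2)"
    by (rule ext) (simp add: a0_def power2_eq_square power3_eq_cube power4_eq_xxxx field_simps)
  moreover have "1 / 4 * (3 * \<delta>\<^sup>2) + (- \<alpha>) * 0 + (\<alpha>\<^sup>2 - a0) * \<delta> + 2 * a0 * \<alpha> * 0 + a0\<^sup>2 * 1
      = S\<^sup>2 + (\<delta> * \<alpha>\<^sup>2 + \<delta>\<^sup>2 / 2)"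
    by (simp add: a0_def power2_eq_square field_simps)
  ultimately have I: "has_bochner_integral lborel (\<lambda>x. g x * (S + (\<alpha> * x - (x\<^sup>2 - \<delta>) / 2))\<^sup>2)
      (S\<^sup>2 + (\<delta> * \<alpha>\<^sup>2 + \<delta>\<^sup>2 / 2))" by simp
  have "(\<integral>\<^sup>+y. ennreal ((S + (\<alpha> * y - (y\<^sup>2 - \<delta>) / 2))\<^sup>2) \<partial>density lborel g)
      = (\<integral>\<^sup>+y. ennreal (g y * (S + (\<alpha> * y - (y\<^sup>2 - \<delta>) / 2))\<^sup>2) \<partial>lborel)"
    by (subst nn_integral_density) (auto simp: g_def ennreal_mult')
  also have "\<dots> = ennreal (S\<^sup>2 + (\<delta> * \<alpha>\<^sup>2 + \<delta>\<^sup>2 / 2))"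
    using I by (subst nn_integral_eq_integral) (auto simp: g_def has_bochner_integral_iff)
  finally show ?thesis by (simp add: g_def)
qed

lemma nn_integral_normal_square_deviation:
  fixes \<alpha> \<delta> :: real
  assumes "\<delta> > 0"
  shows "(\<integral>\<^sup>+y. ennreal ((\<alpha> - y)\<^sup>2) \<partial>normal_law \<delta>) = ennreal (\<alpha>\<^sup>2 + \<delta>)"
proof -
  define g where "g = normal_density 0 (sqrt \<delta>)"
  have s: "sqrt \<delta> > 0" using assms by simp
  have m0: "has_bochner_integral lborel (\<lambda>x. g x * 1) 1"
    using normal_moment_even[OF s, of 0 0] by (simp add: g_def)
  have m1: "has_bochner_integral lborel (\<lambda>x. g x * x) 0"
    using normal_moment_odd[OF s, of 0 0] by (simp add: g_def)
  have m2: "has_bochner_integral lborel (\<lambda>x. g x * x ^ 2) \<delta>"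
    using normal_moment_even[OF s, of 0 1] assms by (simp add: g_def)
  have "has_bochner_integral lborel (\<lambda>x. \<alpha>\<^sup>2 * (g x * 1) + (- 2 * \<alpha>) * (g x * x) + g x * x ^ 2)
      (\<alpha>\<^sup>2 * 1 + (- 2 * \<alpha>) * 0 + \<delta>)"
    by (intro has_bochner_integral_add has_bochner_integral_mult_right m0 m1 m2)
  moreover have "(\<lambda>x. \<alpha>\<^sup>2 * (g x * 1) + (- 2 * \<alpha>) * (g x * x) + g x * x ^ 2) = (\<lambda>x. g x * (\<alpha> - x)\<^sup>2)"
    by (rule ext) (simp add: power2_eq_square algebra_simps)
  ultimately have I: "has_bochner_integral lborel (\<lambda>x. g x * (\<alpha> - x)\<^sup>2) (\<alpha>\<^sup>2 + \<delta>)" by simp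
  have "(\<integral>\<^sup>+y. ennreal ((\<alpha> - y)\<^sup>2) \<partial>density lborel g) = (\<integral>\<^sup>+y. ennreal (g y * (\<alpha> - y)\<^sup>2) \<partial>lborel)"
    by (subst nn_integral_density) (auto simp: g_def ennreal_mult')
  also have "\<dots> = ennreal (\<alpha>\<^sup>2 + \<delta>)"
    using I by (subst nn_integral_eq_integral) (auto simp: g_def has_bochner_integral_iff)
  finally show ?thesis by (simp add: g_def)
qed

lemma natural_filtration_measurable_coordinate:
  assumes "0 \<le> u" "u \<le> t"
  shows "B u \<in> borel_measurable (natural_filtration P B t)"
proof -
  have "(\<lambda>\<omega>. \<lambda>u\<in>{0..t}. B u \<omega>) \<in> measurable (natural_filtration P B t) (PiM {0..t} (\<lambda>_. borel))"
    unfolding natural_filtration_def by (rule measurable_vimage_algebra1) (auto simp: space_PiM)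
  from measurable_compose[OF this measurable_component_singleton[of u]] show ?thesis
    using assms by simp
qed

lemma natural_filtration_subset:
  assumes "\<And>u. 0 \<le> u \<Longrightarrow> u \<le> s \<Longrightarrow> B u \<in> borel_measurable N" "space N = space P"
  shows "sets (natural_filtration P B s) \<subseteq> sets N"
proof -
  have "(\<lambda>\<omega>. \<lambda>u\<in>{0..s}. B u \<omega>) \<in> measurable N (PiM {0..s} (\<lambda>_. borel))"
    using assms(1) by (intro measurable_restrict) auto
  then show ?thesis unfolding natural_filtration_def assms(2)[symmetric] by (rule sets_image_in_sets[OF refl])
qed

lemma space_natural_filtration[simp]: "space (natural_filtration P B s) = space P"
  by (simp add: natural_filtration_def)

lemma measurable_coarser_domain:
  "X \<in> measurable F N \<Longrightarrow> sets F \<subseteq> sets G \<Longrightarrow> space F = space G \<Longrightarrow> X \<in> measurable G N"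
  by (auto simp: measurable_def)

lemma natural_filtration_mono:
  assumes "0 \<le> s" "s \<le> t" "X \<in> measurable (natural_filtration P B s) N"
  shows "X \<in> measurable (natural_filtration P B t) N"
proof -
  have "sets (natural_filtration P B s) \<subseteq> sets (natural_filtration P B t)"
    using assms by (intro natural_filtration_subset natural_filtration_measurable_coordinate) auto
  then show ?thesis by (intro measurable_coarser_domain[OF assms(3)]) auto
qed

lemma brownian_increment_distr:
  assumes "standard_brownian_motion P B" "0 \<le> s" "s < t"
  shows "distr P borel (\<lambda>\<omega>. B t \<omega> - B s \<omega>) = normal_law (t - s)"
proof -
  have "distributed P lborel (\<lambda>\<omega>. B t \<omega> - B s \<omega>) (\<lambda>x. ennreal (normal_density 0 (sqrt (t - s)) x))"
    using assms by (auto simp: standard_brownian_motion_def)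
  then have "distr P lborel (\<lambda>\<omega>. B t \<omega> - B s \<omega>) = normal_law (t - s)"
    by (rule distributed_distr_eq_density)
  moreover have "distr P borel (\<lambda>\<omega>. B t \<omega> - B s \<omega>) = distr P lborel (\<lambda>\<omega>. B t \<omega> - B s \<omega>)"
    by (rule distr_cong) auto
  ultimately show ?thesis by simp
qed

lemma brownian_measurable:
  "standard_brownian_motion P B \<Longrightarrow> 0 \<le> t \<Longrightarrow> B t \<in> borel_measurable P"
  by (auto simp: standard_brownian_motion_def continuous_process_def)

text \<open>Sorting the finitely many past times together with \<open>0\<close> and \<open>s\<close> exhibits the past values as sums of
increments over a partition whose last interval is \<open>[s,t]\<close>. The increment is written as a function on \<open>{0}\<close> because
\<^const>\<open>prob_space.indep_var\<close> compares variables of one type.\<close>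

lemma (in prob_space) brownian_increment_indep_finite_past:
  assumes B: "standard_brownian_motion M B" and st: "0 \<le> s" "s < t"
    and J: "finite J" "J \<subseteq> {0..s}"
  shows "indep_var (PiM J (\<lambda>_. borel)) (\<lambda>\<omega>. \<lambda>j\<in>J. B j \<omega> - B 0 \<omega>)
    (PiM {0} (\<lambda>_. borel)) (\<lambda>\<omega>. \<lambda>_\<in>{0}. B t \<omega> - B s \<omega>)"
proof -
  define K where "K = J \<union> {0, s}"
  have K: "finite K" "K \<subseteq> {0..s}" "0 \<in> K" "s \<in> K" using J st by (auto simp: K_def)
  define L where "L = sorted_list_of_set K"
  have L: "sorted L" "distinct L" "set L = K" using K by (auto simp: L_def)
  then have Lsw: "sorted_wrt (<) L" by (simp add: strict_sorted_iff)
  define n where "n = length L - 1"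
  have len: "length L = Suc n" using L K by (cases L) (auto simp: n_def)
  define p where "p i = (if i \<le> n then L ! i else t)" for i
  have p_mono: "p i < p (Suc i)" if "i < Suc n" for i
  proof (cases "i = n")
    case True
    have "L ! n \<in> K" using L len by (metis lessI nth_mem)
    then show ?thesis using True K st by (auto simp: p_def)
  next
    case False
    then show ?thesis using that Lsw len by (auto simp: p_def intro: sorted_wrt_nth_less)
  qed
  have p_nth: "\<exists>i\<le>n. p i = j" if "j \<in> K" for j
  proof -
    have "j \<in> set L" using that L by simp
    then obtain i where "i < length L" "L ! i = j" by (auto simp: in_set_conv_nth)
    then show ?thesis using len by (intro exI[of _ i]) (auto simp: p_def)
  qed
  have p_le: "p i \<le> p j" if "i \<le> j" "j \<le> n" for i j
    using that L(1) len by (auto simp: p_def intro: sorted_nth_mono)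
  have p_K: "p i \<in> K" if "i \<le> n" for i using that L len by (metis le_imp_less_Suc nth_mem p_def)
  have p0: "p 0 = 0" using p_nth[OF K(3)] p_le[of 0] p_K[of 0] K(2) by force
  have pn: "p n = s" using p_nth[OF K(4)] p_le[of _ n] p_K[of n] K(2) by force
  define idx where "idx j = (SOME i. i \<le> n \<and> p i = j)" for j
  have idx: "idx j \<le> n" "p (idx j) = j" if "j \<in> J" for j
    using someI_ex[OF p_nth[of j]] that by (auto simp: idx_def K_def)
  have "\<forall>(n::nat) p. 0 \<le> p 0 \<and> (\<forall>i<n. p i < p (Suc i)) \<longrightarrow>
      indep_vars (\<lambda>_. borel) (\<lambda>i \<omega>. B (p (Suc i)) \<omega> - B (p i) \<omega>) {..<n}"
    using B unfolding standard_brownian_motion_def by (elim conjE)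
  then have ind: "indep_vars (\<lambda>_. borel) (\<lambda>i \<omega>. B (p (Suc i)) \<omega> - B (p i) \<omega>) {..<Suc n}"
    using p_mono p0 by auto
  have "indep_var (PiM {..<n} (\<lambda>_. borel)) (\<lambda>\<omega>. \<lambda>i\<in>{..<n}. B (p (Suc i)) \<omega> - B (p i) \<omega>)
      (PiM {n} (\<lambda>_. borel)) (\<lambda>\<omega>. \<lambda>i\<in>{n}. B (p (Suc i)) \<omega> - B (p i) \<omega>)"
    by (rule indep_var_restrict[OF ind]) auto
  then have "indep_var (PiM J (\<lambda>_. borel))
      ((\<lambda>x. \<lambda>j\<in>J. \<Sum>i<idx j. x i) \<circ> (\<lambda>\<omega>. \<lambda>i\<in>{..<n}. B (p (Suc i)) \<omega> - B (p i) \<omega>))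
      (PiM {0} (\<lambda>_. borel)) ((\<lambda>x. \<lambda>_\<in>{0}. x n) \<circ> (\<lambda>\<omega>. \<lambda>i\<in>{n}. B (p (Suc i)) \<omega> - B (p i) \<omega>))"
  proof (rule indep_var_compose)
    show "(\<lambda>x. \<lambda>j\<in>J. \<Sum>i<idx j. x i) \<in> measurable (PiM {..<n} (\<lambda>_. borel :: real measure)) (PiM J (\<lambda>_. borel))"
    proof (rule measurable_restrict)
      fix j assume "j \<in> J"
      then have "(\<lambda>x. x i) \<in> borel_measurable (PiM {..<n} (\<lambda>_. borel :: real measure))" if "i \<in> {..<idx j}" for i
        using idx(1)[of j] that by (intro measurable_component_singleton) auto
      from borel_measurable_sum[of "{..<idx j}" "\<lambda>i x. x i", OF this]
      show "(\<lambda>x. \<Sum>i<idx j. x i) \<in> borel_measurable (PiM {..<n} (\<lambda>_. borel :: real measure))" by simp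
    qed
    show "(\<lambda>x. \<lambda>_\<in>{0}. x n) \<in> measurable (PiM {n} (\<lambda>_. borel)) (PiM {0} (\<lambda>_. borel))"
      by (intro measurable_restrict measurable_component_singleton) auto
  qed
  also have "(\<lambda>x. \<lambda>j\<in>J. \<Sum>i<idx j. x i) \<circ> (\<lambda>\<omega>. \<lambda>i\<in>{..<n}. B (p (Suc i)) \<omega> - B (p i) \<omega>)
      = (\<lambda>\<omega>. \<lambda>j\<in>J. B j \<omega> - B 0 \<omega>)"
  proof (intro ext)
    fix \<omega> j
    have "(\<Sum>i<idx j. (\<lambda>i\<in>{..<n}. B (p (Suc i)) \<omega> - B (p i) \<omega>) i) = B j \<omega> - B 0 \<omega>" if "j \<in> J"
    proof -
      have "(\<Sum>i<idx j. (\<lambda>i\<in>{..<n}. B (p (Suc i)) \<omega> - B (p i) \<omega>) i) = (\<Sum>i<idx j. B (p (Suc i)) \<omega> - B (p i) \<omega>)"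
        using idx[OF that] by (intro sum.cong) auto
      also have "\<dots> = B j \<omega> - B 0 \<omega>"
        using sum_lessThan_telescope[of "\<lambda>i. B (p i) \<omega>" "idx j"] idx[OF that] p0 by simp
      finally show ?thesis .
    qed
    then show "((\<lambda>x. \<lambda>j\<in>J. \<Sum>i<idx j. x i) \<circ> (\<lambda>\<omega>. \<lambda>i\<in>{..<n}. B (p (Suc i)) \<omega> - B (p i) \<omega>)) \<omega> j
      = (\<lambda>j\<in>J. B j \<omega> - B 0 \<omega>) j" by auto
  qed
  also have "(\<lambda>x. \<lambda>_\<in>{0}. x n) \<circ> (\<lambda>\<omega>. \<lambda>i\<in>{n}. B (p (Suc i)) \<omega> - B (p i) \<omega>)
      = (\<lambda>\<omega>. \<lambda>_\<in>{0::real}. B t \<omega> - B s \<omega>)"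
    using pn by (auto simp: fun_eq_iff p_def)
  finally show ?thesis .
qed

text \<open>The past is generated by the intersection stable family of cylinder sets, to which the finite-dimensional
statement applies because \<open>B 0 = 0\<close> almost surely.\<close>

lemma (in prob_space) brownian_increment_indep_past:
  assumes B: "standard_brownian_motion M B" and st: "0 \<le> s" "s < t"
  shows "indep_set (sets (natural_filtration M B s)) {(\<lambda>\<omega>. B t \<omega> - B s \<omega>) -` C \<inter> space M |C. C \<in> sets borel}"
proof -
  note [measurable] = brownian_measurable[OF B]
  let ?f = "\<lambda>\<omega>. \<lambda>u\<in>{0..s}. B u \<omega>" and ?D = "\<lambda>\<omega>. B t \<omega> - B s \<omega>"
  let ?\<D> = "{?D -` C \<inter> space M |C. C \<in> sets borel}"
  let ?\<G> = "{?f -` A \<inter> space M |A. A \<in> prod_algebra {0..s} (\<lambda>_. borel :: real measure)}"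
  have D_meas: "?D \<in> borel_measurable M" using st by (intro borel_measurable_diff) auto
  have f_meas: "?f \<in> measurable M (PiM {0..s} (\<lambda>_. borel))" by (intro measurable_restrict) auto
  have B0: "AE \<omega> in M. B 0 \<omega> = 0" using B by (simp add: standard_brownian_motion_def)
  have alg_sets: "prod_algebra {0..s} (\<lambda>_. borel :: real measure) \<subseteq> sets (PiM {0..s} (\<lambda>_. borel))"
    by (auto simp: sets_PiM)
  have F: "sets (natural_filtration M B s) = sigma_sets (space M) ?\<G>"
  proof -
    have "sets (natural_filtration M B s) = sets (vimage_algebra (space M) ?f
        (sigma (\<Pi>\<^sub>E i\<in>{0..s}. space borel) (prod_algebra {0..s} (\<lambda>_. borel :: real measure))))"
      unfolding natural_filtration_def using prod_algebra_sets_into_space[of "{0..s}" "\<lambda>_. borel :: real measure"]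
      by (intro sets_vimage_algebra_cong) (simp add: sets_PiM)
    also have "\<dots> = sigma_sets (space M) ?\<G>"
      using prod_algebra_sets_into_space[of "{0..s}" "\<lambda>_. borel :: real measure"]
      by (subst vimage_algebra_sigma) (auto intro!: sets_measure_of)
    finally show ?thesis .
  qed
  have indep: "indep_set ?\<G> ?\<D>"
  proof (rule indep_setI)
    show "?\<G> \<subseteq> events" using f_meas alg_sets by (auto dest: measurable_sets)
    show "?\<D> \<subseteq> events" using D_meas by (auto dest: measurable_sets)
    fix a b assume "a \<in> ?\<G>" "b \<in> ?\<D>"
    then obtain A C where A: "A \<in> prod_algebra {0..s} (\<lambda>_. borel :: real measure)" and a: "a = ?f -` A \<inter> space M"
      and C: "C \<in> sets borel" and b: "b = ?D -` C \<inter> space M" by auto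
    obtain J E where A_eq: "A = prod_emb {0..s} (\<lambda>_. borel) J (\<Pi>\<^sub>E j\<in>J. E j)"
      and J: "finite J" "J \<subseteq> {0..s}" and E: "\<And>i. i \<in> J \<Longrightarrow> E i \<in> sets borel"
      using prod_algebraE[OF A] by metis
    have a_eq: "a = {\<omega>\<in>space M. \<forall>j\<in>J. B j \<omega> \<in> E j}"
      using J unfolding a A_eq by (auto simp: prod_emb_def PiE_iff Pi_iff subset_eq split: if_splits)
    define a' where "a' = {\<omega>\<in>space M. \<forall>j\<in>J. B j \<omega> - B 0 \<omega> \<in> E j}"
    have ind: "indep_var (PiM J (\<lambda>_. borel)) (\<lambda>\<omega>. \<lambda>j\<in>J. B j \<omega> - B 0 \<omega>)
      (PiM {0::real} (\<lambda>_. borel)) (\<lambda>\<omega>. \<lambda>_\<in>{0}. ?D \<omega>)"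
      by (rule brownian_increment_indep_finite_past[OF B st J])
    have "prob ((\<lambda>x. (\<lambda>j\<in>J. B j x - B 0 x, \<lambda>_\<in>{0::real}. ?D x)) -` (PiE J E \<times> PiE {0} (\<lambda>_. C)) \<inter> space M) =
       prob ((\<lambda>\<omega>. \<lambda>j\<in>J. B j \<omega> - B 0 \<omega>) -` PiE J E \<inter> space M) * prob ((\<lambda>\<omega>. \<lambda>_\<in>{0::real}. ?D \<omega>) -` PiE {0} (\<lambda>_. C) \<inter> space M)"
      using ind by (rule indep_varD) (use J E C in \<open>auto intro!: sets_PiM_I_finite\<close>)
    moreover have "(\<lambda>x. (\<lambda>j\<in>J. B j x - B 0 x, \<lambda>_\<in>{0::real}. ?D x)) -` (PiE J E \<times> PiE {0} (\<lambda>_. C)) \<inter> space M = a' \<inter> b"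
      unfolding a'_def b by (auto simp: PiE_iff)
    moreover have "(\<lambda>\<omega>. \<lambda>j\<in>J. B j \<omega> - B 0 \<omega>) -` PiE J E \<inter> space M = a'"
      unfolding a'_def by (auto simp: PiE_iff)
    moreover have "(\<lambda>\<omega>. \<lambda>_\<in>{0::real}. ?D \<omega>) -` PiE {0} (\<lambda>_. C) \<inter> space M = b"
      unfolding b by (auto simp: PiE_iff)
    ultimately have prod: "prob (a' \<inter> b) = prob a' * prob b" by simp
    have a_ev: "a \<in> events" using A alg_sets f_meas unfolding a by (auto dest: measurable_sets)
    have b_ev: "b \<in> events" using C D_meas unfolding b by (auto dest: measurable_sets)
    have a'_ev: "a' \<in> events"
    proof -
      have "{\<omega>\<in>space M. B j \<omega> - B 0 \<omega> \<in> E j} \<in> events" if j: "j \<in> J" for j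
      proof -
        have "0 \<le> j" using J(2) j by auto
        then have "(\<lambda>\<omega>. B j \<omega> - B 0 \<omega>) \<in> borel_measurable M" by measurable
        from measurable_sets[OF this E[OF j]] show ?thesis
          by (simp add: vimage_def Int_def conj_commute)
      qed
      then show ?thesis unfolding a'_def using J(1) by (intro sets.sets_Collect_finite_All) (auto simp: J)
    qed
    have "prob a = prob a'" using B0 a_ev a'_ev unfolding a_eq a'_def
      by (intro finite_measure_eq_AE) auto
    moreover have "prob (a \<inter> b) = prob (a' \<inter> b)" using B0 a_ev a'_ev b_ev unfolding a_eq a'_def
      by (intro finite_measure_eq_AE) auto
    ultimately show "prob (a \<inter> b) = prob a * prob b" using prod by simp
  qed
  have "indep_set (sigma_sets (space M) ?\<G>) (sigma_sets (space M) ?\<D>)"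
  proof (rule indep_set_sigma_sets[OF indep])
    show "Int_stable ?\<G>"
    proof (rule Int_stableI, safe)
      fix A A' :: "(real \<Rightarrow> real) set" 
      assume "A \<in> prod_algebra {0..s} (\<lambda>_. borel)" "A' \<in> prod_algebra {0..s} (\<lambda>_. borel)"
      then have "A \<inter> A' \<in> prod_algebra {0..s} (\<lambda>_. borel)"
        using Int_stable_prod_algebra by (auto simp: Int_stable_def)
      then show "\<exists>Aa. ?f -` A \<inter> space M \<inter> (?f -` A' \<inter> space M) = ?f -` Aa \<inter> space M \<and>
          Aa \<in> prod_algebra {0..s} (\<lambda>_. borel)" by (intro exI[of _ "A \<inter> A'"]) auto
    qed
    show "Int_stable ?\<D>"
    proof (rule Int_stableI, safe)
      fix A A' :: "real set" assume "A \<in> sets borel" "A' \<in> sets borel"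
      then show "\<exists>C. ?D -` A \<inter> space M \<inter> (?D -` A' \<inter> space M) = ?D -` C \<inter> space M \<and> C \<in> sets borel"
        by (intro exI[of _ "A \<inter> A'"]) auto
    qed
  qed
  then show ?thesis unfolding F indep_set_def
    by (rule indep_sets_mono_sets) (auto split: bool.split)
qed

text \<open>Conditioning on the past at time \<open>s\<close>: the increment is integrated out against its Gaussian law.\<close>

lemma (in prob_space) nn_integral_past_increment:
  assumes B: "standard_brownian_motion M B" and st: "0 \<le> s" "s < t"
    and X: "X \<in> measurable (natural_filtration M B s) N"
    and f[measurable]: "f \<in> borel_measurable (N \<Otimes>\<^sub>M borel)"
  shows "(\<integral>\<^sup>+\<omega>. f (X \<omega>, B t \<omega> - B s \<omega>) \<partial>M)
    = (\<integral>\<^sup>+\<omega>. (\<integral>\<^sup>+y. f (X \<omega>, y) \<partial>normal_law (t - s)) \<partial>M)"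
proof -
  let ?D = "\<lambda>\<omega>. B t \<omega> - B s \<omega>"
  have D_meas[measurable]: "?D \<in> borel_measurable M"
    using st brownian_measurable[OF B] by (intro borel_measurable_diff) auto
  have sub: "sets (natural_filtration M B s) \<subseteq> sets M"
    by (rule natural_filtration_subset) (auto intro: brownian_measurable[OF B])
  have X_meas[measurable]: "X \<in> measurable M N"
    by (rule measurable_coarser_domain[OF X sub]) simp
  interpret X: prob_space "distr M N X" by (rule prob_space_distr) (rule X_meas)
  interpret D: prob_space "distr M borel ?D" by (rule prob_space_distr) (rule D_meas)
  interpret XD: pair_prob_space "distr M N X" "distr M borel ?D" ..
  have law: "distr M N X \<Otimes>\<^sub>M distr M borel ?D = distr M (N \<Otimes>\<^sub>M borel) (\<lambda>\<omega>. (X \<omega>, ?D \<omega>))"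
  proof (rule pair_measure_eqI)
    fix A C assume "A \<in> sets (distr M N X)" "C \<in> sets (distr M borel ?D)"
    then have A: "A \<in> sets N" and C: "C \<in> sets borel" by auto
    have "X -` A \<inter> space M \<in> sets (natural_filtration M B s)" using measurable_sets[OF X A] by simp
    then have "prob ((X -` A \<inter> space M) \<inter> (?D -` C \<inter> space M)) = prob (X -` A \<inter> space M) * prob (?D -` C \<inter> space M)"
      using C by (intro indep_setD[OF brownian_increment_indep_past[OF B st]]) auto
    moreover have "(\<lambda>\<omega>. (X \<omega>, ?D \<omega>)) -` (A \<times> C) \<inter> space M = (X -` A \<inter> space M) \<inter> (?D -` C \<inter> space M)" by auto
    ultimately show "emeasure (distr M N X) A * emeasure (distr M borel ?D) C
        = emeasure (distr M (N \<Otimes>\<^sub>M borel) (\<lambda>\<omega>. (X \<omega>, ?D \<omega>))) (A \<times> C)"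
      using A C by (simp add: emeasure_distr emeasure_eq_measure ennreal_mult')
  qed (simp_all add: X.sigma_finite_measure_axioms D.sigma_finite_measure_axioms)
  have "(\<integral>\<^sup>+\<omega>. f (X \<omega>, ?D \<omega>) \<partial>M) = (\<integral>\<^sup>+z. f z \<partial>distr M (N \<Otimes>\<^sub>M borel) (\<lambda>\<omega>. (X \<omega>, ?D \<omega>)))"
    by (subst nn_integral_distr) auto
  also have "\<dots> = (\<integral>\<^sup>+x. \<integral>\<^sup>+y. f (x, y) \<partial>distr M borel ?D \<partial>distr M N X)"
    unfolding law[symmetric] by (subst D.nn_integral_fst[symmetric]) auto
  also have "\<dots> = (\<integral>\<^sup>+\<omega>. (\<integral>\<^sup>+y. f (X \<omega>, y) \<partial>distr M borel ?D) \<partial>M)"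
    by (subst nn_integral_distr) (auto intro!: D.borel_measurable_nn_integral)
  finally show ?thesis unfolding brownian_increment_distr[OF B st] .
qed

section \<open>The Ito integral of Brownian motion and the Ito lift\<close>

text \<open>The stochastic integral of a simple integrand minus \<open>((B (p j) - B (p 0))\<^sup>2 - (p j - p 0)) / 2\<close>, written as a sum of
martingale differences (see \<open>ito_defect_eq\<close>).\<close>

definition ito_defect ::
  "(real \<Rightarrow> 'w \<Rightarrow> real) \<Rightarrow> (nat \<Rightarrow> real) \<Rightarrow> (nat \<Rightarrow> 'w \<Rightarrow> real) \<Rightarrow> nat \<Rightarrow> 'w \<Rightarrow> real" where
  "ito_defect B p \<xi> j \<omega> = (\<Sum>i<j. (\<xi> i \<omega> - (B (p i) \<omega> - B (p 0) \<omega>)) * (B (p (Suc i)) \<omega> - B (p i) \<omega>)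
     - ((B (p (Suc i)) \<omega> - B (p i) \<omega>)\<^sup>2 - (p (Suc i) - p i)) / 2)"

lemma ito_defect_eq:
  "ito_defect B p \<xi> j \<omega> = step_integral B j p \<xi> \<omega> - ((B (p j) \<omega> - B (p 0) \<omega>)\<^sup>2 - (p j - p 0)) / 2"
proof (induction j)
  case 0
  then show ?case by (simp add: ito_defect_def step_integral_def)
next
  case (Suc j)
  have "ito_defect B p \<xi> (Suc j) \<omega> = ito_defect B p \<xi> j \<omega>
      + ((\<xi> j \<omega> - (B (p j) \<omega> - B (p 0) \<omega>)) * (B (p (Suc j)) \<omega> - B (p j) \<omega>)
      - ((B (p (Suc j)) \<omega> - B (p j) \<omega>)\<^sup>2 - (p (Suc j) - p j)) / 2)"
    by (simp add: ito_defect_def)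
  also have "\<dots> = step_integral B (Suc j) p \<xi> \<omega> - ((B (p (Suc j)) \<omega> - B (p 0) \<omega>)\<^sup>2 - (p (Suc j) - p 0)) / 2"
    unfolding Suc.IH by (simp add: step_integral_def field_simps power2_eq_square)
  finally show ?case .
qed

text \<open>Orthogonality of the martingale differences, obtained by integrating out one increment at a time. Working
with nonnegative integrals makes integrability questions disappear.\<close>

lemma (in prob_space) ito_defect_second_moment:
  assumes B: "standard_brownian_motion M B" and "0 \<le> a"
    and \<xi>: "simple_integrand M (natural_filtration M B) a b n p \<xi>" and "j \<le> n"
  shows "ito_defect B p \<xi> j \<in> borel_measurable (natural_filtration M B (p j)) \<and>
    (\<integral>\<^sup>+\<omega>. ennreal ((ito_defect B p \<xi> j \<omega>)\<^sup>2) \<partial>M) = (\<Sum>i<j. ennreal (p (Suc i) - p i) *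
      (\<integral>\<^sup>+\<omega>. ennreal ((\<xi> i \<omega> - (B (p i) \<omega> - B a \<omega>))\<^sup>2) \<partial>M) + ennreal ((p (Suc i) - p i)\<^sup>2 / 2))"
  using \<open>j \<le> n\<close>
proof (induction j)
  case 0
  have "ito_defect B p \<xi> 0 = (\<lambda>_. 0)" by (simp add: ito_defect_def fun_eq_iff)
  then show ?case by simp
next
  case (Suc j)
  have part: "is_partition a b n p" using \<xi> by (simp add: simple_integrand_def)
  have p0: "p 0 = a" using part by (simp add: is_partition_def)
  have j: "j < n" "0 \<le> p j" "p j < p (Suc j)" "a \<le> p j"
    using Suc.prems part is_partition_in[OF part, of j] \<open>0 \<le> a\<close> by (auto simp: is_partition_def)
  define \<delta> where "\<delta> = p (Suc j) - p j"
  have \<delta>: "\<delta> > 0" using j by (simp add: \<delta>_def)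
  define \<alpha> where "\<alpha> \<omega> = \<xi> j \<omega> - (B (p j) \<omega> - B a \<omega>)" for \<omega>
  let ?F = "natural_filtration M B (p j)"
  have [measurable]: "\<xi> j \<in> borel_measurable ?F" using \<xi> j by (auto simp: simple_integrand_def)
  have [measurable]: "B (p j) \<in> borel_measurable ?F" "B a \<in> borel_measurable ?F"
    using j \<open>0 \<le> a\<close> by (auto intro!: natural_filtration_measurable_coordinate)
  have \<alpha>_F[measurable]: "\<alpha> \<in> borel_measurable ?F" unfolding \<alpha>_def[abs_def] by measurable
  have D_F[measurable]: "ito_defect B p \<xi> j \<in> borel_measurable ?F"
    using Suc by simp
  have sub: "sets ?F \<subseteq> sets M"
    by (rule natural_filtration_subset) (auto intro: brownian_measurable[OF B])
  have [measurable]: "\<alpha> \<in> borel_measurable M" "ito_defect B p \<xi> j \<in> borel_measurable M"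
    by (rule measurable_coarser_domain[OF _ sub]; simp)+
  have step: "ito_defect B p \<xi> (Suc j) \<omega> = ito_defect B p \<xi> j \<omega>
      + (\<alpha> \<omega> * (B (p (Suc j)) \<omega> - B (p j) \<omega>) - ((B (p (Suc j)) \<omega> - B (p j) \<omega>)\<^sup>2 - \<delta>) / 2)" for \<omega>
    by (simp add: ito_defect_def \<alpha>_def \<delta>_def p0)
  have "(\<integral>\<^sup>+\<omega>. ennreal ((ito_defect B p \<xi> (Suc j) \<omega>)\<^sup>2) \<partial>M) =
    (\<integral>\<^sup>+\<omega>. (\<lambda>q. ennreal ((fst (fst q) + (snd (fst q) * snd q - ((snd q)\<^sup>2 - \<delta>) / 2))\<^sup>2))
        ((ito_defect B p \<xi> j \<omega>, \<alpha> \<omega>), B (p (Suc j)) \<omega> - B (p j) \<omega>) \<partial>M)"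
    by (simp add: step)
  also have "\<dots> = (\<integral>\<^sup>+\<omega>. (\<integral>\<^sup>+z. (\<lambda>q. ennreal ((fst (fst q) + (snd (fst q) * snd q - ((snd q)\<^sup>2 - \<delta>) / 2))\<^sup>2))
        ((ito_defect B p \<xi> j \<omega>, \<alpha> \<omega>), z) \<partial>normal_law (p (Suc j) - p j)) \<partial>M)"
    by (rule nn_integral_past_increment[OF B j(2,3), where N = "borel \<Otimes>\<^sub>M borel"]) measurable
  also have "\<dots> = (\<integral>\<^sup>+\<omega>. ennreal ((ito_defect B p \<xi> j \<omega>)\<^sup>2 + (\<delta> * (\<alpha> \<omega>)\<^sup>2 + \<delta>\<^sup>2 / 2)) \<partial>M)"
    using nn_integral_normal_martingale_increment[OF \<delta>] by (simp add: \<delta>_def)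
  also have "\<dots> = (\<integral>\<^sup>+\<omega>. ennreal ((ito_defect B p \<xi> j \<omega>)\<^sup>2) + (ennreal \<delta> * ennreal ((\<alpha> \<omega>)\<^sup>2) + ennreal (\<delta>\<^sup>2 / 2)) \<partial>M)"
    using \<delta> by (simp add: ennreal_plus ennreal_mult)
  also have "\<dots> = (\<integral>\<^sup>+\<omega>. ennreal ((ito_defect B p \<xi> j \<omega>)\<^sup>2) \<partial>M) + (ennreal \<delta> * (\<integral>\<^sup>+\<omega>. ennreal ((\<alpha> \<omega>)\<^sup>2) \<partial>M) + ennreal (\<delta>\<^sup>2 / 2))"
    by (simp add: nn_integral_add nn_integral_cmult emeasure_space_1)
  finally have moment: "(\<integral>\<^sup>+\<omega>. ennreal ((ito_defect B p \<xi> (Suc j) \<omega>)\<^sup>2) \<partial>M) =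
    (\<integral>\<^sup>+\<omega>. ennreal ((ito_defect B p \<xi> j \<omega>)\<^sup>2) \<partial>M) + (ennreal \<delta> * (\<integral>\<^sup>+\<omega>. ennreal ((\<alpha> \<omega>)\<^sup>2) \<partial>M) + ennreal (\<delta>\<^sup>2 / 2))" .
  have "ito_defect B p \<xi> (Suc j) \<in> borel_measurable (natural_filtration M B (p (Suc j)))"
  proof -
    have [measurable]: "\<alpha> \<in> borel_measurable (natural_filtration M B (p (Suc j)))"
        "ito_defect B p \<xi> j \<in> borel_measurable (natural_filtration M B (p (Suc j)))"
      using j by (auto intro!: natural_filtration_mono[of "p j" "p (Suc j)"])
    have [measurable]: "B (p j) \<in> borel_measurable (natural_filtration M B (p (Suc j)))"
        "B (p (Suc j)) \<in> borel_measurable (natural_filtration M B (p (Suc j)))"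
      using j by (auto intro!: natural_filtration_measurable_coordinate)
    show ?thesis unfolding step[abs_def] by measurable
  qed
  then show ?case using moment Suc by (simp add: \<alpha>_def \<delta>_def)
qed

lemma nn_integral_affine_interval:
  fixes c :: ennreal
  assumes "a \<le> (b::real)"
  shows "(\<integral>\<^sup>+u. (c + ennreal (u - a)) * indicator {a<..b} u \<partial>lborel) = ennreal (b - a) * c + ennreal ((b - a)\<^sup>2 / 2)"
proof -
  have "(\<integral>\<^sup>+u. (c + ennreal (u - a)) * indicator {a<..b} u \<partial>lborel) =
      (\<integral>\<^sup>+u. c * indicator {a<..b} u + ennreal (u - a) * indicator {a..b} u \<partial>lborel)"
    by (intro nn_integral_cong) (auto simp: indicator_def)
  also have "\<dots> = c * ennreal (b - a) + (\<integral>\<^sup>+u. ennreal (u - a) * indicator {a..b} u \<partial>lborel)"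
    using assms by (subst nn_integral_add) (auto simp: nn_integral_cmult_indicator)
  also have "(\<integral>\<^sup>+u. ennreal (u - a) * indicator {a..b} u \<partial>lborel) = ennreal ((b - a)\<^sup>2 / 2 - (a - a)\<^sup>2 / 2)"
    using assms by (intro nn_integral_FTC_Icc) (auto intro!: derivative_eq_intros)
  finally show ?thesis by (simp add: mult.commute)
qed

text \<open>Splitting \<open>B u - B a\<close> at \<open>q\<close>, the fresh increment contributes its variance \<open>u - q\<close>.\<close>

lemma (in prob_space) brownian_square_deviation:
  assumes B: "standard_brownian_motion M B" and "0 \<le> a" "a \<le> q" "q < u"
    and \<xi>[measurable]: "\<xi> \<in> borel_measurable (natural_filtration M B q)"
  shows "(\<integral>\<^sup>+\<omega>. ennreal ((\<xi> \<omega> - (B u \<omega> - B a \<omega>))\<^sup>2) \<partial>M)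
    = (\<integral>\<^sup>+\<omega>. ennreal ((\<xi> \<omega> - (B q \<omega> - B a \<omega>))\<^sup>2) \<partial>M) + ennreal (u - q)"
proof -
  define \<alpha> where "\<alpha> \<omega> = \<xi> \<omega> - (B q \<omega> - B a \<omega>)" for \<omega>
  have [measurable]: "B q \<in> borel_measurable (natural_filtration M B q)" "B a \<in> borel_measurable (natural_filtration M B q)"
    using assms by (auto intro!: natural_filtration_measurable_coordinate)
  have \<alpha>[measurable]: "\<alpha> \<in> borel_measurable (natural_filtration M B q)" unfolding \<alpha>_def[abs_def] by measurable
  have sub: "sets (natural_filtration M B q) \<subseteq> sets M"
    by (rule natural_filtration_subset) (auto intro: brownian_measurable[OF B])
  have [measurable]: "\<alpha> \<in> borel_measurable M" by (rule measurable_coarser_domain[OF \<alpha> sub]) simp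
  have "(\<integral>\<^sup>+\<omega>. ennreal ((\<xi> \<omega> - (B u \<omega> - B a \<omega>))\<^sup>2) \<partial>M) =
      (\<integral>\<^sup>+\<omega>. (\<lambda>(x, y). ennreal ((x - y)\<^sup>2)) (\<alpha> \<omega>, B u \<omega> - B q \<omega>) \<partial>M)"
    by (simp add: \<alpha>_def algebra_simps)
  also have "\<dots> = (\<integral>\<^sup>+\<omega>. (\<integral>\<^sup>+y. (\<lambda>(x, y). ennreal ((x - y)\<^sup>2)) (\<alpha> \<omega>, y)
      \<partial>normal_law (u - q)) \<partial>M)"
    by (rule nn_integral_past_increment[OF B _ _ \<alpha>]) (use assms in auto)
  also have "\<dots> = (\<integral>\<^sup>+\<omega>. ennreal ((\<alpha> \<omega>)\<^sup>2 + (u - q)) \<partial>M)"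
    using assms by (simp add: nn_integral_normal_square_deviation)
  also have "\<dots> = (\<integral>\<^sup>+\<omega>. ennreal ((\<alpha> \<omega>)\<^sup>2) + ennreal (u - q) \<partial>M)"
    using assms by (simp add: ennreal_plus)
  also have "\<dots> = (\<integral>\<^sup>+\<omega>. ennreal ((\<alpha> \<omega>)\<^sup>2) \<partial>M) + ennreal (u - q)"
    by (simp add: nn_integral_add emeasure_space_1)
  finally show ?thesis by (simp add: \<alpha>_def)
qed

text \<open>One half of the isometry \<open>E (\<integral>\<xi> dB - Q)\<^sup>2 = \<integral> E (\<xi> - B)\<^sup>2 du\<close>.
Over one interval of length \<open>\<Delta>\<close> both sides equal \<open>\<Delta> E(\<xi> - B)\<^sup>2 + \<Delta>\<^sup>2/2\<close>, the deviation being taken at the left end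
point.\<close>

lemma (in prob_space) ito_defect_le_integrand_distance:
  assumes B: "standard_brownian_motion M B" and a: "0 \<le> a"
    and \<xi>: "simple_integrand M (natural_filtration M B) a b n p \<xi>"
  shows "(\<integral>\<^sup>+\<omega>. ennreal ((ito_defect B p \<xi> n \<omega>)\<^sup>2) \<partial>M)
    \<le> (\<integral>\<^sup>+u\<in>{a..b}. (\<integral>\<^sup>+\<omega>. ennreal ((step_process n p \<xi> u \<omega> - (B u \<omega> - B a \<omega>))\<^sup>2) \<partial>M) \<partial>lborel)"
proof -
  have part: "is_partition a b n p" using \<xi> by (simp add: simple_integrand_def)
  define c where "c i = (\<integral>\<^sup>+\<omega>. ennreal ((\<xi> i \<omega> - (B (p i) \<omega> - B a \<omega>))\<^sup>2) \<partial>M)" for i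
  have p_in: "a \<le> p i" "p i \<le> b" if "i \<le> n" for i using is_partition_in[OF part that] by auto
  have p_mono: "p i < p (Suc i)" if "i < n" for i using part that by (auto simp: is_partition_def)
  have "(\<integral>\<^sup>+\<omega>. ennreal ((ito_defect B p \<xi> n \<omega>)\<^sup>2) \<partial>M) =
      (\<Sum>i<n. ennreal (p (Suc i) - p i) * c i + ennreal ((p (Suc i) - p i)\<^sup>2 / 2))"
    using ito_defect_second_moment[OF B a \<xi> order_refl] by (simp add: c_def)
  also have "\<dots> = (\<Sum>i<n. \<integral>\<^sup>+u. (c i + ennreal (u - p i)) * indicator {p i<..p (Suc i)} u \<partial>lborel)"
    using p_mono by (intro sum.cong refl, subst nn_integral_affine_interval) (auto intro: less_imp_le)
  also have "\<dots> = (\<integral>\<^sup>+u. (\<Sum>i<n. (c i + ennreal (u - p i)) * indicator {p i<..p (Suc i)} u) \<partial>lborel)"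
    by (rule nn_integral_sum[symmetric]) measurable
  also have "\<dots> \<le> (\<integral>\<^sup>+u\<in>{a..b}. (\<integral>\<^sup>+\<omega>. ennreal ((step_process n p \<xi> u \<omega> - (B u \<omega> - B a \<omega>))\<^sup>2) \<partial>M) \<partial>lborel)"
  proof (rule nn_integral_mono)
    fix u :: real
    show "(\<Sum>i<n. (c i + ennreal (u - p i)) * indicator {p i<..p (Suc i)} u)
      \<le> (\<integral>\<^sup>+\<omega>. ennreal ((step_process n p \<xi> u \<omega> - (B u \<omega> - B a \<omega>))\<^sup>2) \<partial>M) * indicator {a..b} u"
    proof (cases "\<exists>i<n. u \<in> {p i<..p (Suc i)}")
      case False
      then have "(\<Sum>i<n. (c i + ennreal (u - p i)) * indicator {p i<..p (Suc i)} u) = 0"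
        by (intro sum.neutral) auto
      then show ?thesis by simp
    next
      case True
      then obtain i where i: "i < n" "u \<in> {p i<..p (Suc i)}" by blast
      have uniq: "u \<notin> {p j<..p (Suc j)}" if "j < n" "j \<noteq> i" for j
      proof (cases "j < i")
        case True
        then have "p (Suc j) \<le> p i" using i(1) by (intro is_partition_mono[OF part]) auto
        then show ?thesis using i by auto
      next
        case False
        then have "p (Suc i) \<le> p j" using that by (intro is_partition_mono[OF part]) auto
        then show ?thesis using i by auto
      qed
      have "(\<Sum>j<n. (c j + ennreal (u - p j)) * indicator {p j<..p (Suc j)} u) = (\<Sum>j\<in>{i}. (c j + ennreal (u - p j)) * indicator {p j<..p (Suc j)} u)"
        using i uniq by (intro sum.mono_neutral_right) auto
      also have "\<dots> = c i + ennreal (u - p i)" using i by simp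
      also have "\<dots> = (\<integral>\<^sup>+\<omega>. ennreal ((\<xi> i \<omega> - (B u \<omega> - B a \<omega>))\<^sup>2) \<partial>M)"
        unfolding c_def using i p_in(1)[of i] \<xi>
        by (intro brownian_square_deviation[symmetric, OF B a]) (auto simp: simple_integrand_def)
      also have "\<dots> = (\<integral>\<^sup>+\<omega>. ennreal ((step_process n p \<xi> u \<omega> - (B u \<omega> - B a \<omega>))\<^sup>2) \<partial>M)"
      proof -
        have "step_process n p \<xi> u \<omega> = \<xi> i \<omega>" for \<omega>
        proof -
          have "(\<Sum>j\<in>{..<n} - {i}. \<xi> j \<omega> * indicator {p j<..p (Suc j)} u) = 0"
            using uniq by (intro sum.neutral) auto
          then show ?thesis
            unfolding step_process_def using i by (subst sum.remove[of _ i]) (auto simp del: sum_mult_indicator)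
        qed
        then show ?thesis by simp
      qed
      finally show ?thesis using i p_in(1)[of i] p_in(2)[of "Suc i"] by (simp add: indicator_def)
    qed
  qed
  finally show ?thesis .
qed

text \<open>Every approximating sequence of simple integrands has stochastic integrals that converge to
\<open>((B b - B a)\<^sup>2 - (b - a)) / 2\<close> in \<open>L\<^sup>2\<close>, by the isometry.\<close>

lemma (in prob_space) ito_integral_brownian:
  assumes B: "standard_brownian_motion M B" and "0 \<le> a" "a \<le> b"
    and I: "has_ito_integral M (natural_filtration M B) B (\<lambda>u \<omega>. B u \<omega> - B a \<omega>) a b I"
  shows "AE \<omega> in M. I \<omega> = ((B b \<omega> - B a \<omega>)\<^sup>2 - (b - a)) / 2"
proof -
  define Q where "Q \<omega> = ((B b \<omega> - B a \<omega>)\<^sup>2 - (b - a)) / 2" for \<omega>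
  have [measurable]: "B b \<in> borel_measurable M" "B a \<in> borel_measurable M"
    using brownian_measurable[OF B] assms by auto
  have Q[measurable]: "Q \<in> borel_measurable M" unfolding Q_def[abs_def] by measurable
  have I_m[measurable]: "I \<in> borel_measurable M" using I by (simp add: has_ito_integral_def)
  obtain n p \<xi> where \<xi>: "\<And>m::nat. simple_integrand M (natural_filtration M B) a b (n m) (p m) (\<xi> m)"
    and y: "(\<lambda>m. \<integral>\<^sup>+u\<in>{a..b}. (\<integral>\<^sup>+\<omega>. ennreal ((step_process (n m) (p m) (\<xi> m) u \<omega> - (B u \<omega> - B a \<omega>))\<^sup>2) \<partial>M) \<partial>lborel) \<longlonglongrightarrow> 0"
    and x: "(\<lambda>m. \<integral>\<^sup>+\<omega>. ennreal ((step_integral B (n m) (p m) (\<xi> m) \<omega> - I \<omega>)\<^sup>2) \<partial>M) \<longlonglongrightarrow> 0"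
    using I unfolding has_ito_integral_def by (elim conjE exE) (rule that, erule spec, assumption, assumption)
  define X where "X m = (\<integral>\<^sup>+\<omega>. ennreal ((step_integral B (n m) (p m) (\<xi> m) \<omega> - I \<omega>)\<^sup>2) \<partial>M)" for m
  define Y where "Y m = (\<integral>\<^sup>+u\<in>{a..b}. (\<integral>\<^sup>+\<omega>. ennreal ((step_process (n m) (p m) (\<xi> m) u \<omega> - (B u \<omega> - B a \<omega>))\<^sup>2) \<partial>M) \<partial>lborel)" for m
  have bound: "(\<integral>\<^sup>+\<omega>. ennreal ((I \<omega> - Q \<omega>)\<^sup>2) \<partial>M) \<le> 2 * X m + 2 * Y m" for m
  proof -
    define S D where "S = step_integral B (n m) (p m) (\<xi> m)" and "D = ito_defect B (p m) (\<xi> m) (n m)"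
    have part: "is_partition a b (n m) (p m)" using \<xi> by (simp add: simple_integrand_def)
    have D_eq: "D \<omega> = S \<omega> - Q \<omega>" for \<omega>
      using ito_defect_eq[of B "p m" "\<xi> m" "n m" \<omega>] part by (simp add: D_def S_def Q_def is_partition_def)
    have sub: "sets (natural_filtration M B (p m (n m))) \<subseteq> sets M"
      by (rule natural_filtration_subset) (auto intro: brownian_measurable[OF B])
    have D[measurable]: "D \<in> borel_measurable M"
      using ito_defect_second_moment[OF B \<open>0 \<le> a\<close> \<xi> order_refl, of m] unfolding D_def
      by (intro measurable_coarser_domain[OF _ sub]) auto
    have "S = (\<lambda>\<omega>. D \<omega> + Q \<omega>)" by (auto simp: D_eq)
    then have S[measurable]: "S \<in> borel_measurable M" by simp
    have "(\<integral>\<^sup>+\<omega>. ennreal ((I \<omega> - Q \<omega>)\<^sup>2) \<partial>M) \<le> (\<integral>\<^sup>+\<omega>. 2 * ennreal ((S \<omega> - I \<omega>)\<^sup>2) + 2 * ennreal ((D \<omega>)\<^sup>2) \<partial>M)"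
    proof (rule nn_integral_mono)
      fix \<omega>
      have "0 \<le> ((S \<omega> - I \<omega>) + (S \<omega> - Q \<omega>))\<^sup>2" by simp
      then have "(I \<omega> - Q \<omega>)\<^sup>2 \<le> 2 * (S \<omega> - I \<omega>)\<^sup>2 + 2 * (D \<omega>)\<^sup>2"
        unfolding D_eq by (simp add: power2_eq_square algebra_simps)
      then have "ennreal ((I \<omega> - Q \<omega>)\<^sup>2) \<le> ennreal (2 * (S \<omega> - I \<omega>)\<^sup>2 + 2 * (D \<omega>)\<^sup>2)" by (rule ennreal_leI)
      also have "\<dots> = 2 * ennreal ((S \<omega> - I \<omega>)\<^sup>2) + 2 * ennreal ((D \<omega>)\<^sup>2)"
        by (simp add: ennreal_plus ennreal_mult)
      finally show "ennreal ((I \<omega> - Q \<omega>)\<^sup>2) \<le> 2 * ennreal ((S \<omega> - I \<omega>)\<^sup>2) + 2 * ennreal ((D \<omega>)\<^sup>2)" .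
    qed
    also have "\<dots> = 2 * X m + 2 * (\<integral>\<^sup>+\<omega>. ennreal ((D \<omega>)\<^sup>2) \<partial>M)"
      by (simp add: nn_integral_add nn_integral_cmult X_def S_def[symmetric])
    also have "\<dots> \<le> 2 * X m + 2 * Y m"
      unfolding D_def Y_def by (intro add_left_mono mult_left_mono ito_defect_le_integrand_distance[OF B \<open>0 \<le> a\<close> \<xi>]) auto
    finally show ?thesis .
  qed
  have "(\<lambda>m. 2 * X m + 2 * Y m) \<longlonglongrightarrow> 2 * 0 + 2 * 0"
    using x y unfolding X_def[symmetric] Y_def[symmetric]
    by (intro tendsto_add ennreal_tendsto_cmult) auto
  then have "(\<integral>\<^sup>+\<omega>. ennreal ((I \<omega> - Q \<omega>)\<^sup>2) \<partial>M) \<le> 0"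
    using bound by (intro LIMSEQ_le_const[of "\<lambda>m. 2 * X m + 2 * Y m"]) auto
  then have "(\<integral>\<^sup>+\<omega>. ennreal ((I \<omega> - Q \<omega>)\<^sup>2) \<partial>M) = 0" by simp
  then have "AE \<omega> in M. ennreal ((I \<omega> - Q \<omega>)\<^sup>2) = 0" by (subst (asm) nn_integral_0_iff_AE) auto
  then show ?thesis by eventually_elim (simp add: Q_def)
qed

text \<open>The difference of the two sides is additive over adjacent intervals by Chen's relation and small on short
intervals, so, as seen from time \<open>0\<close>, it is a continuous function of \<open>t\<close> that vanishes at the rationals. It removes the dependence of the null set
on \<open>(s,t)\<close>.\<close>

lemma chen_identity_determined_on_rationals:
  assumes \<alpha>: "\<alpha> > 0" and rp: "rough_path \<alpha> T X XX"
    and rat: "\<And>q. q \<in> \<rat> \<Longrightarrow> 0 \<le> q \<Longrightarrow> q \<le> T \<Longrightarrow> XX 0 q = ((X q - X 0)\<^sup>2 - q) / 2"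
    and st: "0 \<le> s" "s \<le> t" "t \<le> T"
  shows "XX s t = ((X t - X s)\<^sup>2 - (t - s)) / 2"
proof -
  define E where "E s t = XX s t - ((X t - X s)\<^sup>2 - (t - s)) / 2" for s t
  have add: "E s t = E s u + E u t" if "0 \<le> s" "s \<le> u" "u \<le> t" "t \<le> T" for s u t
  proof -
    have "XX s t = XX s u + XX u t + (X u - X s) * (X t - X u)"
      using rp that unfolding rough_path_def by blast
    then show ?thesis by (simp add: E_def power2_eq_square field_simps)
  qed
  obtain C1 where C1: "C1 \<ge> 0" "\<And>s t. s \<in> {0..T} \<Longrightarrow> t \<in> {0..T} \<Longrightarrow> \<bar>X t - X s\<bar> \<le> C1 * \<bar>t - s\<bar> powr \<alpha>"
    using rp holder_onE[of \<alpha> "{0..T}" X] unfolding rough_path_def by metis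
  obtain C2 where C2: "\<forall>s t. 0 \<le> s \<and> s \<le> t \<and> t \<le> T \<longrightarrow> \<bar>XX s t\<bar> \<le> C2 * (t - s) powr (2 * \<alpha>)"
    using rp unfolding rough_path_def by (elim conjE exE)
  have bound: "\<bar>E s t\<bar> \<le> (C2 + C1\<^sup>2 / 2) * (t - s) powr (2 * \<alpha>) + (t - s) / 2"
    if "0 \<le> s" "s \<le> t" "t \<le> T" for s t
  proof -
    have "\<bar>X t - X s\<bar> \<le> C1 * (t - s) powr \<alpha>" using C1(2)[of s t] that by simp
    then have "(X t - X s)\<^sup>2 \<le> (C1 * (t - s) powr \<alpha>)\<^sup>2" by (metis abs_ge_zero power2_abs power_mono)
    also have "\<dots> = C1\<^sup>2 * (t - s) powr (2 * \<alpha>)"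
    proof -
      have "((t - s) powr \<alpha>)\<^sup>2 = (t - s) powr (2 * \<alpha>)"
        by (simp add: power2_eq_square powr_add[symmetric])
      then show ?thesis by (simp add: power_mult_distrib)
    qed
    finally have "\<bar>((X t - X s)\<^sup>2 - (t - s)) / 2\<bar> \<le> (C1\<^sup>2 * (t - s) powr (2 * \<alpha>)) / 2 + (t - s) / 2"
      using that(2) zero_le_power2[of "X t - X s"] by (intro abs_leI) argo+
    moreover have "\<bar>XX s t\<bar> \<le> C2 * (t - s) powr (2 * \<alpha>)" using C2 that by simp
    ultimately have "\<bar>E s t\<bar> \<le> C2 * (t - s) powr (2 * \<alpha>) + ((C1\<^sup>2 * (t - s) powr (2 * \<alpha>)) / 2 + (t - s) / 2)"
      unfolding E_def by (intro order_trans[OF abs_triangle_ineq4] add_mono)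
    then show ?thesis by (simp add: ring_distribs)
  qed
  have zero: "E 0 t = 0" if t: "0 \<le> t" "t \<le> T" for t
  proof (cases "t = 0")
    case True
    then show ?thesis using rat[of 0] t by (simp add: E_def)
  next
    case False
    \<comment> \<open>rational times approaching \<open>t\<close> from the left\<close>
    have "\<exists>q\<in>\<rat>. max 0 (t - 1 / real (Suc n)) < q \<and> q < t" for n
      using t False by (intro Rats_dense_in_real) (simp add: field_simps)
    then obtain q where q: "\<And>n. q n \<in> \<rat>" "\<And>n. max 0 (t - 1 / real (Suc n)) < q n" "\<And>n. q n < t"
      by metis
    have q_lim: "(\<lambda>n. t - q n) \<longlonglongrightarrow> 0"
    proof (rule tendsto_sandwich[OF _ _ tendsto_const LIMSEQ_inverse_real_of_nat])
      show "eventually (\<lambda>n. 0 \<le> t - q n) sequentially" using q(3) by (intro always_eventually) (simp add: less_imp_le)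
      show "eventually (\<lambda>n. t - q n \<le> inverse (real (Suc n))) sequentially"
        using q(2) by (intro always_eventually) (smt (verit) inverse_eq_divide max_less_iff_conj)
    qed
    have "\<bar>E 0 t\<bar> \<le> (C2 + C1\<^sup>2 / 2) * (t - q n) powr (2 * \<alpha>) + (t - q n) / 2" for n
    proof -
      have qn: "0 \<le> q n" "q n \<le> t" using q(2)[of n] q(3)[of n] by auto
      have "E 0 (q n) = 0" using rat[of "q n"] q(1)[of n] qn t by (simp add: E_def)
      then have "E 0 t = E (q n) t" using add[of 0 "q n" t] qn t by simp
      then show ?thesis using bound[of "q n" t] qn t by simp
    qed
    moreover have "(\<lambda>n. (C2 + C1\<^sup>2 / 2) * (t - q n) powr (2 * \<alpha>) + (t - q n) / 2)
        \<longlonglongrightarrow> (C2 + C1\<^sup>2 / 2) * 0 + 0 / 2"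
      using q_lim \<alpha> q(3) by (intro tendsto_intros tendsto_zero_powrI[where b = "2 * \<alpha>"])
        (auto intro!: always_eventually simp: less_imp_le)
    ultimately have "\<bar>E 0 t\<bar> \<le> (C2 + C1\<^sup>2 / 2) * 0 + 0 / 2"
      by (intro LIMSEQ_le_const) auto
    then show ?thesis by simp
  qed
  have "E s t = 0" using add[of 0 s t] zero[of s] zero[of t] st by simp
  then show ?thesis by (simp add: E_def)
qed

text \<open>For fixed times the four integrals are known: the Ito integral by \<open>ito_integral_brownian\<close>, the two mixed
Young integrals add up to the product of the increments, and the last one is half a square.\<close>

lemma (in prob_space) ito_rough_lift_formula:
  assumes B: "standard_brownian_motion M B" and lift: "ito_rough_lift M B BH MM"
    and T: "T > 0" and \<alpha>: "1/3 < \<alpha>" "\<alpha> < 1/2"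
  shows "AE \<omega> in M. holder_on \<alpha> {0..T} (\<lambda>t. B t \<omega> + BH t \<omega>) \<and>
    (\<forall>s t. 0 \<le> s \<and> s \<le> t \<and> t \<le> T \<longrightarrow>
      MM s t \<omega> = (((B t \<omega> + BH t \<omega>) - (B s \<omega> + BH s \<omega>))\<^sup>2 - (t - s)) / 2)"
proof -
  have at: "AE \<omega> in M. MM 0 t \<omega> = (((B t \<omega> + BH t \<omega>) - (B 0 \<omega> + BH 0 \<omega>))\<^sup>2 - t) / 2" if t: "0 \<le> t" for t
  proof -
    obtain I where I: "has_ito_integral M (natural_filtration M B) B (\<lambda>u \<omega>. B u \<omega> - B 0 \<omega>) 0 t I"
      and J: "AE \<omega> in M. \<exists>J1 J2 J3.
             has_young_integral (\<lambda>u. BH u \<omega> - BH 0 \<omega>) (\<lambda>u. B u \<omega>) 0 t J1 \<and>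
             has_young_integral (\<lambda>u. B u \<omega> - B 0 \<omega>) (\<lambda>u. BH u \<omega>) 0 t J2 \<and>
             has_young_integral (\<lambda>u. BH u \<omega> - BH 0 \<omega>) (\<lambda>u. BH u \<omega>) 0 t J3 \<and>
             MM 0 t \<omega> = I \<omega> + J1 + J2 + J3"
      using lift[unfolded ito_rough_lift_def, THEN conjunct1, THEN spec[where x = 0], THEN spec[where x = t],
          THEN mp, OF conjI, OF order_refl t]
      by (elim exE conjE) (rule that)
    from J ito_integral_brownian[OF B order_refl t I] show ?thesis
    proof eventually_elim
      case (elim \<omega>)
      then obtain J1 J2 J3 where
         J1: "has_young_integral (\<lambda>u. BH u \<omega> - BH 0 \<omega>) (\<lambda>u. B u \<omega>) 0 t J1" and
         J2: "has_young_integral (\<lambda>u. B u \<omega> - B 0 \<omega>) (\<lambda>u. BH u \<omega>) 0 t J2" and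
         J3: "has_young_integral (\<lambda>u. BH u \<omega> - BH 0 \<omega>) (\<lambda>u. BH u \<omega>) 0 t J3" and
         MM: "MM 0 t \<omega> = I \<omega> + J1 + J2 + J3" by (elim exE conjE)
      have "J1 + J2 = (BH t \<omega> - BH 0 \<omega>) * (B t \<omega> - B 0 \<omega>)"
        by (rule young_integral_by_parts[OF t, of "\<lambda>t. BH t \<omega>" "\<lambda>t. B t \<omega>", OF J1 J2])
      moreover have "J3 + J3 = (BH t \<omega> - BH 0 \<omega>) * (BH t \<omega> - BH 0 \<omega>)"
        by (rule young_integral_by_parts[OF t, of "\<lambda>t. BH t \<omega>" "\<lambda>t. BH t \<omega>", OF J3 J3])
      ultimately show ?case using elim(2) MM by (simp add: power2_eq_square field_simps)
    qed
  qed
  have "AE \<omega> in M. \<forall>q\<in>\<rat>. 0 \<le> q \<longrightarrow> MM 0 q \<omega> = (((B q \<omega> + BH q \<omega>) - (B 0 \<omega> + BH 0 \<omega>))\<^sup>2 - q) / 2"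
  proof (subst AE_ball_countable[OF countable_rat], intro ballI)
    fix q :: real
    show "AE \<omega> in M. 0 \<le> q \<longrightarrow> MM 0 q \<omega> = (((B q \<omega> + BH q \<omega>) - (B 0 \<omega> + BH 0 \<omega>))\<^sup>2 - q) / 2"
      using at[of q] by (cases "0 \<le> q") auto
  qed
  moreover have "AE \<omega> in M. rough_path \<alpha> T (\<lambda>t. B t \<omega> + BH t \<omega>) (\<lambda>s t. MM s t \<omega>)"
    using lift T \<alpha> by (simp add: ito_rough_lift_def)
  ultimately show ?thesis
  proof eventually_elim
    case (elim \<omega>)
    have "MM s t \<omega> = (((B t \<omega> + BH t \<omega>) - (B s \<omega> + BH s \<omega>))\<^sup>2 - (t - s)) / 2"
      if "0 \<le> s" "s \<le> t" "t \<le> T" for s t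
      by (rule chen_identity_determined_on_rationals[OF _ elim(2)]) (use elim(1) \<alpha> that in auto)
    moreover have "holder_on \<alpha> {0..T} (\<lambda>t. B t \<omega> + BH t \<omega>)" using elim(2) by (simp add: rough_path_def)
    ultimately show ?case by auto
  qed
qed

lemma ito_rough_lift_imp_holder:
  assumes lift: "ito_rough_lift P B BH MM" and T: "0 \<le> T"
  shows "AE \<omega> in P. \<exists>\<gamma>>1/2. holder_on \<gamma> {0..T} (\<lambda>t. BH t \<omega>)"
proof -
  obtain I where J: "AE \<omega> in P. \<exists>J1 J2 J3.
             has_young_integral (\<lambda>u. BH u \<omega> - BH 0 \<omega>) (\<lambda>u. B u \<omega>) 0 T J1 \<and>
             has_young_integral (\<lambda>u. B u \<omega> - B 0 \<omega>) (\<lambda>u. BH u \<omega>) 0 T J2 \<and>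
             has_young_integral (\<lambda>u. BH u \<omega> - BH 0 \<omega>) (\<lambda>u. BH u \<omega>) 0 T J3 \<and>
             MM 0 T \<omega> = I \<omega> + J1 + J2 + J3"
    using lift[unfolded ito_rough_lift_def, THEN conjunct1, THEN spec[where x = 0], THEN spec[where x = T],
        THEN mp, OF conjI, OF order_refl T]
    by (elim exE conjE) (rule that)
  then show ?thesis
  proof eventually_elim
    case (elim \<omega>)
    then obtain J3 where "has_young_integral (\<lambda>u. BH u \<omega> - BH 0 \<omega>) (\<lambda>u. BH u \<omega>) 0 T J3"
      by (elim exE conjE)
    from young_self_integral_imp_holder[OF this] show ?case by metis
  qed
qed

section \<open>A Gaussian potential for perturbed Bessel processes\<close>

text \<open>A convolution of two centred Gaussian densities.\<close>

lemma nn_integral_normal_gaussian_kernel: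
  fixes v \<delta> m :: real
  assumes "v > 0" "\<delta> > 0"
  shows "(\<integral>\<^sup>+y. ennreal (exp (- (m + y)\<^sup>2 / (2 * v))) \<partial>normal_law \<delta>)
    = ennreal (sqrt (v / (v + \<delta>)) * exp (- m\<^sup>2 / (2 * (v + \<delta>))))"
proof -
  have kernel: "exp (- (m + y)\<^sup>2 / (2 * v)) = sqrt (2 * pi * v) * normal_density 0 (sqrt v) (- m - y)" for y
  proof -
    have "(- m - y)\<^sup>2 = (m + y)\<^sup>2" by (simp add: power2_eq_square algebra_simps)
    then show ?thesis using assms by (simp add: normal_density_def)
  qed
  have conv: "(\<integral>\<^sup>+y. ennreal (normal_density 0 (sqrt v) (- m - y) * normal_density 0 (sqrt \<delta>) y) \<partial>lborel)
      = ennreal (normal_density 0 (sqrt (v + \<delta>)) (- m))"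
    using fun_cong[OF conv_normal_density_zero_mean[of "sqrt v" "sqrt \<delta>"], of "- m"] assms by simp
  have "(\<integral>\<^sup>+y. ennreal (exp (- (m + y)\<^sup>2 / (2 * v))) \<partial>normal_law \<delta>)
      = (\<integral>\<^sup>+y. ennreal (normal_density 0 (sqrt \<delta>) y) * ennreal (exp (- (m + y)\<^sup>2 / (2 * v))) \<partial>lborel)"
    by (subst nn_integral_density) auto
  also have "\<dots> = (\<integral>\<^sup>+y. ennreal (sqrt (2 * pi * v)) *
      ennreal (normal_density 0 (sqrt v) (- m - y) * normal_density 0 (sqrt \<delta>) y) \<partial>lborel)"
    unfolding kernel using assms
    by (intro nn_integral_cong) (simp add: ennreal_mult[symmetric] mult_ac)
  also have "\<dots> = ennreal (sqrt (2 * pi * v)) * ennreal (normal_density 0 (sqrt (v + \<delta>)) (- m))"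
    by (subst nn_integral_cmult) (auto simp: conv)
  also have "\<dots> = ennreal (sqrt (2 * pi * v) * normal_density 0 (sqrt (v + \<delta>)) (- m))"
    using assms by (simp add: ennreal_mult)
  also have "sqrt (2 * pi * v) * normal_density 0 (sqrt (v + \<delta>)) (- m) = sqrt (v / (v + \<delta>)) * exp (- m\<^sup>2 / (2 * (v + \<delta>)))"
    using assms by (simp add: normal_density_def real_sqrt_mult real_sqrt_divide)
  finally show ?thesis .
qed

lemma powr_increment_le:
  fixes \<gamma> S \<delta> :: real
  assumes "0 < \<gamma>" "\<gamma> \<le> 1" "S > 0" "\<delta> > 0"
  shows "(S + \<delta>) powr \<gamma> - S powr \<gamma> \<le> \<gamma> * S powr (\<gamma> - 1) * \<delta>"
proof -
  have "\<exists>z>S. z < S + \<delta> \<and> (S + \<delta>) powr \<gamma> - S powr \<gamma> = (S + \<delta> - S) * (\<gamma> * z powr (\<gamma> - 1))"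
    using assms by (intro MVT2) (auto intro!: derivative_eq_intros)
  then obtain z where z: "z > S" "(S + \<delta>) powr \<gamma> - S powr \<gamma> = \<delta> * (\<gamma> * z powr (\<gamma> - 1))" by auto
  have "z powr (\<gamma> - 1) \<le> S powr (\<gamma> - 1)" using assms z by (intro powr_mono2') auto
  then have "\<delta> * (\<gamma> * z powr (\<gamma> - 1)) \<le> \<delta> * (\<gamma> * S powr (\<gamma> - 1))" using assms by (intro mult_left_mono) auto
  then show ?thesis using z by (simp add: mult_ac)
qed

text \<open>For \<open>\<rho> = 1\<close> this is, up to a constant, the density at the origin of a Bessel process of dimension \<open>D\<close> started
at \<open>w\<close>, taken after time \<open>s\<close> and relative to its speed measure.\<close>

definition gauss_potential :: "real \<Rightarrow> real \<Rightarrow> real \<Rightarrow> real \<Rightarrow> real" where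
  "gauss_potential D \<rho> s w = s powr (- D / 2) * exp (- w\<^sup>2 / (2 * \<rho> * s))"

text \<open>The explicit scheme for \<open>dX = (A / X - k X) dt + dB + dh\<close> with step \<open>\<delta>\<close>, frozen at level \<open>m\<close>. The drift is evaluated at \<open>x + m\<close>:
by monotonicity it is then a lower bound for the drift of a path that stays below \<open>x + m\<close> during the step. The increments of \<open>B\<close>
are the numbers \<open>y i\<close>, whereas \<open>h\<close> is given by its values on the grid.\<close>

primrec euler :: "real \<Rightarrow> real \<Rightarrow> real \<Rightarrow> real \<Rightarrow> real \<Rightarrow> (nat \<Rightarrow> real) \<Rightarrow> (nat \<Rightarrow> real) \<Rightarrow> nat \<Rightarrow> real" where
  "euler A k m \<delta> x0 h y 0 = x0"
| "euler A k m \<delta> x0 h y (Suc j) = (let x = euler A k m \<delta> x0 h y j in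
     if x \<le> m then x else x + \<delta> * (A / (x + m) - k * (x + m)) + y j + (h (Suc j) - h j))"

lemma euler_cong:
  "(\<And>i. i \<le> j \<Longrightarrow> h i = h' i) \<Longrightarrow> (\<And>i. i < j \<Longrightarrow> y i = y' i) \<Longrightarrow>
   euler A k m \<delta> x0 h y j = euler A k m \<delta> x0 h' y' j"
  by (induction j) (auto simp: Let_def)

lemma euler_measurable:
  assumes "\<And>i. i \<le> j \<Longrightarrow> H i \<in> borel_measurable N" "\<And>i. i < j \<Longrightarrow> Y i \<in> borel_measurable N"
  shows "(\<lambda>\<omega>. euler A k m \<delta> x0 (\<lambda>i. H i \<omega>) (\<lambda>i. Y i \<omega>) j) \<in> borel_measurable N"
  using assms
proof (induction j)
  case (Suc j)
  have [measurable]: "(\<lambda>\<omega>. euler A k m \<delta> x0 (\<lambda>i. H i \<omega>) (\<lambda>i. Y i \<omega>) j) \<in> borel_measurable N"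
    using Suc by auto
  have [measurable]: "H j \<in> borel_measurable N" "H (Suc j) \<in> borel_measurable N" "Y j \<in> borel_measurable N"
    using Suc.prems by auto
  show ?case unfolding euler.simps Let_def by measurable
qed simp

text \<open>\<open>\<rho> D / 2 + 2 \<kappa> \<le> 1/2 + A\<close> is the room between \<open>D\<close> and the Bessel dimension \<open>2 A + 1\<close>; \<open>s0\<close> is the length of the
stretch before the target time on which this room, together with the gain from \<open>\<rho> > 1\<close>, outweighs the linear drift \<open>k\<close> and
the shift \<open>K s\<^sup>\<gamma>\<close>.\<close>

locale bessel_potential =
  fixes A k K \<gamma> D \<rho> \<kappa> s0 :: real
  assumes A: "A > 0" and k: "k \<ge> 0" and K: "K \<ge> 0" and \<gamma>: "1/2 < \<gamma>" "\<gamma> \<le> 1"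
    and D: "D > 2" and \<rho>: "\<rho> > 1" and \<kappa>: "\<kappa> > 0" and s0: "s0 > 0"
    and dimension: "\<rho> * D / 2 + 2 * \<kappa> \<le> 1 / 2 + A"
    and short_time: "k \<le> (\<rho> - 1) / (4 * \<rho> * s0)"
      "2 * (K * \<gamma>)\<^sup>2 * s0 powr (2 * \<gamma> - 1) \<le> \<kappa> * (\<rho> - 1) / \<rho>"

text \<open>All constants are taken half way: \<open>D\<close> between \<open>2\<close> and \<open>1 + 2 A\<close>, then \<open>\<rho>\<close> between \<open>1\<close> and \<open>(1 + 2 A) / D\<close>.\<close>

lemma bessel_potential_exists:
  assumes "A > 1/2" "k \<ge> 0" "K \<ge> 0" "1/2 < \<gamma>" "\<gamma> \<le> 1"
  obtains D \<rho> \<kappa> s0 where "bessel_potential A k K \<gamma> D \<rho> \<kappa> s0"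
proof -
  define D where "D = (3 + 2 * A) / 2"
  have D: "2 < D" "D < 1 + 2 * A" using assms(1) by (auto simp: D_def)
  define \<rho> where "\<rho> = (1 + (1 + 2 * A) / D) / 2"
  have r1: "(1 + 2 * A) / D > 1" using D by simp
  have \<rho>: "\<rho> > 1" using r1 by (simp add: \<rho>_def)
  have "\<rho> * D = (D + (1 + 2 * A)) / 2" using D by (simp add: \<rho>_def field_simps)
  then have \<rho>D: "\<rho> * D < 1 + 2 * A" using D by simp
  define \<kappa> where "\<kappa> = (1 + 2 * A - \<rho> * D) / 4"
  have \<kappa>: "\<kappa> > 0" using \<rho>D by (simp add: \<kappa>_def)
  define a b where "a = (\<rho> - 1) / (4 * \<rho> * (k + 1))" and "b = \<kappa> * (\<rho> - 1) / (\<rho> * (2 * (K * \<gamma>)\<^sup>2 + 1))"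
  have ab: "a > 0" "b > 0" using \<rho> \<kappa> assms(2) by (auto simp: a_def b_def intro!: divide_pos_pos mult_pos_pos add_nonneg_pos)
  have cancel: "x * (y / (z * x)) = y / z" if "x \<noteq> 0" for x y z :: real using that by simp
  define s0 where "s0 = min a (b powr (1 / (2 * \<gamma> - 1)))"
  have s0: "s0 > 0" using ab by (simp add: s0_def)
  show ?thesis
  proof (rule that, unfold_locales)
    show "\<rho> * D / 2 + 2 * \<kappa> \<le> 1 / 2 + A" by (simp add: \<kappa>_def field_simps)
    have "k * s0 \<le> (k + 1) * a" using assms(2) s0 by (intro mult_mono) (auto simp: s0_def)
    also have "\<dots> = (\<rho> - 1) / (4 * \<rho>)" using assms(2) unfolding a_def by (intro cancel) simp
    finally show "k \<le> (\<rho> - 1) / (4 * \<rho> * s0)" using s0 \<rho> by (simp add: field_simps)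
    have "s0 powr (2 * \<gamma> - 1) \<le> (b powr (1 / (2 * \<gamma> - 1))) powr (2 * \<gamma> - 1)"
      using s0 assms(4) by (intro powr_mono2) (auto simp: s0_def)
    also have "\<dots> = b" using assms(4) ab by (simp add: powr_powr)
    finally have "2 * (K * \<gamma>)\<^sup>2 * s0 powr (2 * \<gamma> - 1) \<le> (2 * (K * \<gamma>)\<^sup>2 + 1) * b"
      using ab by (intro mult_mono) auto
    also have "\<dots> = \<kappa> * (\<rho> - 1) / \<rho>"
      unfolding b_def by (intro cancel) (smt (verit) zero_le_power2)
    finally show "2 * (K * \<gamma>)\<^sup>2 * s0 powr (2 * \<gamma> - 1) \<le> \<kappa> * (\<rho> - 1) / \<rho>" .
  qed (use assms D \<rho> \<kappa> s0 in auto)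
qed

context bessel_potential
begin

abbreviation "U \<equiv> gauss_potential D \<rho>"

text \<open>One step of the supermartingale property. The Gaussian integral replaces \<open>\<rho> S\<close> by \<open>v = \<rho> S + \<delta>\<close>, whereas the potential at
time \<open>S + \<delta>\<close> has \<open>\<rho> (S + \<delta>)\<close>, which is larger by \<open>(\<rho> - 1) \<delta>\<close>; this gains a negative multiple of \<open>w\<^sup>2\<close>. After
taking logarithms and multiplying by \<open>v / \<delta>\<close> the claim is the inequality \<open>final\<close>: the constant terms are
negative because \<open>\<rho> D < 1 + 2 A\<close>, and the linear term \<open>L w\<close> is dominated by the constant and quadratic ones.\<close>

lemma potential_step:
  assumes \<delta>: "\<delta> > 0" "D * \<delta> \<le> 2 * \<kappa> * S" "\<delta> \<le> S" and S: "S > 0" "S + \<delta> \<le> s0"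
    and w: "w > 0" and drift: "w * d \<ge> A - k * w\<^sup>2 - K * \<gamma> * S powr (\<gamma> - 1) * w"
  shows "(\<integral>\<^sup>+y. ennreal (U S (w + \<delta> * d + y)) \<partial>normal_law \<delta>)
    \<le> ennreal (U (S + \<delta>) w)"
proof -
  define s v m L where "s = S + \<delta>" and "v = \<rho> * S + \<delta>" and "m = w + \<delta> * d" and "L = K * \<gamma> * S powr (\<gamma> - 1)"
  have pos: "s > 0" "v > 0" "\<rho> * S > 0" "\<rho> > 0" using \<delta> S \<rho> by (auto simp: s_def v_def intro!: add_pos_pos mult_pos_pos)
  have "(\<integral>\<^sup>+y. ennreal (U S (m + y)) \<partial>normal_law \<delta>)
      = (\<integral>\<^sup>+y. ennreal (S powr (- D / 2)) * ennreal (exp (- (m + y)\<^sup>2 / (2 * (\<rho> * S)))) \<partial>normal_law \<delta>)"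
    by (intro nn_integral_cong) (simp add: gauss_potential_def ennreal_mult mult.assoc)
  also have "\<dots> = ennreal (S powr (- D / 2)) * ennreal (sqrt (\<rho> * S / v) * exp (- m\<^sup>2 / (2 * v)))"
    using nn_integral_normal_gaussian_kernel[OF pos(3) \<delta>(1), of m] by (subst nn_integral_cmult) (auto simp: v_def)
  also have "\<dots> = ennreal (S powr (- D / 2) * (sqrt (\<rho> * S / v) * exp (- m\<^sup>2 / (2 * v))))"
    using pos by (intro ennreal_mult[symmetric]) auto
  also have "\<dots> \<le> ennreal (U s w)"
  proof (rule ennreal_leI)
    have log_lhs: "S powr (- D / 2) * (sqrt (\<rho> * S / v) * exp (- m\<^sup>2 / (2 * v)))
        = exp (- D / 2 * ln S + ln (\<rho> * S / v) / 2 - m\<^sup>2 / (2 * v))"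
    proof -
      have "sqrt (\<rho> * S / v) = exp (ln (\<rho> * S / v) / 2)"
      proof -
        have "\<rho> * S / v > 0" using pos by simp
        then show ?thesis by (simp add: ln_sqrt[symmetric] del: ln_div times_divide_eq_right)
      qed
      moreover have "S powr (- D / 2) = exp (- D / 2 * ln S)" using S by (simp add: powr_def)
      ultimately show ?thesis by (simp add: exp_add[symmetric] exp_diff[symmetric])
    qed
    have log_rhs: "U s w = exp (- D / 2 * ln s - w\<^sup>2 / (2 * \<rho> * s))"
      using pos by (simp add: gauss_potential_def powr_def exp_add[symmetric])
    have l1: "ln s - ln S \<le> \<delta> / S"
    proof -
      have "ln s - ln S = ln (1 + \<delta> / S)"
      proof -
        have "1 + \<delta> / S = s / S" using S by (simp add: s_def add_divide_distrib)
        then show ?thesis using S pos by (simp add: ln_div)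
      qed
      also have "\<dots> \<le> \<delta> / S" using S \<delta> by (intro ln_add_one_self_le_self) auto
      finally show ?thesis .
    qed
    have l2: "ln (\<rho> * S / v) \<le> - \<delta> / v"
    proof -
      have "ln (\<rho> * S / v) \<le> \<rho> * S / v - 1" using pos by (intro ln_le_minus_one) auto
      also have "\<dots> = - \<delta> / v" using pos by (simp add: v_def field_simps)
      finally show ?thesis .
    qed
    \<comment> \<open>the nonnegative term \<open>(\<delta> d)\<^sup>2\<close> is dropped\<close>
    have m_sq: "m\<^sup>2 \<ge> w\<^sup>2 + 2 * \<delta> * (A - k * w\<^sup>2 - L * w)"
    proof -
      have "m\<^sup>2 = w\<^sup>2 + 2 * \<delta> * (w * d) + (\<delta> * d)\<^sup>2" by (simp add: m_def power2_eq_square algebra_simps)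
      moreover have "2 * \<delta> * (w * d) \<ge> 2 * \<delta> * (A - k * w\<^sup>2 - L * w)"
        using drift \<delta> by (intro mult_left_mono) (auto simp: L_def)
      ultimately show ?thesis using zero_le_power2[of "\<delta> * d"] by linarith
    qed
    define c where "c = (\<rho> - 1) / (4 * \<rho> * s)"
    have c_pos: "c > 0" using \<rho> pos by (simp add: c_def)
    have k_le: "k \<le> c"
    proof -
      have "(\<rho> - 1) / (4 * \<rho> * s0) \<le> c"
        unfolding c_def using \<rho> pos S by (intro divide_left_mono mult_left_mono mult_pos_pos) (auto simp: s_def)
      then show ?thesis using short_time(1) by linarith
    qed
    have L_sq: "L\<^sup>2 \<le> 4 * \<kappa> * c"
    proof -
      have "L\<^sup>2 * s = (K * \<gamma>)\<^sup>2 * (S powr (2 * \<gamma> - 2) * s)"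
      proof -
        have "(S powr (\<gamma> - 1))\<^sup>2 = S powr (2 * \<gamma> - 2)"
          by (simp add: power2_eq_square powr_add[symmetric])
        then show ?thesis by (simp add: L_def power_mult_distrib)
      qed
      also have "S powr (2 * \<gamma> - 2) * s \<le> S powr (2 * \<gamma> - 2) * (2 * S)"
        using \<delta> by (intro mult_left_mono) (auto simp: s_def)
      also have "\<dots> = 2 * S powr (2 * \<gamma> - 1)"
      proof -
        have "S powr (2 * \<gamma> - 2) * S = S powr (2 * \<gamma> - 2 + 1)" using S unfolding powr_add by simp
        then show ?thesis by simp
      qed
      also have "\<dots> \<le> 2 * s0 powr (2 * \<gamma> - 1)"
        using S \<delta> \<gamma> by (intro mult_left_mono powr_mono2) auto
      finally have "L\<^sup>2 * s \<le> (K * \<gamma>)\<^sup>2 * (2 * s0 powr (2 * \<gamma> - 1))" by (simp add: mult_left_mono)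
      also have "\<dots> \<le> \<kappa> * (\<rho> - 1) / \<rho>" using short_time(2) by (simp add: mult_ac)
      finally show ?thesis using pos by (simp add: c_def field_simps)
    qed
    have quad: "L * w \<le> \<kappa> + c * w\<^sup>2"
    proof -
      have "0 \<le> (2 * c * w - L)\<^sup>2" by simp
      then have "4 * c * (L * w) \<le> 4 * c * (c * w\<^sup>2) + L\<^sup>2" by (simp add: power2_eq_square algebra_simps)
      also have "\<dots> \<le> 4 * c * (\<kappa> + c * w\<^sup>2)" using L_sq by (simp add: algebra_simps)
      finally show ?thesis using c_pos by simp
    qed
    have dim: "D * v / (2 * S) \<le> 1 / 2 + A - \<kappa>"
    proof -
      have "D * v / (2 * S) = \<rho> * D / 2 + D * \<delta> / (2 * S)" using S by (simp add: v_def field_simps)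
      also have "D * \<delta> / (2 * S) \<le> \<kappa>" using \<delta> S by (simp add: divide_le_eq mult_ac)
      finally show ?thesis using dimension by linarith
    qed
    have gain: "w\<^sup>2 / (2 * \<rho> * s) - w\<^sup>2 / (2 * v) = - (\<delta> / v) * (2 * c * w\<^sup>2)"
    proof -
      have "w\<^sup>2 / (2 * \<rho> * s) - w\<^sup>2 / (2 * v) = w\<^sup>2 * (v - \<rho> * s) / (2 * \<rho> * s * v)"
        using pos by (simp add: field_simps)
      also have "v - \<rho> * s = - ((\<rho> - 1) * \<delta>)" by (simp add: v_def s_def algebra_simps)
      also have "w\<^sup>2 * - ((\<rho> - 1) * \<delta>) / (2 * \<rho> * s * v) = - (\<delta> / v) * (2 * c * w\<^sup>2)"
        using pos by (simp add: c_def field_simps)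
      finally show ?thesis .
    qed
    have final: "D * v / (2 * S) - 1 / 2 - A + k * w\<^sup>2 + L * w - 2 * c * w\<^sup>2 \<le> 0"
    proof -
      have "k * w\<^sup>2 \<le> c * w\<^sup>2" using k_le by (intro mult_right_mono) auto
      then show ?thesis using dim quad by linarith
    qed
    have "(- D / 2 * ln S + ln (\<rho> * S / v) / 2 - m\<^sup>2 / (2 * v)) - (- D / 2 * ln s - w\<^sup>2 / (2 * \<rho> * s))
        = D / 2 * (ln s - ln S) + ln (\<rho> * S / v) / 2 - m\<^sup>2 / (2 * v) + w\<^sup>2 / (2 * \<rho> * s)"
      by argo
    also have "\<dots> \<le> D / 2 * (\<delta> / S) + (- \<delta> / v) / 2
        - (w\<^sup>2 + 2 * \<delta> * (A - k * w\<^sup>2 - L * w)) / (2 * v) + w\<^sup>2 / (2 * \<rho> * s)"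
      using l1 l2 m_sq D pos by (intro add_mono diff_mono mult_left_mono divide_right_mono) auto
    also have "\<dots> = (D / 2 * (\<delta> / S) + (- \<delta> / v) / 2 - \<delta> * (A - k * w\<^sup>2 - L * w) / v)
        + (w\<^sup>2 / (2 * \<rho> * s) - w\<^sup>2 / (2 * v))"
      by (simp add: add_divide_distrib)
    also have "\<dots> = (\<delta> / v) * (D * v / (2 * S) - 1 / 2 - A + k * w\<^sup>2 + L * w - 2 * c * w\<^sup>2)"
    proof -
      have "D / 2 * (\<delta> / S) = (\<delta> / v) * (D * v / (2 * S))" using pos S by (simp add: field_simps)
      moreover have "(- \<delta> / v) / 2 = (\<delta> / v) * (- 1 / 2)" by simp
      moreover have "\<delta> * (A - k * w\<^sup>2 - L * w) / v = (\<delta> / v) * (A - k * w\<^sup>2 - L * w)" by simp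
      ultimately show ?thesis unfolding gain by (simp only: ) (simp add: algebra_simps)
    qed
    also have "\<dots> \<le> 0" using final \<delta> pos by (intro mult_nonneg_nonpos) auto
    finally show "S powr (- D / 2) * (sqrt (\<rho> * S / v) * exp (- m\<^sup>2 / (2 * v))) \<le> U s w"
      unfolding log_lhs log_rhs by simp
  qed
  finally show ?thesis by (simp add: m_def s_def)
qed

end

section \<open>The stopped potential along a time block\<close>

text \<open>The largest value of \<open>s\<^sup>-\<^sup>p exp (- a / s)\<close> is \<open>(p / a)\<^sup>p exp (- p)\<close>; the bound follows from \<open>u / p \<le> exp (u / p)\<close>.\<close>

lemma powr_exp_inverse_bounded:
  fixes a p s :: real
  assumes "a > 0" "p > 0" "s > 0"
  shows "s powr (- p) * exp (- a / s) \<le> (p / a) powr p"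
proof -
  define u where "u = a / s"
  have u: "u > 0" using assms by (simp add: u_def)
  have "u / p \<le> exp (u / p)" using exp_ge_add_one_self[of "u / p"] by linarith
  then have "(u / p) powr p \<le> exp (u / p) powr p" using u assms by (intro powr_mono2) auto
  also have "\<dots> = exp u" using assms by (simp add: exp_powr_real)
  finally have le: "(u / p) powr p \<le> exp u" .
  have "s powr (- p) = (u / p) powr p * (p / a) powr p"
  proof -
    have "(u / p) powr p * (p / a) powr p = ((u / p) * (p / a)) powr p"
      using assms u by (intro powr_mult[symmetric])
    also have "(u / p) * (p / a) = 1 / s" using assms by (simp add: u_def)
    finally show ?thesis using assms by (simp add: powr_minus_divide powr_divide)
  qed
  then have "s powr (- p) * exp (- a / s) = ((u / p) powr p * exp (- u)) * (p / a) powr p"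
    by (simp add: u_def)
  also have "\<dots> \<le> (exp u * exp (- u)) * (p / a) powr p"
    using le by (intro mult_right_mono) auto
  finally show ?thesis by (simp add: exp_minus)
qed

text \<open>The scheme first comes down to \<open>\<surd>\<epsilon>\<close> within the last \<open>\<epsilon>\<close> of time before grid point \<open>q\<close>. The lower bound \<open>- \<surd>\<epsilon>\<close> excludes
a large undershoot, for which the Gaussian potential would be small.\<close>

definition stops_in_block ::
  "real \<Rightarrow> real \<Rightarrow> real \<Rightarrow> real \<Rightarrow> real \<Rightarrow> nat \<Rightarrow> (nat \<Rightarrow> real) \<Rightarrow> (nat \<Rightarrow> real) \<Rightarrow> bool" where
  "stops_in_block A k x0 \<delta> \<epsilon> q h y \<longleftrightarrow> (\<exists>i\<in>{..q}. (real q - real i) * \<delta> \<le> \<epsilon> \<and>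
     - sqrt \<epsilon> \<le> euler A k (sqrt \<epsilon>) \<delta> x0 h y i \<and> euler A k (sqrt \<epsilon>) \<delta> x0 h y i \<le> sqrt \<epsilon> \<and>
     (\<forall>j\<in>{..<i}. sqrt \<epsilon> < euler A k (sqrt \<epsilon>) \<delta> x0 h y j))"

lemma stops_in_block_sets:
  assumes "\<And>i. i \<le> q \<Longrightarrow> H i \<in> borel_measurable N" "\<And>i. i < q \<Longrightarrow> Y i \<in> borel_measurable N"
  shows "{\<omega> \<in> space N. stops_in_block A k x0 \<delta> \<epsilon> q (\<lambda>i. H i \<omega>) (\<lambda>i. Y i \<omega>)} \<in> sets N"
proof -
  let ?xh = "\<lambda>\<omega>. euler A k (sqrt \<epsilon>) \<delta> x0 (\<lambda>i. H i \<omega>) (\<lambda>i. Y i \<omega>)"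
  have xh: "(\<lambda>\<omega>. ?xh \<omega> i) \<in> borel_measurable N" if "i \<le> q" for i
    using assms that by (intro euler_measurable) auto
  have "{\<omega> \<in> space N. \<exists>i\<in>{..q}. (real q - real i) * \<delta> \<le> \<epsilon> \<and> - sqrt \<epsilon> \<le> ?xh \<omega> i \<and> ?xh \<omega> i \<le> sqrt \<epsilon>
     \<and> (\<forall>j\<in>{..<i}. sqrt \<epsilon> < ?xh \<omega> j)} \<in> sets N"
  proof (intro sets.sets_Collect_finite_Ex sets.sets_Collect_conj sets.sets_Collect_finite_All sets.sets_Collect_const)
    fix i assume i: "i \<in> {..q}"
    have m[measurable]: "(\<lambda>\<omega>. ?xh \<omega> i) \<in> borel_measurable N" using i xh by simp
    show "{\<omega> \<in> space N. - sqrt \<epsilon> \<le> ?xh \<omega> i} \<in> sets N" by measurable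
    show "{\<omega> \<in> space N. ?xh \<omega> i \<le> sqrt \<epsilon>} \<in> sets N" by measurable
    fix j assume "j \<in> {..<i}"
    then have [measurable]: "(\<lambda>\<omega>. ?xh \<omega> j) \<in> borel_measurable N" using i xh by simp
    show "{\<omega> \<in> space N. sqrt \<epsilon> < ?xh \<omega> j} \<in> sets N" by measurable
  qed auto
  then show ?thesis unfolding stops_in_block_def .
qed

text \<open>The block ends at grid point \<open>q\<close>, and the potential is followed from grid point \<open>l\<close> on, where the time left is at most
\<open>s0\<close>. The Hoelder bound on \<open>h\<close> refers to the end of the block because the potential is centred at \<open>h q\<close>.\<close>

locale bessel_grid = bessel_potential +
  fixes x0 \<delta> \<epsilon> :: real and h :: "nat \<Rightarrow> real" and q l :: nat
  assumes \<delta>: "\<delta> > 0" "\<delta> \<le> \<epsilon>" "D * \<delta> \<le> 2 * \<kappa> * \<epsilon>" and \<epsilon>: "2 * \<epsilon> \<le> 1"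
    and l: "l \<le> q" "(real q - real l) * \<delta> + \<epsilon> \<le> s0"
    and l_block: "\<And>i. i \<le> q \<Longrightarrow> (real q - real i) * \<delta> \<le> \<epsilon> \<Longrightarrow> l \<le> i"
    and h: "\<And>j. j \<le> q \<Longrightarrow> \<bar>h q - h j\<bar> \<le> K * ((real q - real j) * \<delta>) powr \<gamma>"
begin

definition time_left :: "nat \<Rightarrow> real" where "time_left j = (real q - real j) * \<delta> + \<epsilon>"

abbreviation "xh \<equiv> euler A k (sqrt \<epsilon>) \<delta> x0 h"

definition shifted :: "(nat \<Rightarrow> real) \<Rightarrow> nat \<Rightarrow> real" where
  "shifted y j = xh y j + sqrt \<epsilon> + (h q - h j) + K * time_left j powr \<gamma>"

primrec stopped :: "(nat \<Rightarrow> real) \<Rightarrow> nat \<Rightarrow> real" where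
  "stopped y 0 = U (time_left 0) (shifted y 0)"
| "stopped y (Suc j) = (if l \<le> j \<and> xh y j \<le> sqrt \<epsilon> then stopped y j else U (time_left (Suc j)) (shifted y (Suc j)))"

abbreviation "noise n \<equiv> PiM {..<n} (\<lambda>_. normal_law \<delta>)"

abbreviation "block_stop \<equiv> stops_in_block A k x0 \<delta> \<epsilon> q h"

lemma \<epsilon>_pos: "\<epsilon> > 0" using \<delta> by linarith

lemma time_left_ge: "j \<le> q \<Longrightarrow> time_left j \<ge> \<epsilon>"
  using \<delta> by (simp add: time_left_def)

lemma time_left_Suc: "time_left j = time_left (Suc j) + \<delta>"
  by (simp add: time_left_def algebra_simps)

lemma shift_bounds:
  assumes "j \<le> q"
  shows "0 \<le> (h q - h j) + K * time_left j powr \<gamma>" "(h q - h j) + K * time_left j powr \<gamma> \<le> 2 * K * time_left j powr \<gamma>"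
proof -
  have "K * ((real q - real j) * \<delta>) powr \<gamma> \<le> K * time_left j powr \<gamma>"
    using assms \<delta> \<epsilon>_pos K \<gamma> unfolding time_left_def by (intro mult_left_mono powr_mono2) auto
  then have "\<bar>h q - h j\<bar> \<le> K * time_left j powr \<gamma>" using h[OF assms] by linarith
  then show "0 \<le> (h q - h j) + K * time_left j powr \<gamma>" "(h q - h j) + K * time_left j powr \<gamma> \<le> 2 * K * time_left j powr \<gamma>"
    by linarith+
qed

text \<open>The shift of the scheme by \<open>\<surd>\<epsilon> + (h q - h j) + K s\<^sup>\<gamma>\<close> eliminates the increments of \<open>h\<close> and makes \<open>w \<ge> x + \<surd>\<epsilon>\<close>,
so that \<open>w\<close> times the drift \<open>A / (x + \<surd>\<epsilon>)\<close> is at least \<open>A\<close>.\<close>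

lemma potential_step_euler:
  assumes j: "l \<le> j" "j < q" and alive: "xh y j > sqrt \<epsilon>"
  shows "(\<integral>\<^sup>+z. ennreal (U (time_left (Suc j)) (shifted (y(j := z)) (Suc j))) \<partial>normal_law \<delta>)
    \<le> ennreal (U (time_left j) (shifted y j))"
proof -
  define x S w where "x = xh y j" and "S = time_left (Suc j)" and "w = shifted y j"
  define d where "d = A / (x + sqrt \<epsilon>) - k * (x + sqrt \<epsilon>) - K * (time_left j powr \<gamma> - S powr \<gamma>) / \<delta>"
  have S: "S \<ge> \<epsilon>" "S > 0" "time_left j = S + \<delta>"
    using time_left_ge[of "Suc j"] j \<epsilon>_pos time_left_Suc[of j] by (auto simp: S_def)
  have m: "sqrt \<epsilon> > 0" using \<epsilon>_pos by simp
  have x: "x + sqrt \<epsilon> > 0" using alive m unfolding x_def by linarith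
  have w: "x + sqrt \<epsilon> \<le> w" using shift_bounds(1)[of j] j by (simp add: w_def shifted_def x_def)
  have next_eq: "shifted (y(j := z)) (Suc j) = w + \<delta> * d + z" for z
  proof -
    have "xh (y(j := z)) j = x" unfolding x_def by (rule euler_cong) auto
    then show ?thesis
      using alive \<delta>(1) unfolding shifted_def w_def d_def S_def[symmetric]
      by (simp add: Let_def x_def[symmetric] field_simps)
  qed
  have "(\<integral>\<^sup>+z. ennreal (U S (w + \<delta> * d + z)) \<partial>normal_law \<delta>) \<le> ennreal (U (S + \<delta>) w)"
  proof (rule potential_step)
    show "\<delta> > 0" "\<delta> \<le> S" "S > 0" using \<delta> S by auto
    have "2 * \<kappa> * \<epsilon> \<le> 2 * \<kappa> * S" using \<kappa> S by simp
    then show "D * \<delta> \<le> 2 * \<kappa> * S" using \<delta>(3) by linarith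
    have "real j \<ge> real l" using j by simp
    then have "time_left j \<le> (real q - real l) * \<delta> + \<epsilon>"
      unfolding time_left_def using \<delta>(1) by (intro add_right_mono mult_right_mono) auto
    then show "S + \<delta> \<le> s0" using l(2) S by linarith
    show w0: "w > 0" using w x by linarith
    have "w * (A / (x + sqrt \<epsilon>)) \<ge> (x + sqrt \<epsilon>) * (A / (x + sqrt \<epsilon>))"
      using w A x by (intro mult_right_mono) auto
    then have 1: "w * (A / (x + sqrt \<epsilon>)) \<ge> A" using x by simp
    have "w * (x + sqrt \<epsilon>) \<le> w * w" using w w0 by (intro mult_left_mono) auto
    then have 2: "k * (w * (x + sqrt \<epsilon>)) \<le> k * w\<^sup>2" using k by (simp add: power2_eq_square mult_left_mono)
    have "(time_left j powr \<gamma> - S powr \<gamma>) / \<delta> \<le> \<gamma> * S powr (\<gamma> - 1)"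
      using powr_increment_le[of \<gamma> S \<delta>] \<gamma> S \<delta>(1) by (simp add: divide_le_eq)
    then have 3: "w * (K * ((time_left j powr \<gamma> - S powr \<gamma>) / \<delta>)) \<le> w * (K * (\<gamma> * S powr (\<gamma> - 1)))"
      using w0 K by (intro mult_left_mono) auto
    have "w * d = w * (A / (x + sqrt \<epsilon>)) - k * (w * (x + sqrt \<epsilon>)) - w * (K * ((time_left j powr \<gamma> - S powr \<gamma>) / \<delta>))"
      by (simp add: d_def algebra_simps)
    moreover have "w * (K * (\<gamma> * S powr (\<gamma> - 1))) = K * \<gamma> * S powr (\<gamma> - 1) * w" by simp
    ultimately show "A - k * w\<^sup>2 - K * \<gamma> * S powr (\<gamma> - 1) * w \<le> w * d"
      using 1 2 3 by linarith
  qed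
  then show ?thesis unfolding next_eq S_def[symmetric] w_def[symmetric] using S(3) by simp
qed

lemma xh_measurable: "j \<le> n \<Longrightarrow> (\<lambda>y. xh y j) \<in> borel_measurable (noise n)"
proof -
  assume j: "j \<le> n"
  have "(\<lambda>y. euler A k (sqrt \<epsilon>) \<delta> x0 (\<lambda>i. (\<lambda>_. h i) y) (\<lambda>i. (\<lambda>y. y i) y) j) \<in> borel_measurable (noise n)"
  proof (rule euler_measurable)
    fix i assume "i < j"
    then have "(\<lambda>y. y i) \<in> measurable (noise n) (normal_law \<delta>)"
      using j by (intro measurable_component_singleton) auto
    then show "(\<lambda>y. y i) \<in> borel_measurable (noise n)" by simp
  qed simp
  then show ?thesis by simp
qed

lemma shifted_measurable: "j \<le> n \<Longrightarrow> (\<lambda>y. shifted y j) \<in> borel_measurable (noise n)"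
  using xh_measurable[of j n] unfolding shifted_def by measurable

lemma U_measurable[measurable]: "U s \<in> borel_measurable borel"
  unfolding gauss_potential_def[abs_def] by measurable

lemma stopped_measurable: "j \<le> n \<Longrightarrow> (\<lambda>y. stopped y j) \<in> borel_measurable (noise n)"
proof (induction j)
  case 0
  have [measurable]: "(\<lambda>y. shifted y 0) \<in> borel_measurable (noise n)" using shifted_measurable[of 0 n] by simp
  show ?case by simp
next
  case (Suc j)
  have [measurable]: "(\<lambda>y. shifted y (Suc j)) \<in> borel_measurable (noise n)" using shifted_measurable Suc by simp
  have [measurable]: "(\<lambda>y. xh y j) \<in> borel_measurable (noise n)" using xh_measurable Suc by simp
  have [measurable]: "(\<lambda>y. stopped y j) \<in> borel_measurable (noise n)" using Suc by simp
  show ?case unfolding stopped.simps by measurable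
qed

lemma shifted_cong: "(\<And>i. i < j \<Longrightarrow> y i = y' i) \<Longrightarrow> shifted y j = shifted y' j"
  unfolding shifted_def using euler_cong[of j h h y y'] by simp

lemma stopped_cong: "(\<And>i. i < j \<Longrightarrow> y i = y' i) \<Longrightarrow> stopped y j = stopped y' j"
proof (induction j)
  case 0
  then show ?case using shifted_cong[of 0 y y'] by simp
next
  case (Suc j)
  then show ?case using shifted_cong[of "Suc j" y y'] euler_cong[of j h h y y'] by simp
qed

lemma prob_space_noise1: "prob_space (normal_law \<delta>)"
  using \<delta>(1) by (intro prob_space_normal_density) simp

lemma product_prob_space_noise: "product_prob_space (\<lambda>_::nat. normal_law \<delta>)"
  using prob_space_noise1 by (simp add: product_prob_space_def product_prob_space_axioms_def product_sigma_finite_def prob_space_imp_sigma_finite)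

lemma prob_space_noise: "prob_space (noise n)"
  by (rule prob_space_PiM) (rule prob_space_noise1)

text \<open>If the scheme is already frozen, nothing changes; otherwise this is \<open>potential_step_euler\<close>, with the last coordinate of
the product measure integrated out.\<close>

lemma stopped_supermartingale:
  assumes j: "l \<le> j" "j < q"
  shows "(\<integral>\<^sup>+y. ennreal (stopped y (Suc j)) \<partial>noise (Suc j)) \<le> (\<integral>\<^sup>+y. ennreal (stopped y j) \<partial>noise j)"
proof -
  let ?N = "\<lambda>_::nat. normal_law \<delta>"
  interpret product_prob_space ?N by (rule product_prob_space_noise)
  have mass: "emeasure (normal_law \<delta>) UNIV = 1"
    using prob_space.emeasure_space_1[OF prob_space_noise1] by simp
  have "(\<integral>\<^sup>+y. ennreal (stopped y (Suc j)) \<partial>noise (Suc j)) =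
      (\<integral>\<^sup>+y. (\<integral>\<^sup>+z. ennreal (stopped (y(j := z)) (Suc j)) \<partial>?N j) \<partial>noise j)"
    unfolding lessThan_Suc
    by (rule product_nn_integral_insert)
      (use stopped_measurable[of "Suc j" "Suc j"] in \<open>auto simp: lessThan_Suc\<close>)
  also have "\<dots> \<le> (\<integral>\<^sup>+y. ennreal (stopped y j) \<partial>noise j)"
  proof (rule nn_integral_mono)
    fix y
    have xh_eq: "xh (y(j := z)) j = xh y j" for z by (rule euler_cong) auto
    have stopped_eq: "stopped (y(j := z)) j = stopped y j" for z by (rule stopped_cong) auto
    show "(\<integral>\<^sup>+z. ennreal (stopped (y(j := z)) (Suc j)) \<partial>?N j) \<le> ennreal (stopped y j)"
    proof (cases "xh y j \<le> sqrt \<epsilon>")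
      case True
      then show ?thesis using j by (simp add: xh_eq stopped_eq mass del: euler.simps)
    next
      case False
      have "stopped y j = U (time_left j) (shifted y j)"
      proof (cases j)
        case (Suc i)
        then show ?thesis using False by (cases "xh y i \<le> sqrt \<epsilon>") (auto simp: Let_def)
      qed simp
      moreover have "stopped (y(j := z)) (Suc j) = U (time_left (Suc j)) (shifted (y(j := z)) (Suc j))" for z
        using False by (simp add: xh_eq del: euler.simps)
      ultimately show ?thesis using potential_step_euler[OF j, of y] False by simp
    qed
  qed
  finally show ?thesis .
qed

lemma stopped_mean_le:
  assumes C: "\<And>y. U (time_left l) (shifted y l) \<le> C"
  shows "(\<integral>\<^sup>+y. ennreal (stopped y q) \<partial>noise q) \<le> ennreal C"
proof -
  have "(\<integral>\<^sup>+y. ennreal (stopped y q) \<partial>noise q) \<le> (\<integral>\<^sup>+y. ennreal (stopped y l) \<partial>noise l)"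
  proof -
    have "(\<integral>\<^sup>+y. ennreal (stopped y n) \<partial>noise n) \<le> (\<integral>\<^sup>+y. ennreal (stopped y l) \<partial>noise l)"
      if "l \<le> n" "n \<le> q" for n
      using that
    proof (induction n rule: dec_induct)
      case (step n)
      then show ?case using stopped_supermartingale[of n] by (auto intro: order_trans)
    qed simp
    then show ?thesis using l(1) by simp
  qed
  also have "\<dots> \<le> (\<integral>\<^sup>+y. ennreal C \<partial>noise l)"
  proof (intro nn_integral_mono ennreal_leI)
    fix y
    have "stopped y n = U (time_left n) (shifted y n)" if "n \<le> l" for n using that by (cases n) auto
    then show "stopped y l \<le> C" using C[of y] by simp
  qed
  also have "\<dots> = ennreal C" using prob_space.emeasure_space_1[OF prob_space_noise[of l]] by simp
  finally show ?thesis .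
qed

text \<open>At the stopping time the time left lies in \<open>[\<epsilon>, 2\<epsilon>]\<close> and the shifted position is \<open>O (\<surd>\<epsilon>)\<close>, as \<open>s\<^sup>\<gamma> \<le> \<surd>s\<close> for
\<open>s \<le> 1\<close>; afterwards the stopped potential stays constant.\<close>

lemma block_stop_potential:
  assumes "block_stop y"
  shows "2 powr (- D / 2) * exp (- (2 + 4 * K)\<^sup>2 / (2 * \<rho>)) * \<epsilon> powr (- D / 2) \<le> stopped y q"
proof -
  obtain i where i: "i \<le> q" "l \<le> i" "(real q - real i) * \<delta> \<le> \<epsilon>" "- sqrt \<epsilon> \<le> xh y i" "xh y i \<le> sqrt \<epsilon>"
      "\<And>j. j < i \<Longrightarrow> xh y j > sqrt \<epsilon>"
    using assms l_block unfolding stops_in_block_def by (metis atMost_iff lessThan_iff)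
  have at_i: "stopped y i = U (time_left i) (shifted y i)"
  proof (cases i)
    case (Suc j)
    then show ?thesis using i(6)[of j] by simp
  qed simp
  have frozen: "xh y (i + n) = xh y i \<and> stopped y (i + n) = stopped y i" for n
  proof (induction n)
    case (Suc n)
    then show ?case using i(2,5) by (simp add: Let_def)
  qed simp
  have q_eq: "stopped y q = U (time_left i) (shifted y i)"
    using frozen[of "q - i"] i(1) at_i by simp
  define s where "s = time_left i"
  have s: "\<epsilon> \<le> s" "s \<le> 2 * \<epsilon>" using time_left_ge[OF i(1)] i(3) by (auto simp: s_def time_left_def)
  have "s powr \<gamma> \<le> s powr (1 / 2)"
    using s \<epsilon> \<epsilon>_pos \<gamma> by (intro powr_mono') auto
  also have "\<dots> = sqrt s" using s \<epsilon>_pos by (simp add: powr_half_sqrt)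
  also have "\<dots> \<le> sqrt (4 * \<epsilon>)" using s \<epsilon>_pos by simp
  also have "\<dots> = 2 * sqrt \<epsilon>" by (simp add: real_sqrt_mult)
  finally have s_powr: "s powr \<gamma> \<le> 2 * sqrt \<epsilon>" .
  have "2 * K * s powr \<gamma> \<le> 2 * K * (2 * sqrt \<epsilon>)" using s_powr K by (intro mult_left_mono) auto
  then have shift: "0 \<le> shifted y i" "shifted y i \<le> (2 + 4 * K) * sqrt \<epsilon>"
    using shift_bounds[OF i(1)] i(4,5) unfolding shifted_def s_def[symmetric] by (auto simp: algebra_simps)
  have "(shifted y i)\<^sup>2 \<le> ((2 + 4 * K) * sqrt \<epsilon>)\<^sup>2" using shift by (intro power_mono) auto
  also have "\<dots> = (2 + 4 * K)\<^sup>2 * \<epsilon>" using \<epsilon>_pos by (simp add: power_mult_distrib)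
  also have "\<dots> \<le> (2 + 4 * K)\<^sup>2 * s" using s by (intro mult_left_mono) auto
  finally have "(shifted y i)\<^sup>2 / (2 * \<rho> * s) \<le> ((2 + 4 * K)\<^sup>2 * s) / (2 * \<rho> * s)"
    using \<rho> s \<epsilon>_pos by (intro divide_right_mono) auto
  also have "\<dots> = (2 + 4 * K)\<^sup>2 / (2 * \<rho>)" using s \<epsilon>_pos by simp
  finally have e: "exp (- (2 + 4 * K)\<^sup>2 / (2 * \<rho>)) \<le> exp (- (shifted y i)\<^sup>2 / (2 * \<rho> * s))" by simp
  have "2 powr (- D / 2) * \<epsilon> powr (- D / 2) = (2 * \<epsilon>) powr (- D / 2)"
    using \<epsilon>_pos by (simp add: powr_mult)
  also have "\<dots> \<le> s powr (- D / 2)" using s \<epsilon>_pos D by (intro powr_mono2') auto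
  finally have "2 powr (- D / 2) * \<epsilon> powr (- D / 2) * exp (- (2 + 4 * K)\<^sup>2 / (2 * \<rho>))
      \<le> s powr (- D / 2) * exp (- (shifted y i)\<^sup>2 / (2 * \<rho> * s))"
    using e by (intro mult_mono) auto
  then show ?thesis unfolding q_eq gauss_potential_def s_def[symmetric] by (simp add: mult_ac)
qed

lemma block_stop_sets: "{y \<in> space (noise q). block_stop y} \<in> sets (noise q)"
proof (rule stops_in_block_sets[where H = "\<lambda>i _. h i" and Y = "\<lambda>i y. y i"])
  show "(\<lambda>y. y i) \<in> borel_measurable (noise q)" if "i < q" for i
  proof -
    have "(\<lambda>y. y i) \<in> measurable (noise q) (normal_law \<delta>)"
      using that by (intro measurable_component_singleton) auto
    then show ?thesis by simp
  qed
qed simp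

text \<open>Markov's inequality for the stopped potential.\<close>

lemma block_stop_bound:
  assumes C: "\<And>y. U (time_left l) (shifted y l) \<le> C"
  shows "emeasure (noise q) {y \<in> space (noise q). block_stop y}
    \<le> ennreal (C / (2 powr (- D / 2) * exp (- (2 + 4 * K)\<^sup>2 / (2 * \<rho>))) * \<epsilon> powr (D / 2))"
proof -
  define c where "c = 2 powr (- D / 2) * exp (- (2 + 4 * K)\<^sup>2 / (2 * \<rho>)) * \<epsilon> powr (- D / 2)"
  have c: "c > 0" using \<epsilon>_pos by (simp add: c_def)
  have C0: "C \<ge> 0"
  proof -
    have "0 \<le> U (time_left l) (shifted (\<lambda>_. 0) l)" by (simp add: gauss_potential_def)
    then show ?thesis using C by (rule order_trans)
  qed
  have "ennreal c * emeasure (noise q) {y \<in> space (noise q). block_stop y}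
      = (\<integral>\<^sup>+y. ennreal c * indicator {y \<in> space (noise q). block_stop y} y \<partial>noise q)"
    using block_stop_sets by (simp add: nn_integral_cmult_indicator)
  also have "\<dots> \<le> (\<integral>\<^sup>+y. ennreal (stopped y q) \<partial>noise q)"
    using block_stop_potential by (intro nn_integral_mono) (auto simp: indicator_def c_def intro!: ennreal_leI)
  also have "\<dots> \<le> ennreal C" by (rule stopped_mean_le[OF C])
  finally have "ennreal (1 / c) * (ennreal c * emeasure (noise q) {y \<in> space (noise q). block_stop y}) \<le> ennreal (1 / c) * ennreal C"
    by (intro mult_left_mono) auto
  also have "\<dots> = ennreal (C / c)" using c C0 by (simp add: ennreal_mult[symmetric])
  also have "ennreal (1 / c) * (ennreal c * emeasure (noise q) {y \<in> space (noise q). block_stop y})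
      = emeasure (noise q) {y \<in> space (noise q). block_stop y}"
    using c by (simp add: mult.assoc[symmetric] ennreal_mult[symmetric])
  finally show ?thesis by (simp add: c_def powr_minus field_simps)
qed

lemma initial_potential_le_late:
  assumes "s0 / 2 \<le> time_left l"
  shows "U (time_left l) w \<le> (s0 / 2) powr (- D / 2)"
proof -
  have "U (time_left l) w \<le> time_left l powr (- D / 2) * 1"
    unfolding gauss_potential_def using \<rho> assms s0 by (intro mult_left_mono) auto
  also have "\<dots> \<le> (s0 / 2) powr (- D / 2)" using assms s0 D by (simp, intro powr_mono2') auto
  finally show ?thesis .
qed

lemma initial_potential_le_start:
  assumes "l = 0" "x0 > 0"
  shows "U (time_left l) (shifted y l) \<le> (D / 2 / (x0\<^sup>2 / (2 * \<rho>))) powr (D / 2)"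
proof -
  have t: "time_left 0 > 0" using time_left_ge[of 0] \<epsilon>_pos by simp
  have "x0 \<le> shifted y 0" using shift_bounds(1)[of 0] \<epsilon>_pos by (simp add: shifted_def)
  then have "x0\<^sup>2 \<le> (shifted y 0)\<^sup>2" using assms by (intro power_mono) auto
  then have "x0\<^sup>2 / (2 * \<rho> * time_left 0) \<le> (shifted y 0)\<^sup>2 / (2 * \<rho> * time_left 0)"
    using \<rho> t by (intro divide_right_mono) auto
  then have "U (time_left 0) (shifted y 0) \<le> time_left 0 powr (- (D / 2)) * exp (- (x0\<^sup>2 / (2 * \<rho>)) / time_left 0)"
    unfolding gauss_potential_def using \<rho> t by (auto intro!: mult_left_mono)
  also have "\<dots> \<le> (D / 2 / (x0\<^sup>2 / (2 * \<rho>))) powr (D / 2)"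
    using assms \<rho> D t by (intro powr_exp_inverse_bounded) auto
  finally show ?thesis using assms by simp
qed

end

context bessel_potential
begin

text \<open>The bound on the initial potential divided by the factor of \<open>\<epsilon>\<^sup>-\<^sup>D\<^sup>/\<^sup>2\<close> in \<open>block_stop_potential\<close>.\<close>

definition block_constant :: "real \<Rightarrow> real" where
  "block_constant x0 = max ((s0 / 2) powr (- D / 2)) ((D / 2 / (x0\<^sup>2 / (2 * \<rho>))) powr (D / 2))
     / (2 powr (- D / 2) * exp (- (2 + 4 * K)\<^sup>2 / (2 * \<rho>)))"

lemma block_constant_nonneg: "block_constant x0 \<ge> 0"
  by (auto simp: block_constant_def intro!: divide_nonneg_nonneg max.coboundedI1)

text \<open>A block that ends before time \<open>s0\<close> is followed from time \<open>0\<close>, where the potential is bounded since the scheme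
starts at \<open>x0 > 0\<close>. A later block is followed from a grid point where the time left is between \<open>s0 / 2\<close> and \<open>s0\<close>, and there
the potential is bounded whatever the position.\<close>

lemma block_probability:
  assumes "x0 > 0" and \<epsilon>: "\<epsilon> > 0" "2 * \<epsilon> \<le> 1" "2 * \<epsilon> \<le> s0"
    and \<delta>: "\<delta> > 0" "\<delta> \<le> \<epsilon>" "D * \<delta> \<le> 2 * \<kappa> * \<epsilon>"
    and h: "\<And>j. j \<le> q \<Longrightarrow> \<bar>h q - h j\<bar> \<le> K * ((real q - real j) * \<delta>) powr \<gamma>"
  shows "emeasure (PiM {..<q} (\<lambda>_. normal_law \<delta>))
      {y \<in> space (PiM {..<q} (\<lambda>_. normal_law \<delta>)). stops_in_block A k x0 \<delta> \<epsilon> q h y}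
    \<le> ennreal (block_constant x0 * \<epsilon> powr (D / 2))"
proof (cases "real q * \<delta> + \<epsilon> \<le> s0")
  case True
  interpret bessel_grid A k K \<gamma> D \<rho> \<kappa> s0 x0 \<delta> \<epsilon> h q 0
    by unfold_locales (use assms True in auto)
  show ?thesis unfolding block_constant_def
    by (rule block_stop_bound) (use initial_potential_le_start assms in \<open>auto intro: max.coboundedI2\<close>)
next
  case False
  \<comment> \<open>the largest number of steps whose duration is at most \<open>s0 - \<epsilon>\<close>\<close>
  define l0 where "l0 = nat \<lfloor>(s0 - \<epsilon>) / \<delta>\<rfloor>"
  have fl: "real l0 = of_int \<lfloor>(s0 - \<epsilon>) / \<delta>\<rfloor>" using \<epsilon> \<delta> by (simp add: l0_def)
  have l0: "real l0 * \<delta> \<le> s0 - \<epsilon>" "s0 - \<epsilon> < (real l0 + 1) * \<delta>"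
  proof -
    have "real l0 \<le> (s0 - \<epsilon>) / \<delta>" "(s0 - \<epsilon>) / \<delta> < real l0 + 1" unfolding fl by linarith+
    then show "real l0 * \<delta> \<le> s0 - \<epsilon>" "s0 - \<epsilon> < (real l0 + 1) * \<delta>"
      using \<delta> by (simp_all add: field_simps)
  qed
  have "real l0 * \<delta> < real q * \<delta>" using l0 False by linarith
  then have "l0 < q" using \<delta> by simp
  then have diff: "real q - real (q - l0) = real l0" by simp
  interpret bessel_grid A k K \<gamma> D \<rho> \<kappa> s0 x0 \<delta> \<epsilon> h q "q - l0"
  proof unfold_locales
    show "(real q - real (q - l0)) * \<delta> + \<epsilon> \<le> s0" unfolding diff using l0 by linarith
    fix i assume i: "i \<le> q" "(real q - real i) * \<delta> \<le> \<epsilon>"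
    have "(real q - real i) * \<delta> < (real l0 + 1) * \<delta>" using i(2) l0(2) \<epsilon> by linarith
    then have "real q - real i < real l0 + 1" using \<delta> by simp
    then show "q - l0 \<le> i" by linarith
  qed (use assms in auto)
  have "s0 / 2 \<le> time_left (q - l0)"
    unfolding time_left_def diff using l0(2) assms(4,6) by (simp add: algebra_simps)
  then show ?thesis unfolding block_constant_def
    by (intro block_stop_bound) (use initial_potential_le_late in \<open>auto intro: max.coboundedI1\<close>)
qed

end

section \<open>From the grid to the probability space\<close>

lemma stops_in_block_cong:
  assumes "\<And>i. i \<le> q \<Longrightarrow> h i = h' i" "\<And>i. i < q \<Longrightarrow> y i = y' i"
  shows "stops_in_block A k x0 \<delta> \<epsilon> q h y \<longleftrightarrow> stops_in_block A k x0 \<delta> \<epsilon> q h' y'"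
proof -
  have "euler A k (sqrt \<epsilon>) \<delta> x0 h y i = euler A k (sqrt \<epsilon>) \<delta> x0 h' y' i" if "i \<le> q" for i
    using assms that by (intro euler_cong) auto
  then show ?thesis unfolding stops_in_block_def by auto
qed

text \<open>Fubini for the joint law of the increments of \<open>B\<close> and the independent path \<open>G\<close> on the grid: \<open>G\<close> may be frozen.\<close>

lemma (in prob_space) nn_integral_brownian_increments_independent:
  fixes B G :: "real \<Rightarrow> 'a \<Rightarrow> real"
  assumes B: "standard_brownian_motion M B" and ind: "independent_processes M B G"
    and \<delta>: "\<delta> > 0" and q: "q > 0"
    and f[measurable]: "f \<in> borel_measurable (PiM {..<q} (\<lambda>_. borel) \<Otimes>\<^sub>M PiM {..q} (\<lambda>_. borel))"
  shows "(\<integral>\<^sup>+\<omega>. f (\<lambda>i\<in>{..<q}. B (real (Suc i) * \<delta>) \<omega> - B (real i * \<delta>) \<omega>, \<lambda>i\<in>{..q}. G (real i * \<delta>) \<omega>) \<partial>M)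
    = (\<integral>\<^sup>+\<omega>. (\<integral>\<^sup>+y. f (y, \<lambda>i\<in>{..q}. G (real i * \<delta>) \<omega>)
        \<partial>PiM {..<q} (\<lambda>_. normal_law \<delta>)) \<partial>M)"
proof -
  let ?Y = "\<lambda>\<omega>. \<lambda>i\<in>{..<q}. B (real (Suc i) * \<delta>) \<omega> - B (real i * \<delta>) \<omega>"
  let ?H = "\<lambda>\<omega>. \<lambda>i\<in>{..q}. G (real i * \<delta>) \<omega>"
  let ?S = "PiM {..<q} (\<lambda>_::nat. borel :: real measure)" and ?T = "PiM {..q} (\<lambda>_::nat. borel :: real measure)"
  let ?N = "normal_law \<delta>"
  have comp: "(\<lambda>w. w (real i * \<delta>)) \<in> borel_measurable (PiM {0..} (\<lambda>_. borel :: real measure))" for i :: nat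
    using \<delta> by (intro measurable_component_singleton) simp
  have "indep_var ?S ((\<lambda>w. \<lambda>i\<in>{..<q}. w (real (Suc i) * \<delta>) - w (real i * \<delta>)) \<circ> (\<lambda>\<omega>. \<lambda>t\<in>{0..}. B t \<omega>))
      ?T ((\<lambda>w. \<lambda>i\<in>{..q}. w (real i * \<delta>)) \<circ> (\<lambda>\<omega>. \<lambda>t\<in>{0..}. G t \<omega>))"
    using ind unfolding independent_processes_def
  proof (rule indep_var_compose)
    show "(\<lambda>w. \<lambda>i\<in>{..<q}. w (real (Suc i) * \<delta>) - w (real i * \<delta>)) \<in> measurable (PiM {0..} (\<lambda>_. borel)) ?S"
      by (intro measurable_restrict borel_measurable_diff comp)
    show "(\<lambda>w. \<lambda>i\<in>{..q}. w (real i * \<delta>)) \<in> measurable (PiM {0..} (\<lambda>_. borel)) ?T"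
      by (intro measurable_restrict comp)
  qed
  also have "(\<lambda>w. \<lambda>i\<in>{..<q}. w (real (Suc i) * \<delta>) - w (real i * \<delta>)) \<circ> (\<lambda>\<omega>. \<lambda>t\<in>{0..}. B t \<omega>) = ?Y"
    using \<delta> by (auto simp: fun_eq_iff restrict_def)
  also have "(\<lambda>w. \<lambda>i\<in>{..q}. w (real i * \<delta>)) \<circ> (\<lambda>\<omega>. \<lambda>t\<in>{0..}. G t \<omega>) = ?H"
    using \<delta> by (auto simp: fun_eq_iff restrict_def)
  finally have YH: "indep_var ?S ?Y ?T ?H" .
  have Y[measurable]: "?Y \<in> measurable M ?S" and H[measurable]: "?H \<in> measurable M ?T"
    using indep_var_rv1[OF YH] indep_var_rv2[OF YH] .
  have law: "distr M ?S ?Y \<Otimes>\<^sub>M distr M ?T ?H = distr M (?S \<Otimes>\<^sub>M ?T) (\<lambda>\<omega>. (?Y \<omega>, ?H \<omega>))"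
    using YH unfolding indep_var_distribution_eq by blast
  have Y_law: "distr M ?S ?Y = PiM {..<q} (\<lambda>_. ?N)"
  proof -
    have part: "\<forall>(n::nat) p. 0 \<le> p 0 \<and> (\<forall>i<n. p i < p (Suc i)) \<longrightarrow>
        indep_vars (\<lambda>_. borel) (\<lambda>i \<omega>. B (p (Suc i)) \<omega> - B (p i) \<omega>) {..<n}"
      using B unfolding standard_brownian_motion_def by (elim conjE)
    have "indep_vars (\<lambda>_. borel) (\<lambda>i \<omega>. B (real (Suc i) * \<delta>) \<omega> - B (real i * \<delta>) \<omega>) {..<q}"
      using part[THEN spec[where x = q], THEN spec[where x = "\<lambda>i. real i * \<delta>"]] \<delta> by simp
    moreover have rv: "(\<lambda>\<omega>. B (real (Suc i) * \<delta>) \<omega> - B (real i * \<delta>) \<omega>) \<in> borel_measurable M" for i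
      using brownian_measurable[OF B] \<delta> by (intro borel_measurable_diff) auto
    ultimately have "distr M ?S ?Y = PiM {..<q} (\<lambda>i. distr M borel (\<lambda>\<omega>. B (real (Suc i) * \<delta>) \<omega> - B (real i * \<delta>) \<omega>))"
      using q by (subst (asm) indep_vars_iff_distr_eq_PiM) (auto simp: lessThan_empty_iff)
    also have "\<dots> = PiM {..<q} (\<lambda>_. ?N)"
    proof (rule PiM_cong[OF refl])
      fix i
      have "real (Suc i) * \<delta> - real i * \<delta> = \<delta>" by (simp add: algebra_simps)
      then show "distr M borel (\<lambda>\<omega>. B (real (Suc i) * \<delta>) \<omega> - B (real i * \<delta>) \<omega>) = ?N"
        using brownian_increment_distr[OF B, of "real i * \<delta>" "real (Suc i) * \<delta>"] \<delta> by simp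
    qed
    finally show ?thesis .
  qed
  interpret Y: prob_space "distr M ?S ?Y" by (rule prob_space_distr) (rule Y)
  interpret H: prob_space "distr M ?T ?H" by (rule prob_space_distr) (rule H)
  interpret YH: pair_prob_space "distr M ?S ?Y" "distr M ?T ?H" ..
  have "(\<integral>\<^sup>+\<omega>. f (?Y \<omega>, ?H \<omega>) \<partial>M) = (\<integral>\<^sup>+z. f z \<partial>distr M (?S \<Otimes>\<^sub>M ?T) (\<lambda>\<omega>. (?Y \<omega>, ?H \<omega>)))"
    by (subst nn_integral_distr[OF measurable_Pair[OF Y H]]) auto
  also have "\<dots> = (\<integral>\<^sup>+h. \<integral>\<^sup>+y. f (y, h) \<partial>distr M ?S ?Y \<partial>distr M ?T ?H)"
    unfolding law[symmetric] by (subst YH.nn_integral_snd[symmetric]) (auto simp: split_beta')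
  also have "\<dots> = (\<integral>\<^sup>+\<omega>. (\<integral>\<^sup>+y. f (y, ?H \<omega>) \<partial>distr M ?S ?Y) \<partial>M)"
  proof -
    have "(\<lambda>(h, y). f (y, h)) \<in> borel_measurable (?T \<Otimes>\<^sub>M distr M ?S ?Y)" by measurable
    from Y.borel_measurable_nn_integral[OF this]
    have "(\<lambda>h. \<integral>\<^sup>+y. f (y, h) \<partial>distr M ?S ?Y) \<in> borel_measurable (distr M ?T ?H)" by simp
    from nn_integral_distr[OF H this] show ?thesis .
  qed
  finally show ?thesis unfolding Y_law .
qed

definition block_event ::
  "'w measure \<Rightarrow> (real \<Rightarrow> 'w \<Rightarrow> real) \<Rightarrow> (real \<Rightarrow> 'w \<Rightarrow> real) \<Rightarrow> real \<Rightarrow> real \<Rightarrow> real \<Rightarrow> real \<Rightarrow> real \<Rightarrow> real \<Rightarrow> real \<Rightarrow> nat \<Rightarrow> 'w set"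
  where
  "block_event P B G K \<gamma> A k x0 \<delta> \<epsilon> q = {\<omega> \<in> space P.
     (\<forall>j\<in>{..q}. \<bar>G (real q * \<delta>) \<omega> - G (real j * \<delta>) \<omega>\<bar> \<le> K * ((real q - real j) * \<delta>) powr \<gamma>) \<and>
     stops_in_block A k x0 \<delta> \<epsilon> q (\<lambda>i. G (real i * \<delta>) \<omega>) (\<lambda>i. B (real (Suc i) * \<delta>) \<omega> - B (real i * \<delta>) \<omega>)}"

lemma (in prob_space) block_event_sets:
  assumes B: "\<And>t. 0 \<le> t \<Longrightarrow> B t \<in> borel_measurable M" and G: "\<And>t. 0 \<le> t \<Longrightarrow> G t \<in> borel_measurable M" and \<delta>: "\<delta> > 0"
  shows "block_event M B G K \<gamma> A k x0 \<delta> \<epsilon> q \<in> events"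
proof -
  have G': "G (real i * \<delta>) \<in> borel_measurable M" for i :: nat using G \<delta> by simp
  have B': "B (real i * \<delta>) \<in> borel_measurable M" for i :: nat using B \<delta> by simp
  have single: "{\<omega> \<in> space M. \<bar>G (real q * \<delta>) \<omega> - G (real j * \<delta>) \<omega>\<bar> \<le> K * ((real q - real j) * \<delta>) powr \<gamma>} \<in> events" for j
  proof -
    have [measurable]: "(\<lambda>\<omega>. G (real q * \<delta>) \<omega> - G (real j * \<delta>) \<omega>) \<in> borel_measurable M"
      by (rule borel_measurable_diff[OF G' G'])
    show ?thesis by measurable
  qed
  have "{\<omega> \<in> space M. \<forall>j\<in>{..q}. \<bar>G (real q * \<delta>) \<omega> - G (real j * \<delta>) \<omega>\<bar> \<le> K * ((real q - real j) * \<delta>) powr \<gamma>} \<in> events"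
    by (rule sets.sets_Collect_finite_All[OF single finite_atMost])
  moreover have "{\<omega> \<in> space M. stops_in_block A k x0 \<delta> \<epsilon> q (\<lambda>i. G (real i * \<delta>) \<omega>) (\<lambda>i. B (real (Suc i) * \<delta>) \<omega> - B (real i * \<delta>) \<omega>)} \<in> events"
    by (rule stops_in_block_sets[where H = "\<lambda>i. G (real i * \<delta>)" and Y = "\<lambda>i \<omega>. B (real (Suc i) * \<delta>) \<omega> - B (real i * \<delta>) \<omega>"])
      (rule G', rule borel_measurable_diff[OF B' B'])
  ultimately show ?thesis unfolding block_event_def by (intro sets.sets_Collect_conj)
qed

lemma (in bessel_potential) block_event_probability:
  fixes P :: "'w measure"
  assumes "prob_space P" and B: "standard_brownian_motion P B" and ind: "independent_processes P B G"
    and G: "\<And>t. 0 \<le> t \<Longrightarrow> G t \<in> borel_measurable P"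
    and "x0 > 0" and \<epsilon>: "\<epsilon> > 0" "2 * \<epsilon> \<le> 1" "2 * \<epsilon> \<le> s0"
    and \<delta>: "\<delta> > 0" "\<delta> \<le> \<epsilon>" "D * \<delta> \<le> 2 * \<kappa> * \<epsilon>" and q: "q > 0"
  shows "emeasure P (block_event P B G K \<gamma> A k x0 \<delta> \<epsilon> q) \<le> ennreal (block_constant x0 * \<epsilon> powr (D / 2))"
proof -
  interpret prob_space P by fact
  let ?S = "PiM {..<q} (\<lambda>_::nat. borel :: real measure)" and ?T = "PiM {..q} (\<lambda>_::nat. borel :: real measure)"
  let ?Y = "\<lambda>\<omega>. \<lambda>i\<in>{..<q}. B (real (Suc i) * \<delta>) \<omega> - B (real i * \<delta>) \<omega>"
  let ?H = "\<lambda>\<omega>. \<lambda>i\<in>{..q}. G (real i * \<delta>) \<omega>"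
  let ?\<nu> = "PiM {..<q} (\<lambda>_::nat. normal_law \<delta>)"
  define good where "good h \<longleftrightarrow> (\<forall>j\<in>{..q}. \<bar>h q - h j\<bar> \<le> K * ((real q - real j) * \<delta>) powr \<gamma>)" for h :: "nat \<Rightarrow> real"
  define W where "W = {z \<in> space (?S \<Otimes>\<^sub>M ?T). good (snd z) \<and> stops_in_block A k x0 \<delta> \<epsilon> q (snd z) (fst z)}"
  have W[measurable]: "W \<in> sets (?S \<Otimes>\<^sub>M ?T)"
  proof -
    have comp: "(\<lambda>z. snd z i) \<in> borel_measurable (?S \<Otimes>\<^sub>M ?T)" if "i \<le> q" for i
      using that by (intro measurable_compose[OF measurable_snd measurable_component_singleton]) simp
    have comp': "(\<lambda>z. fst z i) \<in> borel_measurable (?S \<Otimes>\<^sub>M ?T)" if "i < q" for i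
      using that by (intro measurable_compose[OF measurable_fst measurable_component_singleton]) simp
    have "{z \<in> space (?S \<Otimes>\<^sub>M ?T). \<bar>snd z q - snd z j\<bar> \<le> K * ((real q - real j) * \<delta>) powr \<gamma>} \<in> sets (?S \<Otimes>\<^sub>M ?T)"
      if "j \<in> {..q}" for j
      using comp[of q] comp[of j] that by measurable
    then show ?thesis unfolding W_def good_def
      by (intro sets.sets_Collect_conj sets.sets_Collect_finite_All
          stops_in_block_sets[where H = "\<lambda>i z. snd z i" and Y = "\<lambda>i z. fst z i"] comp comp') auto
  qed
  have Y_H: "?Y \<omega> \<in> space ?S" "?H \<omega> \<in> space ?T" for \<omega> by (auto simp: space_PiM)
  have "emeasure P (block_event P B G K \<gamma> A k x0 \<delta> \<epsilon> q) = (\<integral>\<^sup>+\<omega>. indicator (block_event P B G K \<gamma> A k x0 \<delta> \<epsilon> q) \<omega> \<partial>P)"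
    using block_event_sets[of B G \<delta>] brownian_measurable[OF B] G \<delta> by simp
  also have "\<dots> = (\<integral>\<^sup>+\<omega>. indicator W (?Y \<omega>, ?H \<omega>) \<partial>P)"
  proof (intro nn_integral_cong)
    fix \<omega> assume \<omega>: "\<omega> \<in> space P"
    have "stops_in_block A k x0 \<delta> \<epsilon> q (?H \<omega>) (?Y \<omega>) \<longleftrightarrow> stops_in_block A k x0 \<delta> \<epsilon> q (\<lambda>i. G (real i * \<delta>) \<omega>) (\<lambda>i. B (real (Suc i) * \<delta>) \<omega> - B (real i * \<delta>) \<omega>)"
      by (rule stops_in_block_cong) auto
    then have "(?Y \<omega>, ?H \<omega>) \<in> W \<longleftrightarrow> \<omega> \<in> block_event P B G K \<gamma> A k x0 \<delta> \<epsilon> q"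
      using \<omega> Y_H[of \<omega>] by (simp add: W_def block_event_def good_def space_pair_measure)
    then show "indicator (block_event P B G K \<gamma> A k x0 \<delta> \<epsilon> q) \<omega> = (indicator W (?Y \<omega>, ?H \<omega>) :: ennreal)"
      by (simp add: indicator_def)
  qed
  also have "\<dots> = (\<integral>\<^sup>+\<omega>. (\<integral>\<^sup>+y. indicator W (y, ?H \<omega>) \<partial>?\<nu>) \<partial>P)"
    by (rule nn_integral_brownian_increments_independent[OF B ind \<delta>(1) q]) measurable
  also have "\<dots> \<le> (\<integral>\<^sup>+\<omega>. ennreal (block_constant x0 * \<epsilon> powr (D / 2)) \<partial>P)"
  proof (intro nn_integral_mono)
    fix \<omega>
    let ?E = "{y \<in> space ?\<nu>. stops_in_block A k x0 \<delta> \<epsilon> q (?H \<omega>) y}"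
    show "(\<integral>\<^sup>+y. indicator W (y, ?H \<omega>) \<partial>?\<nu>) \<le> ennreal (block_constant x0 * \<epsilon> powr (D / 2))"
    proof (cases "good (?H \<omega>)")
      case False
      then have "(\<lambda>y. indicator W (y, ?H \<omega>) :: ennreal) = (\<lambda>_. 0)" by (auto simp: W_def fun_eq_iff)
      then show ?thesis by simp
    next
      case True
      have E: "?E \<in> sets ?\<nu>"
      proof (rule stops_in_block_sets[where H = "\<lambda>i _. ?H \<omega> i" and Y = "\<lambda>i y. y i"])
        show "(\<lambda>y. y i) \<in> borel_measurable ?\<nu>" if "i < q" for i
        proof -
          have "(\<lambda>y. y i) \<in> measurable ?\<nu> (normal_law \<delta>)"
            using that by (intro measurable_component_singleton) auto
          then show ?thesis by simp
        qed
      qed simp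
      have "(\<integral>\<^sup>+y. indicator W (y, ?H \<omega>) \<partial>?\<nu>) \<le> (\<integral>\<^sup>+y. indicator ?E y \<partial>?\<nu>)"
        by (intro nn_integral_mono) (auto simp: W_def indicator_def)
      also have "\<dots> = emeasure ?\<nu> ?E" using E by simp
      also have "\<dots> \<le> ennreal (block_constant x0 * \<epsilon> powr (D / 2))"
        by (rule block_probability[OF assms(5-11)]) (use True in \<open>auto simp: good_def\<close>)
      finally show ?thesis .
    qed
  qed
  also have "\<dots> = ennreal (block_constant x0 * \<epsilon> powr (D / 2))" by (simp add: emeasure_space_1)
  finally show ?thesis .
qed

text \<open>For each \<open>L\<close> the set of points that lie in \<open>E L n\<close> for all large \<open>n\<close> has probability at most \<open>\<beta> L\<close>, so the
intersection of these sets over \<open>L\<close> is a null set.\<close>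

lemma (in prob_space) AE_not_eventually_in_small_events:
  fixes E :: "nat \<Rightarrow> nat \<Rightarrow> 'a set" and L0 n1 :: nat
  assumes E: "\<And>L n. L \<ge> L0 \<Longrightarrow> n \<ge> n1 \<Longrightarrow> E L n \<in> events"
    and small: "\<And>L n. L \<ge> L0 \<Longrightarrow> n \<ge> n1 \<Longrightarrow> prob (E L n) \<le> \<beta> L" and \<beta>: "\<beta> \<longlonglongrightarrow> 0"
  shows "AE \<omega> in M. \<not> (\<forall>L\<ge>L0. \<exists>n0. \<forall>n\<ge>n0. \<omega> \<in> E L n)"
proof -
  define S where "S L m = (\<Inter>n\<in>{max m n1..}. E L n)" for L m
  have S: "S L m \<in> events" if "L \<ge> L0" for L m
    unfolding S_def using E[OF that] by (intro sets.countable_INT') auto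
  have S_union: "(\<Union>m. S L m) \<in> events" if "L \<ge> L0" for L using S[OF that] by auto
  have bound: "prob (\<Union>m. S L m) \<le> \<beta> L" if L: "L \<ge> L0" for L
  proof -
    have "incseq (S L)" by (rule incseq_SucI) (auto simp: S_def)
    then have "(\<lambda>m. prob (S L m)) \<longlonglongrightarrow> prob (\<Union>m. S L m)"
      using S[OF L] by (intro finite_Lim_measure_incseq) auto
    moreover have "prob (S L m) \<le> \<beta> L" for m
    proof -
      have "prob (S L m) \<le> prob (E L (max m n1))"
        using E[OF L] by (intro finite_measure_mono) (auto simp: S_def)
      also have "\<dots> \<le> \<beta> L" using small[OF L] by simp
      finally show ?thesis .
    qed
    ultimately show ?thesis by (intro LIMSEQ_le_const2) auto
  qed
  define Z where "Z = (\<Inter>L\<in>{L0..}. \<Union>m. S L m)"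
  have Z: "Z \<in> events" unfolding Z_def using S_union by (intro sets.countable_INT') auto
  have "prob Z \<le> \<beta> L" if "L \<ge> L0" for L
  proof -
    have "prob Z \<le> prob (\<Union>m. S L m)" using S_union[OF that] that by (intro finite_measure_mono) (auto simp: Z_def)
    then show ?thesis using bound[OF that] by linarith
  qed
  then have "prob Z \<le> 0" using \<beta> by (intro LIMSEQ_le_const[OF \<beta>]) auto
  then have "prob Z = 0" using measure_nonneg[of M Z] by linarith
  then have "emeasure M Z = 0" by (simp add: emeasure_eq_measure)
  then have "AE \<omega> in M. \<omega> \<notin> Z" using Z by (intro AE_not_in) (auto simp: null_sets_def)
  then show ?thesis
  proof eventually_elim
    case (elim \<omega>)
    show ?case
    proof
      assume all: "\<forall>L\<ge>L0. \<exists>n0. \<forall>n\<ge>n0. \<omega> \<in> E L n"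
      have "\<omega> \<in> Z" unfolding Z_def
      proof
        fix L assume "L \<in> {L0..}"
        then obtain n0 where "\<forall>n\<ge>n0. \<omega> \<in> E L n" using all by auto
        then have "\<omega> \<in> S L n0" by (auto simp: S_def)
        then show "\<omega> \<in> (\<Union>m. S L m)" by blast
      qed
      then show False using elim by simp
    qed
  qed
qed

section \<open>The scheme as a lower bound for the path\<close>

text \<open>On one step the path stays below \<open>z + m\<close>, \<open>z\<close> being its value at the left end, so its drift is at least that of the scheme
at \<open>z\<close>. The map \<open>x \<mapsto> x + \<delta> (A / (x + m) - k (x + m))\<close> is increasing for small \<open>\<delta>\<close>, hence the order between scheme and path is
preserved.\<close>

lemma euler_below_path:
  fixes X W :: "real \<Rightarrow> real"
  assumes A: "A > 0" and k: "k \<ge> 0" and m: "m > 0" and \<delta>: "\<delta> > 0" "\<delta> * (A / m\<^sup>2 + 2 * k) \<le> 1"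
    and X_pos: "\<And>t. 0 \<le> t \<Longrightarrow> t < \<tau> \<Longrightarrow> X t > 0" and X_cont: "continuous_on {0..\<tau>} X"
    and eq: "\<And>s t. 0 \<le> s \<Longrightarrow> s \<le> t \<Longrightarrow> t < \<tau> \<Longrightarrow>
      X t - X s = integral {s..t} (\<lambda>u. A / X u - k * X u) + (W t - W s)"
    and modulus: "\<And>s t. 0 \<le> s \<Longrightarrow> s \<le> t \<Longrightarrow> t \<le> \<tau> \<Longrightarrow> t - s \<le> \<delta> \<Longrightarrow> \<bar>X t - X s\<bar> \<le> m"
    and driver: "\<And>i. y i + (h (Suc i) - h i) = W (real (Suc i) * \<delta>) - W (real i * \<delta>)"
    and j: "real j * \<delta> < \<tau>" and alive: "\<And>i. i < j \<Longrightarrow> euler A k m \<delta> (X 0) h y i > m"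
  shows "euler A k m \<delta> (X 0) h y j \<le> X (real j * \<delta>)"
  using j alive
proof (induction j)
  case (Suc j)
  define x z s t where "x = euler A k m \<delta> (X 0) h y j" and "z = X (real j * \<delta>)"
    and "s = real j * \<delta>" and "t = real (Suc j) * \<delta>"
  have st: "0 \<le> s" "s \<le> t" "t < \<tau>" "t - s = \<delta>"
    using Suc.prems(1) \<delta>(1) by (auto simp: s_def t_def algebra_simps)
  have x: "x > m" using Suc.prems(2)[of j] by (simp add: x_def)
  have xz: "x \<le> z" unfolding x_def z_def using Suc st by (intro Suc.IH) (auto simp: s_def)
  have drift: "integral {s..t} (\<lambda>u. A / X u - k * X u) \<ge> \<delta> * (A / (z + m) - k * (z + m))"
  proof -
    have "integral {s..t} (\<lambda>_. A / (z + m) - k * (z + m)) \<le> integral {s..t} (\<lambda>u. A / X u - k * X u)"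
    proof (rule integral_le)
      have "continuous_on {s..t} X" by (rule continuous_on_subset[OF X_cont]) (use st in auto)
      moreover have "\<forall>u\<in>{s..t}. X u \<noteq> 0"
      proof
        fix u assume "u \<in> {s..t}"
        then show "X u \<noteq> 0" using X_pos[of u] st by simp
      qed
      ultimately show "(\<lambda>u. A / X u - k * X u) integrable_on {s..t}"
        by (intro integrable_continuous_real continuous_intros)
      fix u assume u: "u \<in> {s..t}"
      have "\<bar>X u - X s\<bar> \<le> m" using modulus[of s u] u st by auto
      then have Xu: "X u \<le> z + m" unfolding z_def s_def by linarith
      have "X u > 0" using X_pos[of u] u st by auto
      then have "A / (z + m) \<le> A / X u" using Xu A by (intro divide_left_mono mult_pos_pos) auto
      moreover have "k * X u \<le> k * (z + m)" using Xu k by (intro mult_left_mono)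
      ultimately show "A / (z + m) - k * (z + m) \<le> A / X u - k * X u" by linarith
    qed (rule integrable_const_ivl)
    then show ?thesis using st by simp
  qed
  have mono: "x + \<delta> * (A / (x + m) - k * (x + m)) \<le> z + \<delta> * (A / (z + m) - k * (z + m))"
  proof -
    have pos: "x + m > 0" "z + m > 0" using x xz m by auto
    have "m\<^sup>2 \<le> (x + m) * (z + m)"
      unfolding power2_eq_square using x xz m by (intro mult_mono) auto
    then have "A / ((x + m) * (z + m)) \<le> A / m\<^sup>2"
      using A m pos by (intro divide_left_mono mult_pos_pos) auto
    then have "\<delta> * (A / ((x + m) * (z + m)) + k) \<le> \<delta> * (A / m\<^sup>2 + 2 * k)"
      using \<delta> k by (intro mult_left_mono add_mono) auto
    then have "\<delta> * (A / ((x + m) * (z + m)) + k) \<le> 1" using \<delta> by linarith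
    then have "(z - x) * (\<delta> * (A / ((x + m) * (z + m)) + k)) \<le> (z - x) * 1"
      using xz by (intro mult_left_mono) auto
    moreover have "A / (x + m) - A / (z + m) = (z - x) * (A / ((x + m) * (z + m)))"
      using pos by (simp add: field_simps)
    ultimately show ?thesis by (simp add: algebra_simps)
  qed
  have "euler A k m \<delta> (X 0) h y (Suc j) = x + \<delta> * (A / (x + m) - k * (x + m)) + (W t - W s)"
    using x driver[of j] unfolding euler.simps Let_def x_def[symmetric] s_def t_def by simp
  also have "\<dots> \<le> z + integral {s..t} (\<lambda>u. A / X u - k * X u) + (W t - W s)"
    using mono drift by linarith
  also have "\<dots> = X t" using eq[of s t] st unfolding z_def s_def by simp
  finally show ?case by (simp add: t_def)
qed simp

text \<open>At the last grid point before the hitting time the path is at most \<open>m\<close>, hence so is the scheme, unless it stopped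
earlier. The stopping position is at least \<open>- m\<close> because the last step starts above \<open>m\<close>, where the drift
takes away at most the current value and the driver at most \<open>m\<close>.\<close>

lemma euler_stops_before_hitting:
  fixes X W :: "real \<Rightarrow> real"
  assumes A: "A > 0" and k: "k \<ge> 0" and m: "m > 0" and \<delta>: "\<delta> > 0" "\<delta> * (A / m\<^sup>2 + 2 * k) \<le> 1"
    and X_pos: "\<And>t. 0 \<le> t \<Longrightarrow> t < \<tau> \<Longrightarrow> X t > 0" and X_cont: "continuous_on {0..\<tau>} X"
    and eq: "\<And>s t. 0 \<le> s \<Longrightarrow> s \<le> t \<Longrightarrow> t < \<tau> \<Longrightarrow>
      X t - X s = integral {s..t} (\<lambda>u. A / X u - k * X u) + (W t - W s)"
    and modulus: "\<And>s t. 0 \<le> s \<Longrightarrow> s \<le> t \<Longrightarrow> t \<le> \<tau> \<Longrightarrow> t - s \<le> \<delta> \<Longrightarrow> \<bar>X t - X s\<bar> \<le> m"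
    and W_modulus: "\<And>s t. 0 \<le> s \<Longrightarrow> s \<le> t \<Longrightarrow> t \<le> \<tau> \<Longrightarrow> t - s \<le> \<delta> \<Longrightarrow> \<bar>W t - W s\<bar> \<le> m"
    and driver: "\<And>i. y i + (h (Suc i) - h i) = W (real (Suc i) * \<delta>) - W (real i * \<delta>)"
    and \<tau>: "\<tau> > 0" "X \<tau> = 0" and start: "X 0 > m"
  obtains i where "real i * \<delta> < \<tau>" "- m \<le> euler A k m \<delta> (X 0) h y i" "euler A k m \<delta> (X 0) h y i \<le> m"
    "\<And>j. j < i \<Longrightarrow> euler A k m \<delta> (X 0) h y j > m"
proof -
  let ?xh = "euler A k m \<delta> (X 0) h y"
  have "\<exists>n. \<tau> \<le> real n * \<delta>" using \<delta>(1) by (metis mult.commute order_less_imp_le reals_Archimedean3)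
  define N where "N = (LEAST n. \<tau> \<le> real n * \<delta>)"
  have N: "\<tau> \<le> real N * \<delta>" unfolding N_def by (rule LeastI_ex) fact
  have "N \<noteq> 0" using N \<tau>(1) by (intro notI) simp
  then obtain J where J: "N = Suc J" using not0_implies_Suc by blast
  have J_lt: "real J * \<delta> < \<tau>" using not_less_Least[of J "\<lambda>n. \<tau> \<le> real n * \<delta>"] J unfolding N_def[symmetric] by simp
  have "\<bar>X \<tau> - X (real J * \<delta>)\<bar> \<le> m"
    using N J J_lt \<delta>(1) by (intro modulus) (auto simp: algebra_simps)
  then have XJ: "X (real J * \<delta>) \<le> m" using \<tau> by linarith
  have "\<exists>i\<le>J. ?xh i \<le> m"
  proof (rule ccontr)
    assume "\<not> ?thesis"
    then have alive: "\<And>i. i \<le> J \<Longrightarrow> ?xh i > m" by force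
    have "?xh J \<le> X (real J * \<delta>)"
      by (rule euler_below_path[OF A k m \<delta> X_pos X_cont eq modulus driver J_lt]) (use alive in auto)
    then show False using XJ alive[of J] by simp
  qed
  then obtain i0 where i0: "i0 \<le> J" "?xh i0 \<le> m" by blast
  define i where "i = (LEAST i. ?xh i \<le> m)"
  have i: "?xh i \<le> m" "i \<le> i0" unfolding i_def using i0(2) by (rule LeastI, rule Least_le)
  have below: "?xh j > m" if "j < i" for j using not_less_Least[of j "\<lambda>i. ?xh i \<le> m"] that unfolding i_def by simp
  have "real i * \<delta> \<le> real J * \<delta>" using i(2) i0(1) \<delta>(1) by (intro mult_right_mono) auto
  then have i_lt: "real i * \<delta> < \<tau>" using J_lt by linarith
  have "i \<noteq> 0" using i(1) start by (cases i) auto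
  then obtain j where j: "i = Suc j" using not0_implies_Suc by blast
  define x where "x = ?xh j"
  have x: "x > m" using below[of j] j by (simp add: x_def)
  have W_inc: "\<bar>W (real (Suc j) * \<delta>) - W (real j * \<delta>)\<bar> \<le> m"
    using i_lt \<delta>(1) j by (intro W_modulus) (auto simp: algebra_simps)
  have "?xh i = x + \<delta> * (A / (x + m) - k * (x + m)) + (W (real (Suc j) * \<delta>) - W (real j * \<delta>))"
    using x driver[of j] unfolding j euler.simps Let_def x_def[symmetric] by simp
  moreover have "\<delta> * (k * (x + m)) \<le> x"
  proof -
    have "0 \<le> \<delta> * (A / m\<^sup>2)" using \<delta>(1) A by simp
    then have "\<delta> * (2 * k) \<le> 1" using \<delta>(2) by (simp add: ring_distribs)
    then have "(\<delta> * (2 * k)) * x \<le> 1 * x" using x m by (intro mult_right_mono) auto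
    moreover have "\<delta> * (k * (x + m)) \<le> \<delta> * (k * (2 * x))" using x \<delta>(1) k by (intro mult_left_mono) auto
    ultimately show ?thesis by (simp add: algebra_simps)
  qed
  moreover have "0 \<le> \<delta> * (A / (x + m))" using \<delta>(1) A x m by simp
  ultimately have "- m \<le> ?xh i" using W_inc by (simp add: right_diff_distrib)
  then show ?thesis using that[of i] i_lt i(1) below by blast
qed

lemma uniform_modulus:
  fixes f :: "real \<Rightarrow> real"
  assumes "continuous_on {a..b} f" "m > 0"
  obtains \<eta> where "\<eta> > 0" "\<And>s t. a \<le> s \<Longrightarrow> s \<le> t \<Longrightarrow> t \<le> b \<Longrightarrow> t - s \<le> \<eta> \<Longrightarrow> \<bar>f t - f s\<bar> \<le> m"
proof -
  have "uniformly_continuous_on {a..b} f" using assms(1) by (intro compact_uniformly_continuous) auto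
  then obtain d where d: "d > 0" "\<And>s t. s \<in> {a..b} \<Longrightarrow> t \<in> {a..b} \<Longrightarrow> dist t s < d \<Longrightarrow> dist (f t) (f s) < m"
    unfolding uniformly_continuous_on_def using assms(2) by metis
  show ?thesis
  proof (rule that[of "d / 2"])
    fix s t assume st: "a \<le> s" "s \<le> t" "t \<le> b" "t - s \<le> d / 2"
    then have "dist t s < d" using d(1) by (simp add: dist_real_def)
    then have "dist (f t) (f s) < m" using st by (intro d(2)) auto
    then show "\<bar>f t - f s\<bar> \<le> m" by (simp add: dist_real_def)
  qed (use d in simp)
qed

text \<open>With \<open>\<epsilon> = T / L\<close> and mesh \<open>\<epsilon> / n\<close> the ends of the blocks are the grid points \<open>b * n\<close>, and a stop at grid point \<open>i\<close> belongs
to the block \<open>b = i div n + 1\<close>.\<close>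

lemma hitting_path_in_block_events:
  fixes X :: "real \<Rightarrow> real" and B G :: "real \<Rightarrow> 'w \<Rightarrow> real"
  assumes A: "A > 0" and k: "k \<ge> 0" and \<omega>: "\<omega> \<in> space P" and T: "0 < \<tau>" "\<tau> \<le> T"
    and L: "L > 0" "sqrt (T / real L) < X 0"
    and X_pos: "\<And>t. 0 \<le> t \<Longrightarrow> t < \<tau> \<Longrightarrow> X t > 0" and X_cont: "continuous_on {0..\<tau>} X" and X_hit: "X \<tau> = 0"
    and eq: "\<And>s t. 0 \<le> s \<Longrightarrow> s \<le> t \<Longrightarrow> t < \<tau> \<Longrightarrow>
      X t - X s = integral {s..t} (\<lambda>u. A / X u - k * X u) + ((B t \<omega> + G t \<omega>) - (B s \<omega> + G s \<omega>))"
    and W_cont: "continuous_on {0..\<tau>} (\<lambda>t. B t \<omega> + G t \<omega>)"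
    and G: "\<And>s t. 0 \<le> s \<Longrightarrow> s \<le> t \<Longrightarrow> t \<le> T \<Longrightarrow> \<bar>G t \<omega> - G s \<omega>\<bar> \<le> K * (t - s) powr \<gamma>"
  shows "\<exists>n0. \<forall>n\<ge>n0. \<omega> \<in> (\<Union>b\<in>{1..L}. block_event P B G K \<gamma> A k (X 0) (T / real L / real n) (T / real L) (b * n))"
proof -
  define \<epsilon> m where "\<epsilon> = T / real L" and "m = sqrt \<epsilon>"
  have \<epsilon>: "\<epsilon> > 0" using T L by (simp add: \<epsilon>_def)
  have m: "m > 0" "X 0 > m" using \<epsilon> L by (auto simp: m_def \<epsilon>_def)
  obtain \<eta>1 where \<eta>1: "\<eta>1 > 0" "\<And>s t. 0 \<le> s \<Longrightarrow> s \<le> t \<Longrightarrow> t \<le> \<tau> \<Longrightarrow> t - s \<le> \<eta>1 \<Longrightarrow> \<bar>X t - X s\<bar> \<le> m"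
    using uniform_modulus[OF X_cont m(1)] by metis
  obtain \<eta>2 where \<eta>2: "\<eta>2 > 0" "\<And>s t. 0 \<le> s \<Longrightarrow> s \<le> t \<Longrightarrow> t \<le> \<tau> \<Longrightarrow> t - s \<le> \<eta>2 \<Longrightarrow>
      \<bar>(B t \<omega> + G t \<omega>) - (B s \<omega> + G s \<omega>)\<bar> \<le> m"
    using uniform_modulus[OF W_cont m(1)] by metis
  define c where "c = A / m\<^sup>2 + 2 * k"
  have c: "c > 0" unfolding c_def using A m k by (intro add_pos_nonneg divide_pos_pos) auto
  \<comment> \<open>below \<open>1 / c\<close> the Euler map is increasing; below \<open>\<eta>1\<close> and \<open>\<eta>2\<close> the path and its driver move by at most \<open>m\<close>\<close>
  define \<eta> where "\<eta> = min (1 / c) (min \<eta>1 \<eta>2)"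
  have \<eta>: "\<eta> > 0" using c \<eta>1 \<eta>2 by (simp add: \<eta>_def)
  obtain n0 :: nat where n0: "\<epsilon> / \<eta> < real n0" using reals_Archimedean2 by blast
  have "\<omega> \<in> (\<Union>b\<in>{1..L}. block_event P B G K \<gamma> A k (X 0) (\<epsilon> / real n) \<epsilon> (b * n))" if n: "n \<ge> n0" for n
  proof -
    define \<delta> where "\<delta> = \<epsilon> / real n"
    have n_pos: "real n > 0" using n0 n \<epsilon> \<eta> by (smt (verit) divide_pos_pos of_nat_mono)
    have n_\<delta>: "real n * \<delta> = \<epsilon>" using n_pos by (simp add: \<delta>_def)
    have "\<epsilon> / \<eta> < real n" using n0 n by (meson less_le_trans of_nat_mono)
    then have "\<delta> \<le> \<eta>" using n_pos \<eta> by (simp add: \<delta>_def field_simps)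
    then have \<delta>: "\<delta> > 0" "\<delta> \<le> \<eta>1" "\<delta> \<le> \<eta>2" "\<delta> \<le> 1 / c"
      using \<epsilon> n_pos by (auto simp: \<eta>_def \<delta>_def)
    have \<delta>c: "\<delta> * (A / m\<^sup>2 + 2 * k) \<le> 1" using \<delta>(4) c unfolding c_def[symmetric] by (simp add: pos_le_divide_eq)
    define h y where "h = (\<lambda>i. G (real i * \<delta>) \<omega>)"
      and "y = (\<lambda>i. B (real (Suc i) * \<delta>) \<omega> - B (real i * \<delta>) \<omega>)"
    obtain i where i: "real i * \<delta> < \<tau>" "- m \<le> euler A k m \<delta> (X 0) h y i" "euler A k m \<delta> (X 0) h y i \<le> m"
        "\<And>j. j < i \<Longrightarrow> euler A k m \<delta> (X 0) h y j > m"
    proof (rule euler_stops_before_hitting[OF A k m(1) \<delta>(1) \<delta>c X_pos X_cont eq])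
      show "\<bar>X t - X s\<bar> \<le> m" if "0 \<le> s" "s \<le> t" "t \<le> \<tau>" "t - s \<le> \<delta>" for s t
        using \<eta>1(2)[of s t] that \<delta> by linarith
      show "\<bar>(B t \<omega> + G t \<omega>) - (B s \<omega> + G s \<omega>)\<bar> \<le> m" if "0 \<le> s" "s \<le> t" "t \<le> \<tau>" "t - s \<le> \<delta>" for s t
        using \<eta>2(2)[of s t] that \<delta> by linarith
      show "y i + (h (Suc i) - h i) = (B (real (Suc i) * \<delta>) \<omega> + G (real (Suc i) * \<delta>) \<omega>) - (B (real i * \<delta>) \<omega> + G (real i * \<delta>) \<omega>)" for i
        by (simp add: y_def h_def)
    qed (use T X_hit m that in auto)
    define b where "b = i div n + 1"
    have n0': "n > 0" using n_pos by simp
    have i_lt: "i < b * n" using dividend_less_div_times[OF n0', of i] by (simp add: b_def)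
    have "(b - 1) * n \<le> i" by (simp add: b_def)
    then have block: "b * n \<le> i + n" by (simp add: b_def)
    have "real i * \<delta> < real (L * n) * \<delta>"
      using i(1) T(2) n_\<delta> L(1) by (simp add: \<epsilon>_def mult.assoc)
    then have "real i < real (L * n)" using \<delta>(1) by (simp only: mult_less_cancel_right_pos)
    then have "i < L * n" by (simp only: of_nat_less_iff)
    then have "i div n < L" by (simp add: less_mult_imp_div_less)
    then have b_in: "b \<in> {1..L}" by (simp add: b_def)
    have q_T: "real (b * n) * \<delta> \<le> T"
    proof -
      have "real (b * n) * \<delta> = real b * \<epsilon>" using n_\<delta> by (simp add: mult.assoc)
      also have "\<dots> \<le> real L * \<epsilon>" using b_in \<epsilon> by (intro mult_right_mono) auto
      also have "\<dots> = T" using L by (simp add: \<epsilon>_def)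
      finally show ?thesis .
    qed
    have stop: "stops_in_block A k (X 0) \<delta> \<epsilon> (b * n) h y"
      unfolding stops_in_block_def m_def[symmetric]
    proof (intro bexI[of _ i] conjI ballI)
      have "(real (b * n) - real i) * \<delta> \<le> real n * \<delta>"
      proof (rule mult_right_mono)
        have "real (b * n) \<le> real (i + n)" using block by (rule of_nat_mono)
        then show "real (b * n) - real i \<le> real n" by simp
      qed (use \<delta> in simp)
      then show "(real (b * n) - real i) * \<delta> \<le> \<epsilon>" unfolding n_\<delta> .
    qed (use i i_lt in auto)
    have holder: "\<bar>G (real (b * n) * \<delta>) \<omega> - G (real j * \<delta>) \<omega>\<bar> \<le> K * ((real (b * n) - real j) * \<delta>) powr \<gamma>"
      if "j \<in> {..b * n}" for j
    proof -
      have "real j * \<delta> \<le> real (b * n) * \<delta>" using that \<delta>(1) by (intro mult_right_mono of_nat_mono) auto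
      then have "\<bar>G (real (b * n) * \<delta>) \<omega> - G (real j * \<delta>) \<omega>\<bar> \<le> K * (real (b * n) * \<delta> - real j * \<delta>) powr \<gamma>"
        using q_T \<delta>(1) by (intro G) auto
      then show ?thesis by (simp only: left_diff_distrib)
    qed
    have "\<omega> \<in> block_event P B G K \<gamma> A k (X 0) \<delta> \<epsilon> (b * n)"
      unfolding block_event_def by (intro CollectI conjI \<omega> ballI holder stop[unfolded h_def y_def])
    then show ?thesis using b_in unfolding \<delta>_def by blast
  qed
  then show ?thesis unfolding \<epsilon>_def by blast
qed

section \<open>Positivity\<close>

text \<open>The \<open>L\<close> blocks contribute at most \<open>L C (T / L)\<^sup>D\<^sup>/\<^sup>2\<close> in total, which tends to zero because \<open>D > 2\<close>.\<close>

lemma AE_not_eventually_in_block_events: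
  fixes P :: "'w measure" and T x0 :: real
  assumes P: "prob_space P" and B: "standard_brownian_motion P B" and ind: "independent_processes P B G"
    and G: "\<And>t. 0 \<le> t \<Longrightarrow> G t \<in> borel_measurable P"
    and par: "A > 1/2" "k \<ge> 0" "K \<ge> 0" "1/2 < \<gamma>" "\<gamma> \<le> 1" and x0: "x0 > 0" and T: "T > 0"
  shows "\<exists>L0. (\<forall>L\<ge>L0. L > 0 \<and> sqrt (T / real L) < x0) \<and> (AE \<omega> in P. \<not> (\<forall>L\<ge>L0. \<exists>n0. \<forall>n\<ge>n0.
       \<omega> \<in> (\<Union>b\<in>{1..L}. block_event P B G K \<gamma> A k x0 (T / real L / real n) (T / real L) (b * n))))"
proof -
  interpret prob_space P by (rule P)
  obtain D \<rho> \<kappa> s0 where "bessel_potential A k K \<gamma> D \<rho> \<kappa> s0"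
    using bessel_potential_exists[OF par] .
  then interpret bessel_potential A k K \<gamma> D \<rho> \<kappa> s0 .
  \<comment> \<open>\<open>T / L < a\<close> gives \<open>\<surd>\<epsilon> < x0\<close>, \<open>2\<epsilon> \<le> 1\<close> and \<open>2\<epsilon> \<le> s0\<close> for \<open>\<epsilon> = T / L\<close>\<close>
  define a where "a = min (x0\<^sup>2) (min (1 / 2) (s0 / 2))"
  have a: "a > 0" using x0 s0 by (simp add: a_def)
  obtain L0 :: nat where L0: "T / a < real L0" using reals_Archimedean2 by blast
  obtain n1 :: nat where n1: "max 0 (D / (2 * \<kappa>)) < real n1" using reals_Archimedean2 by blast
  have L: "L > 0" "T / real L > 0" "T / real L < a" if "L \<ge> L0" for L
  proof -
    have 1: "T / a < real L" using L0 that by (meson less_le_trans of_nat_mono)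
    moreover have "T / a > 0" using T a by simp
    ultimately have L_pos: "real L > 0" by linarith
    then show "L > 0" "T / real L > 0" using T by auto
    show "T / real L < a" using 1 a L_pos by (simp add: field_simps)
  qed
  let ?E = "\<lambda>L n. \<Union>b\<in>{1..L}. block_event P B G K \<gamma> A k x0 (T / real L / real n) (T / real L) (b * n)"
  define C where "C = block_constant x0"
  define \<beta> where "\<beta> L = C * T * (T / real L) powr (D / 2 - 1)" for L
  have n_pos: "real n > 0" "D / (2 * \<kappa>) < real n" if "n \<ge> n1" for n
    using n1 of_nat_mono[OF that, where 'a = real] by auto
  have E_sets: "block_event P B G K \<gamma> A k x0 (T / real L / real n) (T / real L) (b * n) \<in> events"
    if "L \<ge> L0" "n \<ge> n1" for L n b
    by (rule block_event_sets[OF brownian_measurable[OF B] G divide_pos_pos[OF L(2)[OF that(1)] n_pos(1)[OF that(2)]]])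
  have "L > 0 \<and> sqrt (T / real L) < x0" if "L \<ge> L0" for L
  proof -
    note L' = L[OF that]
    have "sqrt (T / real L) < sqrt (x0\<^sup>2)" using L' by (intro real_sqrt_less_mono) (simp add: a_def)
    then show "L > 0 \<and> sqrt (T / real L) < x0" using L' x0 by simp
  qed
  moreover have "AE \<omega> in P. \<not> (\<forall>L\<ge>L0. \<exists>n0. \<forall>n\<ge>n0. \<omega> \<in> ?E L n)"
  proof (rule AE_not_eventually_in_small_events[where ?n1.0 = n1 and \<beta> = \<beta>])
    fix L n assume Ln: "L \<ge> L0" "n \<ge> n1"
    show "?E L n \<in> events" using E_sets[OF Ln] by auto
    define \<epsilon> \<delta> where "\<epsilon> = T / real L" and "\<delta> = \<epsilon> / real n"
    have \<epsilon>: "\<epsilon> > 0" "2 * \<epsilon> \<le> 1" "2 * \<epsilon> \<le> s0"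
    proof -
      have "\<epsilon> > 0" "\<epsilon> < a" using L[OF Ln(1)] by (simp_all add: \<epsilon>_def)
      then show "\<epsilon> > 0" "2 * \<epsilon> \<le> 1" "2 * \<epsilon> \<le> s0" by (auto simp: a_def)
    qed
    have n: "real n \<ge> 1" "D / (2 * \<kappa>) < real n" using n_pos[OF Ln(2)] by auto
    have n\<delta>: "\<epsilon> = real n * \<delta>" using n by (simp add: \<delta>_def)
    have \<delta>: "\<delta> > 0" using \<epsilon> n by (simp add: \<delta>_def)
    have \<delta>_le: "\<delta> \<le> \<epsilon>" using n \<delta> unfolding n\<delta> by (simp add: mult_le_cancel_right1)
    have "D \<le> 2 * \<kappa> * real n" using n(2) \<kappa> by (simp add: divide_less_eq mult_ac)
    then have D\<delta>: "D * \<delta> \<le> 2 * \<kappa> * \<epsilon>" using \<delta> unfolding n\<delta> by (simp add: mult.assoc[symmetric])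
    have "prob (?E L n) \<le> (\<Sum>b\<in>{1..L}. prob (block_event P B G K \<gamma> A k x0 \<delta> \<epsilon> (b * n)))"
      unfolding \<delta>_def \<epsilon>_def using E_sets[OF Ln] by (intro finite_measure_subadditive_finite) auto
    also have "\<dots> \<le> (\<Sum>b\<in>{1..L}. C * \<epsilon> powr (D / 2))"
    proof (rule sum_mono)
      fix b assume b: "b \<in> {1..L}"
      have "emeasure P (block_event P B G K \<gamma> A k x0 \<delta> \<epsilon> (b * n)) \<le> ennreal (C * \<epsilon> powr (D / 2))"
        unfolding C_def
        by (rule block_event_probability[OF P B ind G x0 \<epsilon> \<delta> \<delta>_le D\<delta>]) (use b n in auto)
      then show "prob (block_event P B G K \<gamma> A k x0 \<delta> \<epsilon> (b * n)) \<le> C * \<epsilon> powr (D / 2)"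
        using block_constant_nonneg[of x0] by (simp add: emeasure_eq_measure C_def)
    qed
    also have "\<dots> = \<beta> L"
    proof -
      have "real L * \<epsilon> powr (D / 2) = real L * (\<epsilon> powr (D / 2 - 1) * \<epsilon>)"
        using \<epsilon> by (simp add: powr_diff)
      also have "\<dots> = T * \<epsilon> powr (D / 2 - 1)" using L[OF Ln(1)] by (simp add: \<epsilon>_def)
      finally show ?thesis by (simp add: \<beta>_def \<epsilon>_def mult_ac)
    qed
    finally show "prob (?E L n) \<le> \<beta> L" .
  next
    have "(\<lambda>L. T / real L) \<longlonglongrightarrow> 0" by (rule lim_const_over_n)
    then have "(\<lambda>L. (T / real L) powr (D / 2 - 1)) \<longlonglongrightarrow> 0"
      using D T by (intro tendsto_zero_powrI[where b = "D / 2 - 1"]) auto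
    then have "(\<lambda>L. C * T * (T / real L) powr (D / 2 - 1)) \<longlonglongrightarrow> C * T * 0" by (intro tendsto_intros)
    then show "\<beta> \<longlonglongrightarrow> 0" unfolding \<beta>_def[abs_def] by simp
  qed
  ultimately show ?thesis by (intro exI[of _ L0] conjI allI impI) simp_all
qed

lemma holder_on_subset: "holder_on \<alpha> S f \<Longrightarrow> S' \<subseteq> S \<Longrightarrow> holder_on \<alpha> S' f"
  unfolding holder_on_def by (meson subsetD)

text \<open>The exponent and the constant of a random path are random; this reduces them to countably many deterministic
pairs.\<close>

lemma holder_on_imp_countable_scale:
  assumes f: "holder_on \<gamma> {0..T} f" and \<gamma>: "\<gamma> > 1/2"
  obtains N :: nat where "\<And>s t. 0 \<le> s \<Longrightarrow> s \<le> t \<Longrightarrow> t \<le> T \<Longrightarrow> \<bar>f t - f s\<bar> \<le> real N * (t - s) powr (1 / 2 + 1 / (real N + 2))"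
proof -
  obtain C where C: "C \<ge> 0" "\<And>s t. s \<in> {0..T} \<Longrightarrow> t \<in> {0..T} \<Longrightarrow> \<bar>f t - f s\<bar> \<le> C * \<bar>t - s\<bar> powr \<gamma>"
    using holder_onE[OF f] by metis
  define R where "R = max 1 T"
  obtain N :: nat where N: "max (1 / (\<gamma> - 1 / 2)) (C * R powr \<gamma>) < real N" using reals_Archimedean2 by blast
  define \<gamma>' where "\<gamma>' = 1 / 2 + 1 / (real N + 2)"
  have "1 < real N * (\<gamma> - 1 / 2)" using N \<gamma> by (simp add: divide_less_eq mult.commute)
  also have "\<dots> \<le> (real N + 2) * (\<gamma> - 1 / 2)" using \<gamma> by (intro mult_right_mono) auto
  finally have "1 / (real N + 2) \<le> \<gamma> - 1 / 2" by (simp add: divide_le_eq mult.commute add_pos_nonneg)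
  then have \<gamma>': "\<gamma>' \<le> \<gamma>" "0 < \<gamma>'" by (auto simp: \<gamma>'_def add_pos_nonneg)
  show ?thesis
  proof (rule that[of N])
    fix s t assume st: "0 \<le> s" "s \<le> t" "t \<le> T"
    have "\<bar>f t - f s\<bar> \<le> C * (t - s) powr \<gamma>" using C(2)[of s t] st by simp
    also have "(t - s) powr \<gamma> = (t - s) powr (\<gamma> - \<gamma>') * (t - s) powr \<gamma>'"
      by (simp add: powr_add[symmetric])
    also have "C * \<dots> \<le> C * (R powr \<gamma> * (t - s) powr \<gamma>')"
    proof (intro mult_left_mono mult_right_mono C(1))
      have "(t - s) powr (\<gamma> - \<gamma>') \<le> R powr (\<gamma> - \<gamma>')"
        using st \<gamma>' by (intro powr_mono2) (auto simp: R_def)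
      also have "\<dots> \<le> R powr \<gamma>" using \<gamma>' by (intro powr_mono) (auto simp: R_def)
      finally show "(t - s) powr (\<gamma> - \<gamma>') \<le> R powr \<gamma>" .
    qed simp
    also have "\<dots> = (C * R powr \<gamma>) * (t - s) powr \<gamma>'" by simp
    also have "\<dots> \<le> real N * (t - s) powr \<gamma>'" using N by (intro mult_right_mono) auto
    finally show "\<bar>f t - f s\<bar> \<le> real N * (t - s) powr (1 / 2 + 1 / (real N + 2))" by (simp add: \<gamma>'_def)
  qed
qed

lemma first_zero:
  fixes r :: "real \<Rightarrow> real"
  assumes cont: "continuous_on {0..} r" and nonneg: "\<And>t. 0 \<le> t \<Longrightarrow> 0 \<le> r t" and "r 0 > 0"
    and t: "0 \<le> t" "r t = 0"
  obtains \<tau> where "0 < \<tau>" "r \<tau> = 0" "\<And>u. 0 \<le> u \<Longrightarrow> u < \<tau> \<Longrightarrow> r u > 0"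
proof -
  define S where "S = {u \<in> {0..t}. r u = 0}"
  have "closed S" unfolding S_def
    by (intro continuous_closed_preimage_constant continuous_on_subset[OF cont]) auto
  moreover have "bounded S" by (rule bounded_subset[of "{0..t}"]) (auto simp: S_def)
  ultimately have "compact S" by (simp add: compact_eq_bounded_closed)
  moreover have "t \<in> S" using t by (simp add: S_def)
  ultimately obtain \<tau> where \<tau>: "\<tau> \<in> S" "\<And>u. u \<in> S \<Longrightarrow> \<tau> \<le> u"
    using compact_attains_inf[of S] by blast
  show ?thesis
  proof (rule that[of \<tau>])
    show "r \<tau> = 0" using \<tau> by (simp add: S_def)
    then show "0 < \<tau>" using \<tau>(1) \<open>r 0 > 0\<close> by (cases "\<tau> = 0") (auto simp: S_def)
    fix u assume u: "0 \<le> u" "u < \<tau>"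
    then have "u \<notin> S" using \<tau>(2)[of u] by auto
    then have "r u \<noteq> 0" using u \<tau>(1) by (auto simp: S_def)
    then show "r u > 0" using nonneg[of u] u by simp
  qed
qed

theorem theorem3p3:
  fixes P :: "'w measure"
    and B BH r :: "real \<Rightarrow> 'w \<Rightarrow> real"
    and MM :: "real \<Rightarrow> real \<Rightarrow> 'w \<Rightarrow> real"
    and k \<theta> \<sigma> H \<alpha> r0 :: real
  assumes "prob_space P"
    and "k > 0" and "\<theta> > 0" and "\<sigma> > 0"
    and "1/2 < H" and "H < 1"
    and feller: "2 * k * \<theta> > \<sigma>\<^sup>2"
    and "standard_brownian_motion P B"
    and "fractional_brownian_motion P H BH"
    and "independent_processes P B BH"
    and "ito_rough_lift P B BH MM"
    and "1/3 < \<alpha>" and "\<alpha> < 1/2"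
    and "r0 > 0"
    and "solves_rde_until_zero P \<alpha> k \<theta> \<sigma> r0 (\<lambda>t \<omega>. B t \<omega> + BH t \<omega>) MM r"
  shows "AE \<omega> in P. \<forall>t\<ge>0. r t \<omega> > 0"
proof -
  interpret prob_space P by fact
  note B = \<open>standard_brownian_motion P B\<close> and lift = \<open>ito_rough_lift P B BH MM\<close>
  define A x0 where "A = 2 * k * \<theta> / \<sigma>\<^sup>2 - 1 / 2" and "x0 = 2 * sqrt r0 / \<sigma>"
  \<comment> \<open>the Hoelder exponents of \<open>holder_on_imp_countable_scale\<close>, indexed together with the constant \<open>K\<close>\<close>
  define \<gamma> where "\<gamma> K = 1 / 2 + 1 / (real K + 2)" for K :: nat
  have A: "A > 1/2" using feller \<open>\<sigma> > 0\<close> by (simp add: A_def field_simps)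
  have x0: "x0 > 0" using \<open>r0 > 0\<close> \<open>\<sigma> > 0\<close> by (simp add: x0_def)
  have \<gamma>: "1/2 < \<gamma> K" "\<gamma> K \<le> 1" for K by (auto simp: \<gamma>_def field_simps)
  have BH_proc: "continuous_process P BH"
    using \<open>fractional_brownian_motion P H BH\<close> by (simp add: fractional_brownian_motion_def)
  have B_proc: "continuous_process P B" using B by (simp add: standard_brownian_motion_def)
  have BH_meas: "\<And>t. 0 \<le> t \<Longrightarrow> BH t \<in> borel_measurable P" using BH_proc by (simp add: continuous_process_def)
  let ?E = "\<lambda>N K L n \<omega>. \<omega> \<in> (\<Union>b\<in>{1..L}. block_event P B BH (real K) (\<gamma> K) A (k / 2) x0
      (real (Suc N) / real L / real n) (real (Suc N) / real L) (b * n))"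
  define Q where "Q N K L0 \<longleftrightarrow> (\<forall>L\<ge>L0. L > 0 \<and> sqrt (real (Suc N) / real L) < x0) \<and>
      (AE \<omega> in P. \<not> (\<forall>L\<ge>L0. \<exists>n0. \<forall>n\<ge>n0. ?E N K L n \<omega>))" for N K L0 :: nat
  have Q_ex: "\<exists>L0. Q N K L0" for N K
  proof -
    have k2: "k / 2 \<ge> 0" using \<open>k > 0\<close> by simp
    have T: "real (Suc N) > 0" by simp
    show ?thesis
      unfolding Q_def
      by (rule AE_not_eventually_in_block_events[OF \<open>prob_space P\<close> B \<open>independent_processes P B BH\<close> BH_meas
            A k2 of_nat_0_le_iff \<gamma> x0 T])
  qed
  define L0 where "L0 N K = (SOME L0. Q N K L0)" for N K
  have Q: "Q N K (L0 N K)" for N K unfolding L0_def by (rule someI_ex[OF Q_ex])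
  have L0: "L > 0 \<and> sqrt (real (Suc N) / real L) < x0" if "L \<ge> L0 N K" for N K L
    using Q[unfolded Q_def, THEN conjunct1] that by simp
  have L0_AE: "AE \<omega> in P. \<not> (\<forall>L\<ge>L0 N K. \<exists>n0. \<forall>n\<ge>n0. ?E N K L n \<omega>)" for N K
    using Q[unfolded Q_def, THEN conjunct2] .
  have blocks: "AE \<omega> in P. \<forall>N K. \<not> (\<forall>L\<ge>L0 N K. \<exists>n0. \<forall>n\<ge>n0. ?E N K L n \<omega>)"
    by (simp only: AE_all_countable) (intro allI L0_AE)
  have lift_AE: "AE \<omega> in P. \<forall>N::nat. holder_on \<alpha> {0..real (Suc N)} (\<lambda>t. B t \<omega> + BH t \<omega>) \<and>
    (\<forall>s t. 0 \<le> s \<and> s \<le> t \<and> t \<le> real (Suc N) \<longrightarrow>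
      MM s t \<omega> = (((B t \<omega> + BH t \<omega>) - (B s \<omega> + BH s \<omega>))\<^sup>2 - (t - s)) / 2)"
    unfolding AE_all_countable
    by (intro allI ito_rough_lift_formula[OF B lift]) (use \<open>1/3 < \<alpha>\<close> \<open>\<alpha> < 1/2\<close> in auto)
  have holder_AE: "AE \<omega> in P. \<forall>N::nat. \<exists>\<gamma>>1/2. holder_on \<gamma> {0..real (Suc N)} (\<lambda>t. BH t \<omega>)"
    unfolding AE_all_countable by (intro allI ito_rough_lift_imp_holder[OF lift]) simp
  have B_cont: "AE \<omega> in P. continuous_on {0..} (\<lambda>t. B t \<omega>)" using B_proc by (simp add: continuous_process_def)
  have BH_cont: "AE \<omega> in P. continuous_on {0..} (\<lambda>t. BH t \<omega>)" using BH_proc by (simp add: continuous_process_def)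
  note sol = \<open>solves_rde_until_zero P \<alpha> k \<theta> \<sigma> r0 (\<lambda>t \<omega>. B t \<omega> + BH t \<omega>) MM r\<close>
    [unfolded solves_rde_until_zero_def continuous_process_def]
  note r_cont = sol[THEN conjunct1, THEN conjunct2] and r_nonneg = sol[THEN conjunct2, THEN conjunct1]
    and r_0 = sol[THEN conjunct2, THEN conjunct2, THEN conjunct1]
    and r_sol = sol[THEN conjunct2, THEN conjunct2, THEN conjunct2]
  show ?thesis
    using AE_space blocks lift_AE holder_AE B_cont BH_cont r_cont r_nonneg r_0 r_sol
  proof eventually_elim
    case (elim \<omega>)
    show ?case
    proof (rule ccontr)
      assume "\<not> (\<forall>t\<ge>0. r t \<omega> > 0)"
      then obtain t where t: "0 \<le> t" "\<not> r t \<omega> > 0" by blast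
      then have "r t \<omega> = 0" using elim(8) by (simp add: antisym)
      then obtain \<tau> where \<tau>: "0 < \<tau>" "r \<tau> \<omega> = 0" and pos: "\<And>u. 0 \<le> u \<Longrightarrow> u < \<tau> \<Longrightarrow> r u \<omega> > 0"
        using first_zero[OF elim(7), of t] elim(8,9) t(1) \<open>r0 > 0\<close> by auto
      obtain N :: nat where N: "\<tau> < real N" using reals_Archimedean2 by blast
      have hit: "ereal s < zero_hitting_time r \<omega>" if s: "s < \<tau>" for s
      proof -
        have "ereal \<tau> \<le> zero_hitting_time r \<omega>"
          unfolding zero_hitting_time_def
        proof (rule Inf_greatest)
          fix x assume "x \<in> {ereal t |t. 0 < t \<and> r t \<omega> = 0}"
          then obtain u where "x = ereal u" "0 < u" "r u \<omega> = 0" by blast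
          then show "ereal \<tau> \<le> x" using pos[of u] by (cases "u < \<tau>") auto
        qed
        then show ?thesis using s by (meson ereal_less(2) less_ereal.simps(1) less_le_trans)
      qed
      obtain \<gamma>0 where "\<gamma>0 > 1/2" "holder_on \<gamma>0 {0..real (Suc N)} (\<lambda>t. BH t \<omega>)" using elim(4) by blast
      then obtain K :: nat where K: "\<And>s t. 0 \<le> s \<Longrightarrow> s \<le> t \<Longrightarrow> t \<le> real (Suc N) \<Longrightarrow>
          \<bar>BH t \<omega> - BH s \<omega>\<bar> \<le> real K * (t - s) powr \<gamma> K"
        unfolding \<gamma>_def using holder_on_imp_countable_scale by metis
      define X where "X u = 2 * sqrt (r u \<omega>) / \<sigma>" for u
      have X0: "X 0 = x0" using elim(9) by (simp add: X_def x0_def)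
      have \<tau>_N: "\<tau> \<le> real (Suc N)" using N by simp
      have X_eq: "X t - X s = integral {s..t} (\<lambda>u. A / X u - k / 2 * X u) + ((B t \<omega> + BH t \<omega>) - (B s \<omega> + BH s \<omega>))"
        if st: "0 \<le> s" "s \<le> t" "t < \<tau>" for s t
        unfolding X_def A_def
      proof (rule sqrt_solves_bessel_equation[where T = t and XX = "\<lambda>u v. MM u v \<omega>"])
        show "continuous_on {0..t} (\<lambda>u. r u \<omega>)" by (rule continuous_on_subset[OF elim(7)]) auto
        show "r u \<omega> > 0" if "0 \<le> u" "u \<le> t" for u using pos that st by simp
        have "holder_on \<alpha> {0..real (Suc N)} (\<lambda>t. B t \<omega> + BH t \<omega>)" using elim(3) by blast
        then show "holder_on \<alpha> {0..t} (\<lambda>t. B t \<omega> + BH t \<omega>)"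
          by (rule holder_on_subset) (use st \<tau>_N in auto)
        show "MM u v \<omega> = (((B v \<omega> + BH v \<omega>) - (B u \<omega> + BH u \<omega>))\<^sup>2 - (v - u)) / 2"
          if "0 \<le> u" "u \<le> v" "v \<le> t" for u v
          using elim(3)[THEN spec[where x = N]] that st \<tau>_N by simp
        show "\<exists>J. has_rough_integral \<alpha> u (\<lambda>t. B t \<omega> + BH t \<omega>) (\<lambda>u v. MM u v \<omega>) (\<lambda>u. \<sigma> * sqrt (r u \<omega>)) (\<lambda>u. \<sigma>\<^sup>2 / 2) J \<and>
            r u \<omega> = r0 + integral {0..u} (\<lambda>u. k * (\<theta> - r u \<omega>)) + J" if "0 \<le> u" "u \<le> t" for u
          using elim(10)[THEN spec[where x = u], THEN mp, THEN mp, THEN conjunct2] hit[of u] that st by simp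
      qed (use \<open>\<sigma> > 0\<close> \<open>1/3 < \<alpha>\<close> \<open>\<alpha> < 1/2\<close> st in auto)
      have "\<exists>n0. \<forall>n\<ge>n0. ?E N K L n \<omega>" if "L \<ge> L0 N K" for L
        unfolding X0[symmetric]
      proof (rule hitting_path_in_block_events[where \<tau> = \<tau>])
        show "L > 0" "sqrt (real (Suc N) / real L) < X 0" using L0[OF that] X0 by auto
        show "X u > 0" if "0 \<le> u" "u < \<tau>" for u using pos[OF that] \<open>\<sigma> > 0\<close> by (simp add: X_def)
        show "continuous_on {0..\<tau>} X" unfolding X_def[abs_def] using \<open>\<sigma> > 0\<close>
          by (intro continuous_intros continuous_on_subset[OF elim(7)]) auto
        show "continuous_on {0..\<tau>} (\<lambda>t. B t \<omega> + BH t \<omega>)"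
          by (intro continuous_intros continuous_on_subset[OF elim(5)] continuous_on_subset[OF elim(6)]) auto
        show "X \<tau> = 0" using \<tau> by (simp add: X_def)
      qed (use A \<open>k > 0\<close> elim(1) \<tau> \<tau>_N X_eq K in auto)
      then show False using elim(2) by blast
    qed
  qed
qed

end
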